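(* For every $p\in\mathbb{N}$, the parameterized problems $[0,1]$-$\textsc{Parmax}_p$ and $[-1,1]$-$\textsc{Parmax}_p$ are in FPT.
   Context: For $p\in\mathbb{N}$, $\|x\|_p=(\sum_i|x_i|^p)^{1/p}$. $[0,1]$-$\textsc{Parmax}_p$: Input: $d\in\mathbb{N}$, $\gamma\in\mathbb{Q}$, linearly independent $v_1,\dots,v_d\in\mathbb{Q}^d$. Parameter: $d$. Question: is $\max\{\|x\|_p^p: x\in\sum_{i=1}^d[0,1]v_i\}\ge\gamma$? $[-1,1]$-$\textsc{Parmax}_p$: same input and parameter; question: is $\max\{\|x\|_p^p:x\in\sum_{i=1}^d[-1,1]v_i\}\ge\gamma$? Here $\sum_i[a,b]v_i$ denotes the Minkowski sum of the segments $\{\lambda v_i:\lambda\in[a,b]\}$. *)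

theory Defs
  imports
    Complex_Main
    "HOL-Library.Log_Nat"
    "HOL-Library.Set_Algebras"
    "Jordan_Normal_Form.VS_Connect"
begin

section \<open>Random access machines with logarithmic cost\<close>

text \<open>The random access machine of Aho, Hopcroft and Ullman (``The Design and Analysis of
  Computer Algorithms'', Section 1.2--1.3) under the logarithmic cost criterion, which is
  polynomially equivalent to the Turing machine. Registers hold integers, register \<open>0\<close> is the
  accumulator, the input is read from left to right from a one-way tape of integers. Instead of
  using an output tape, the result of a computation is the content of the accumulator when
  \<open>Halt\<close> is executed.\<close>

datatype address = Dir nat | Ind nat

datatype operand = Imm int | At address

datatype instr =
    Load operand
  | Store address
  | Add operand
  | Sub operand
  | Mult operand
  | Div operand
  | Read address
  | Jump nat
  | JumpGtz nat
  | JumpZero nat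
  | Halt

type_synonym program = "instr list"
type_synonym registers = "nat \<Rightarrow> int"

text \<open>Program counter, registers, unread part of the input tape.\<close>
type_synonym config = "nat \<times> registers \<times> int list"

text \<open>The logarithmic cost of an integer: \<open>1\<close> for \<open>0\<close>, and \<open>\<lfloor>log 2 \<bar>z\<bar>\<rfloor> + 1\<close> otherwise.\<close>
definition len :: "int \<Rightarrow> nat" where
  "len z = max 1 (floorlog 2 (nat \<bar>z\<bar>))"

text \<open>\<open>None\<close>: indirect addressing through a register with negative content, which is illegal.\<close>
fun target :: "registers \<Rightarrow> address \<Rightarrow> nat option" where
  "target r (Dir i) = Some i"
| "target r (Ind i) = (if r i \<ge> 0 then Some (nat (r i)) else None)"

fun address_cost :: "registers \<Rightarrow> address \<Rightarrow> nat" where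
  "address_cost r (Dir i) = len (int i)"
| "address_cost r (Ind i) = len (int i) + len (r i)"

fun fetch :: "registers \<Rightarrow> operand \<Rightarrow> int option" where
  "fetch r (Imm z) = Some z"
| "fetch r (At a) = map_option r (target r a)"

fun operand_cost :: "registers \<Rightarrow> operand \<Rightarrow> nat" where
  "operand_cost r (Imm z) = len z"
| "operand_cost r (At a) = address_cost r a + (case target r a of None \<Rightarrow> 0 | Some i \<Rightarrow> len (r i))"

definition arith_step ::
  "(int \<Rightarrow> int \<Rightarrow> int) \<Rightarrow> operand \<Rightarrow> config \<Rightarrow> (nat \<times> config) option" where
  "arith_step f a = (\<lambda>(pc, r, xs).
     map_option (\<lambda>v. (len (r 0) + operand_cost r a, (Suc pc, r(0 := f (r 0) v), xs)))
       (fetch r a))"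

text \<open>Cost and successor configuration of one instruction. Reading beyond the end of the input
  yields the endmarker \<open>0\<close>.\<close>
fun ram_step :: "instr \<Rightarrow> config \<Rightarrow> (nat \<times> config) option" where
  "ram_step (Load a) (pc, r, xs) =
     map_option (\<lambda>v. (operand_cost r a, (Suc pc, r(0 := v), xs))) (fetch r a)"
| "ram_step (Store a) (pc, r, xs) =
     map_option (\<lambda>i. (len (r 0) + address_cost r a, (Suc pc, r(i := r 0), xs))) (target r a)"
| "ram_step (Add a) c = arith_step (+) a c"
| "ram_step (Sub a) c = arith_step (-) a c"
| "ram_step (Mult a) c = arith_step (*) a c"
| "ram_step (Div a) c = arith_step (div) a c"
| "ram_step (Read a) (pc, r, xs) =
     (let x = (case xs of [] \<Rightarrow> 0 | x # _ \<Rightarrow> x) in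
      map_option (\<lambda>i. (len x + address_cost r a, (Suc pc, r(i := x), tl xs))) (target r a))"
| "ram_step (Jump l) (pc, r, xs) = Some (1, (l, r, xs))"
| "ram_step (JumpGtz l) (pc, r, xs) =
     Some (len (r 0), (if r 0 > 0 then l else Suc pc, r, xs))"
| "ram_step (JumpZero l) (pc, r, xs) =
     Some (len (r 0), (if r 0 = 0 then l else Suc pc, r, xs))"
| "ram_step Halt c = None"

text \<open>\<open>halts_with P c t v\<close>: from configuration \<open>c\<close>, the program \<open>P\<close> executes \<open>Halt\<close> at total cost
  \<open>t\<close> and with accumulator content \<open>v\<close>. Illegal addresses and program counters outside the program
  do not count as halting.\<close>
inductive halts_with :: "program \<Rightarrow> config \<Rightarrow> nat \<Rightarrow> int \<Rightarrow> bool" for P :: program where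
  halt: "pc < length P \<Longrightarrow> P ! pc = Halt \<Longrightarrow> halts_with P (pc, r, xs) 1 (r 0)"
| step: "pc < length P \<Longrightarrow> ram_step (P ! pc) (pc, r, xs) = Some (s, c) \<Longrightarrow> halts_with P c t v
    \<Longrightarrow> halts_with P (pc, r, xs) (s + t) v"

definition ram_run :: "program \<Rightarrow> int list \<Rightarrow> nat \<Rightarrow> int \<Rightarrow> bool" where
  "ram_run P xs t v \<longleftrightarrow> halts_with P (0, \<lambda>_. 0, xs) t v"


section \<open>Parameterized problems and FPT\<close>

type_synonym parameterized_problem = "(bool list \<times> nat) set"

definition computable_fun :: "(nat \<Rightarrow> nat) \<Rightarrow> bool" where
  "computable_fun f \<longleftrightarrow> (\<exists>P. \<forall>n. \<exists>t. ram_run P [int n] t (int (f n)))"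

text \<open>The parameter is written on the first square of the input tape and is followed by the word.
  Its letters are coded by \<open>1\<close> and \<open>2\<close>, as \<open>0\<close> is the endmarker.\<close>
definition input_tape :: "bool list \<Rightarrow> nat \<Rightarrow> int list" where
  "input_tape w k = int k # map (\<lambda>b. if b then 2 else 1) w"

text \<open>Time \<open>f(k) * poly(\<bar>w\<bar>)\<close> with computable \<open>f\<close>; the summand \<open>1\<close> only concerns the empty word.\<close>
definition FPT :: "parameterized_problem set" where
  "FPT = {L. \<exists>P f c. computable_fun f \<and>
     (\<forall>w k. \<exists>t. ram_run P (input_tape w k) t (if (w, k) \<in> L then 1 else 0)
        \<and> t \<le> f k * (length w + 1) ^ c)}"


section \<open>Encoding of the inputs\<close>

text \<open>Binary digits, least significant first, without leading zeros.\<close>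
fun binary :: "nat \<Rightarrow> bool list" where
  "binary n = (if n = 0 then [] else odd n # binary (n div 2))"

declare binary.simps [simp del]

text \<open>Self-delimiting: a sign bit, then every binary digit of the absolute value preceded by
  \<open>True\<close>, then \<open>False\<close>.\<close>
definition encode_int :: "int \<Rightarrow> bool list" where
  "encode_int z = (z < 0) # concat (map (\<lambda>b. [True, b]) (binary (nat \<bar>z\<bar>))) @ [False]"

text \<open>A rational number is given by any fraction that represents it, reduced or not.\<close>
definition encodes_rat :: "rat \<Rightarrow> bool list \<Rightarrow> bool" where
  "encodes_rat q w \<longleftrightarrow> (\<exists>a b. b > 0 \<and> q = Rat.Fract a b \<and> w = encode_int a @ encode_int b)"

definition encodes_input :: "nat \<Rightarrow> rat \<Rightarrow> rat vec list \<Rightarrow> bool list \<Rightarrow> bool" where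
  "encodes_input d \<gamma> vs w \<longleftrightarrow>
     (\<exists>ws. list_all2 encodes_rat (\<gamma> # concat (map list_of_vec vs)) ws
        \<and> w = encode_int (int d) @ concat ws)"


section \<open>Norm maximization over parallelotopes\<close>

definition p_norm :: "nat \<Rightarrow> real vec \<Rightarrow> real" where
  "p_norm p x = root p (\<Sum>i<dim_vec x. \<bar>x $ i\<bar> ^ p)"

definition segment :: "real \<Rightarrow> real \<Rightarrow> real vec \<Rightarrow> real vec set" where
  "segment a b v = {l \<cdot>\<^sub>v v | l. a \<le> l \<and> l \<le> b}"

text \<open>Addition of sets is the Minkowski sum.\<close>
definition segment_sum :: "nat \<Rightarrow> real \<Rightarrow> real \<Rightarrow> real vec list \<Rightarrow> real vec set" where
  "segment_sum d a b vs = foldr (+) (map (segment a b) vs) {0\<^sub>v d}"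

definition lin_indep_family :: "nat \<Rightarrow> rat vec list \<Rightarrow> bool" where
  "lin_indep_family d vs \<longleftrightarrow> set vs \<subseteq> carrier_vec d \<and> distinct vs
     \<and> \<not> LinearCombinations.module.lin_dep class_ring (module_vec TYPE(rat) d) (set vs)"

text \<open>The problem \<open>[a,b]\<close>-Parmax. The maximum of the (continuous) function over the (nonempty,
  compact) set exists, so \<open>GREATEST\<close> is well-defined here. Words that do not encode an input are
  no-instances.\<close>
definition Parmax :: "real \<Rightarrow> real \<Rightarrow> nat \<Rightarrow> parameterized_problem" where
  "Parmax a b p = {(w, d). d \<ge> 1 \<and> (\<exists>\<gamma> vs.
     length vs = d \<and> lin_indep_family d vs \<and> encodes_input d \<gamma> vs w \<and>
     (GREATEST m. m \<in> (\<lambda>x. p_norm p x ^ p) ` segment_sum d a b (map (map_vec of_rat) vs))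
        \<ge> of_rat \<gamma>)}"

end

(*
  A convex function on a parallelotope attains its maximum at one of the 2^d vertices, so it suffices
  to evaluate the norm at the vertices. Linear independence is decided by elimination without
  divisions: every pivot step at most doubles the length of the entries (up to an additive
  constant), which is harmless because there are only d steps. In general, the length of a number in
  a register grows by one bit with every step that is not a multiplication and doubles with every
  multiplication. The word is parsed without multiplications in time linear in its length, and
  everything else takes a number of steps that depends on d only. Hence it is enough to count steps
  and multiplications in order to bound the logarithmic cost.
*)

theory Submission
  imports Defs
begin

section \<open>Cost of machine runs\<close>

text \<open>The charge of an instruction depends on register contents, so a time bound must be
  available without knowing the data. Therefore the programs are written in a loop language, and the
  loop limits of the decision procedure are fixed beforehand: they are d and 2 ^ d. The numbers of
  steps and of multiplications are then bounded in terms of the parameter alone, whatever the data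
  and the tests are. For the same reason nothing is aborted: a violated condition only sets an error
  flag, and all stages run to the end even on malformed words. Total division and the clipping of
  negative addresses keep the machine running meanwhile. After n letters all lengths are linear in
  n, and so is the number of steps; their product gives the exponent 2. As \<open>FPT\<close> asks
  for a computable f, the bound is brought into the closed form \<open>growth\<close>, for which a
  loop program is given as well. Fractions need not be reduced and no gcd is computed: all entries
  are multiplied by the product of their denominators, which preserves independence and turns the
  question into an inequality between integers.\<close>

lemma len_le_iff: "L \<ge> 1 \<Longrightarrow> len z \<le> L \<longleftrightarrow> \<bar>z\<bar> < 2 ^ L"
  by (auto simp: len_def floorlog_le_iff nat_less_iff)

lemma len_ge_1: "len z \<ge> 1"
  by (simp add: len_def)

fun mults :: "instr \<Rightarrow> nat" where
  "mults (Mult a) = 1"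
| "mults i = 0"

text \<open>The costs \<open>s\<close> are dropped. The two numbers count the steps and the
  multiplications among them; \<open>reach_cost\<close> recovers a bound on the cost from
  these.\<close>

inductive reach :: "program \<Rightarrow> config \<Rightarrow> nat \<Rightarrow> nat \<Rightarrow> config \<Rightarrow> bool" for P where
  reach_refl: "reach P c 0 0 c"
| reach_step: "pc < length P \<Longrightarrow> ram_step (P ! pc) (pc, r, xs) = Some (s, c) \<Longrightarrow> reach P c n m c'
    \<Longrightarrow> reach P (pc, r, xs) (Suc n) (mults (P ! pc) + m) c'"

lemma reach_trans:
  assumes "reach P c n m c'" "reach P c' n' m' c''"
  shows "reach P c (n + n') (m + m') c''"
  using assms by (induction rule: reach.induct) (auto simp: add.assoc intro: reach_step)

lemma reach_one:
  assumes "pc < length P" "ram_step (P ! pc) (pc, r, xs) = Some (s, c)"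
  shows "reach P (pc, r, xs) 1 (mults (P ! pc)) c"
  using reach_step[OF assms reach_refl] by simp

text \<open>The unread tape is included because \<open>Read\<close> moves its integers into
  registers.\<close>

definition bounded :: "nat \<Rightarrow> config \<Rightarrow> bool" where
  "bounded L = (\<lambda>(pc, r, xs). (\<forall>i. len (r i) \<le> L) \<and> (\<forall>x\<in>set xs. len x \<le> L))"

text \<open>Constants of the program text are measured separately: their lengths depend on the
  program only, while register contents are controlled by \<open>bounded\<close>.\<close>

fun address_const :: "address \<Rightarrow> nat" where
  "address_const (Dir i) = len (int i)"
| "address_const (Ind i) = len (int i)"

fun operand_const :: "operand \<Rightarrow> nat" where
  "operand_const (Imm z) = len z"
| "operand_const (At a) = address_const a"

fun instr_const :: "instr \<Rightarrow> nat" where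
  "instr_const (Load a) = operand_const a"
| "instr_const (Store a) = address_const a"
| "instr_const (Add a) = operand_const a"
| "instr_const (Sub a) = operand_const a"
| "instr_const (Mult a) = operand_const a"
| "instr_const (Div a) = operand_const a"
| "instr_const (Read a) = address_const a"
| "instr_const _ = 1"

lemma address_cost_le:
  assumes "\<And>i. len (r i) \<le> L" "address_const a \<le> L"
  shows "address_cost r a \<le> 2 * L"
  using assms by (cases a) (auto intro: order_trans add_mono simp: mult_2)

lemma fetch_bounds:
  assumes "\<And>i. len (r i) \<le> L" "operand_const a \<le> L" "fetch r a = Some v"
  shows "len v \<le> L" "operand_cost r a \<le> 3 * L"
proof -
  show "len v \<le> L" using assms by (cases a) auto
  show "operand_cost r a \<le> 3 * L"
  proof (cases a)
    case (Imm z)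
    with assms show ?thesis by simp
  next
    case (At b)
    from At assms(2) have "address_const b \<le> L" by simp
    with assms(1) have "address_cost r b \<le> 2 * L" by (rule address_cost_le)
    moreover have "(case target r b of None \<Rightarrow> 0 | Some i \<Rightarrow> len (r i)) \<le> L"
      using assms(1) by (auto split: option.split)
    ultimately show ?thesis unfolding At operand_cost.simps by linarith
  qed
qed

lemma len_add_le:
  assumes "len x \<le> L" "len y \<le> L"
  shows "len (x + y) \<le> Suc L" "len (x - y) \<le> Suc L"
proof -
  have "1 \<le> L" using len_ge_1 assms(1) order_trans by blast
  then have "\<bar>x\<bar> < 2 ^ L" "\<bar>y\<bar> < 2 ^ L" "1 \<le> Suc L" using assms len_le_iff by auto
  then show "len (x + y) \<le> Suc L" "len (x - y) \<le> Suc L"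
    by (auto simp: len_le_iff)
qed

lemma len_mult_le:
  assumes "len x \<le> L" "len y \<le> L"
  shows "len (x * y) \<le> 2 * L"
proof -
  have "1 \<le> L" using len_ge_1 assms(1) order_trans by blast
  then have "\<bar>x\<bar> < 2 ^ L" "\<bar>y\<bar> < 2 ^ L" "1 \<le> 2 * L" using assms len_le_iff by auto
  then have "\<bar>x\<bar> * \<bar>y\<bar> < 2 ^ L * 2 ^ L" by (intro mult_strict_mono') auto
  with \<open>1 \<le> 2 * L\<close> show ?thesis by (simp add: len_le_iff abs_mult mult_2 power_add)
qed

text \<open>Only a negative dividend needs care: for a positive divisor the floor is smallest when
  the divisor is 1. Division by 0 gives 0.\<close>

lemma abs_div_le: "\<bar>x div y\<bar> \<le> \<bar>x\<bar>" for x y :: int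
proof -
  have pos: "\<bar>a div b\<bar> \<le> \<bar>a\<bar>" if "b > 0" for a b :: int
  proof (cases "a \<ge> 0")
    case True
    with that show ?thesis
      by (metis abs_of_nonneg div_by_1 less_numeral_extra(1) pos_imp_zdiv_nonneg_iff zdiv_mono2
          int_one_le_iff_zero_less)
  next
    case False
    with that have "a div b < 0" by (simp add: pos_imp_zdiv_neg_iff)
    moreover have "a div b \<ge> a div 1"
      by (rule zdiv_mono2_neg) (use that False in auto)
    ultimately show ?thesis by simp
  qed
  consider "y > 0" | "y = 0" | "y < 0" by linarith
  then show ?thesis
  proof cases
    case 1
    then show ?thesis by (rule pos)
  next
    case 3
    then have "\<bar>(- x) div (- y)\<bar> \<le> \<bar>- x\<bar>" by (intro pos) simp
    then show ?thesis by simp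
  qed simp
qed

lemma len_div_le:
  assumes "len x \<le> L"
  shows "len (x div y) \<le> L"
proof -
  have "1 \<le> L" using len_ge_1 assms(1) order_trans by blast
  then show ?thesis using assms abs_div_le[of x y] by (simp add: len_le_iff)
qed

text \<open>The factor 4 is the worst case of an arithmetic instruction with an indirect operand:
  accumulator, constant address, pointer and addressed register.\<close>

lemma ram_step_bounds:
  assumes "bounded L (pc, r, xs)" "instr_const i \<le> L" "ram_step i (pc, r, xs) = Some (s, c)"
  shows "s \<le> 4 * L" "mults i = 0 \<Longrightarrow> bounded (L + 1) c" "bounded (2 * L) c \<or> mults i = 0"
proof -
  have r: "\<And>i. len (r i) \<le> L" and xs: "\<And>x. x \<in> set xs \<Longrightarrow> len x \<le> L"
    using assms(1) by (auto simp: bounded_def)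
  have L: "1 \<le> L" using len_ge_1 r order_trans by blast
  have r': "\<And>i. len (r i) \<le> Suc L" and xs': "\<And>x. x \<in> set xs \<Longrightarrow> len x \<le> Suc L"
    using r xs le_SucI by blast+
  have r0: "len (r 0) \<le> L" by (rule r)
  have tl: "set (tl xs) \<subseteq> set xs" by (cases xs) auto
  have arith: "len (r 0) + operand_cost r a \<le> 4 * L \<and> bounded L' c"
    if st: "arith_step f a (pc, r, xs) = Some (s, c)" and that: "operand_const a \<le> L" "L \<le> L'"
      "\<And>v. len v \<le> L \<Longrightarrow> len (f (r 0) v) \<le> L'" for f a L'
  proof -
    obtain v where v: "fetch r a = Some v" "c = (Suc pc, r(0 := f (r 0) v), xs)"
      using st by (auto simp: arith_step_def)
    have vL: "len v \<le> L" and oc: "operand_cost r a \<le> 3 * L" using fetch_bounds[OF r that(1) v(1)] by auto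
    have "len (r 0) \<le> L" by (rule r)
    with oc have "len (r 0) + operand_cost r a \<le> 4 * L" by linarith
    moreover have "bounded L' c"
      using that(3)[OF vL] order_trans[OF r that(2)] order_trans[OF xs that(2)]
      unfolding v(2) bounded_def by auto
    ultimately show ?thesis ..
  qed
  have s_arith: "s = len (r 0) + operand_cost r a" if "arith_step f a (pc, r, xs) = Some (s, c)" for f a
    using that by (auto simp: arith_step_def)
  have *: "s \<le> 4 * L \<and> bounded (if mults i = 0 then L + 1 else 2 * L) c"
  proof (cases i)
    case (Load a)
    then obtain v where v: "fetch r a = Some v" "c = (Suc pc, r(0 := v), xs)" "s = operand_cost r a"
      using assms(3) by auto
    have "operand_const a \<le> L" using Load assms(2) by simp
    from fetch_bounds[OF r this v(1)] have "len v \<le> Suc L" "s \<le> 4 * L" using v(3) by auto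
    then show ?thesis unfolding v(2) by (simp add: Load bounded_def r' xs')
  next
    case (Store a)
    then obtain j where j: "c = (Suc pc, r(j := r 0), xs)" "s = len (r 0) + address_cost r a"
      using assms(3) by auto
    have "address_cost r a \<le> 2 * L" using Store assms(2) by (intro address_cost_le r) auto
    with r0 have "s \<le> 4 * L" unfolding j(2) by linarith
    then show ?thesis unfolding j(1) by (simp add: Store bounded_def r' xs')
  next
    case (Add a)
    show ?thesis using arith[of "(+)" a "Suc L"] s_arith[of "(+)" a] Add assms(2,3) r0 len_add_le by auto
  next
    case (Sub a)
    show ?thesis using arith[of "(-)" a "Suc L"] s_arith[of "(-)" a] Sub assms(2,3) r0 len_add_le by auto
  next
    case (Mult a)
    show ?thesis using arith[of "(*)" a "2*L"] s_arith[of "(*)" a] Mult assms(2,3) r0 len_mult_le by auto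
  next
    case (Div a)
    show ?thesis using arith[of "(div)" a "Suc L"] s_arith[of "(div)" a] Div assms(2,3)
        le_SucI[OF len_div_le[OF r0]] by auto
  next
    case (Read a)
    let ?x = "case xs of [] \<Rightarrow> 0 | x # _ \<Rightarrow> x"
    obtain j where j: "c = (Suc pc, r(j := ?x), tl xs)" "s = len ?x + address_cost r a"
      using assms(3) Read by (auto simp: Let_def)
    have "address_cost r a \<le> 2 * L" using Read assms(2) by (intro address_cost_le r) auto
    moreover have "len 0 \<le> L" using L by (simp add: len_def floorlog_def)
    then have x: "len ?x \<le> L" using xs by (cases xs) auto
    ultimately have "s \<le> 4 * L" unfolding j(2) by linarith
    moreover have "\<And>x. x \<in> set (tl xs) \<Longrightarrow> len x \<le> Suc L" using xs' tl by blast
    ultimately show ?thesis unfolding j(1) using le_SucI[OF x] by (simp add: Read bounded_def r')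
  next
    case (Jump l)
    then have "c = (l, r, xs)" "s \<le> 4 * L" using assms(3) L by auto
    then show ?thesis by (simp add: Jump bounded_def r' xs')
  next
    case (JumpGtz l)
    then have "c = (if r 0 > 0 then l else Suc pc, r, xs)" "s \<le> 4 * L" using assms(3) r0 by auto
    then show ?thesis by (simp add: JumpGtz bounded_def r' xs')
  next
    case (JumpZero l)
    then have "c = (if r 0 = 0 then l else Suc pc, r, xs)" "s \<le> 4 * L" using assms(3) r0 by auto
    then show ?thesis by (simp add: JumpZero bounded_def r' xs')
  next
    case Halt
    then show ?thesis using assms(3) by simp
  qed
  show "s \<le> 4 * L" using * by simp
  show "mults i = 0 \<Longrightarrow> bounded (L + 1) c" "bounded (2 * L) c \<or> mults i = 0" using * by (auto split: if_splits)
qed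

text \<open>Between multiplications operand lengths grow only by one bit per step, and a multiplication
  doubles them. Hence counting steps and multiplications suffices to bound the logarithmic cost.\<close>
lemma reach_cost:
  assumes "reach P c n m c'" "bounded L c" "\<And>i. i \<in> set P \<Longrightarrow> instr_const i \<le> L"
  shows "\<exists>t \<le> n * (4 * ((L + n) * 2 ^ m)).
    \<forall>t' v. halts_with P c' t' v \<longrightarrow> halts_with P c (t + t') v"
  using assms
proof (induction arbitrary: L rule: reach.induct)
  case (reach_refl c)
  show ?case by auto
next
  case (reach_step pc r xs s c n m c')
  define L' where "L' = (if mults (P ! pc) = 0 then L + 1 else 2 * L)"
  have i: "instr_const (P ! pc) \<le> L" using reach_step.hyps(1) reach_step.prems(2) by simp
  note b = ram_step_bounds[OF reach_step.prems(1) i reach_step.hyps(2)]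
  have L': "bounded L' c" "L \<le> L'" using b unfolding L'_def by auto
  \<comment> \<open>The quantity \<open>(L + n) * 2 ^ m\<close>, with \<open>n\<close> steps and
    \<open>m\<close> multiplications to come, does not increase: an ordinary step moves one unit
    from \<open>n\<close> to \<open>L\<close>, and a multiplication gives up a factor 2 for doubling
    \<open>L\<close>.\<close>
  have "mults (P ! pc) = 0 \<or> mults (P ! pc) = 1" by (cases "P ! pc") auto
  then have grow: "(L' + n) * 2 ^ m \<le> (L + Suc n) * 2 ^ (mults (P ! pc) + m)"
    by (auto simp: L'_def algebra_simps)
  obtain t where t: "t \<le> n * (4 * ((L' + n) * 2 ^ m))"
    "\<And>t' v. halts_with P c' t' v \<Longrightarrow> halts_with P c (t + t') v"
    using reach_step.IH[of L'] L' reach_step.prems(2) order_trans by blast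
  have "s \<le> 4 * ((L + Suc n) * 2 ^ (mults (P ! pc) + m))"
  proof -
    have "L * 1 \<le> (L + Suc n) * 2 ^ (mults (P ! pc) + m)" by (intro mult_mono) auto
    with b(1) show ?thesis by linarith
  qed
  moreover have "n * (4 * ((L' + n) * 2 ^ m)) \<le> n * (4 * ((L + Suc n) * 2 ^ (mults (P ! pc) + m)))"
    by (intro mult_mono grow) auto
  ultimately have "s + t \<le> Suc n * (4 * ((L + Suc n) * 2 ^ (mults (P ! pc) + m)))"
    using t(1) by (simp only: mult_Suc)
  moreover have "\<forall>t' v. halts_with P c' t' v \<longrightarrow> halts_with P (pc, r, xs) ((s + t) + t') v"
    using t(2) step[OF reach_step.hyps(1,2)] by (auto simp: add.assoc)
  ultimately show ?case by blast
qed

section \<open>A loop language and its compiler\<close>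

datatype atom = C int | V nat

datatype bop = Plus | Minus | Times | Divide

text \<open>Right operands are atoms, so that the accumulator suffices for the evaluation and no
  temporaries are needed.\<close>

datatype exp = Atom atom | Bin exp bop atom

datatype com =
    Skip
  | Asg nat exp
  | Get nat exp
  | Put exp nat
  | Seq com com (infixr \<open>;;\<close> 60)
  | IfPos exp com com
  | IfZero exp com com
  | For nat nat com

type_synonym env = "nat \<Rightarrow> int"

primrec aval :: "atom \<Rightarrow> env \<Rightarrow> int" where
  "aval (C z) v = z"
| "aval (V x) v = v x"

primrec bval :: "bop \<Rightarrow> int \<Rightarrow> int \<Rightarrow> int" where
  "bval Plus = (+)"
| "bval Minus = (-)"
| "bval Times = (*)"
| "bval Divide = (div)"

primrec eval :: "exp \<Rightarrow> env \<Rightarrow> int" where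
  "eval (Atom a) v = aval a v"
| "eval (Bin e b a) v = bval b (eval e v) (aval a v)"

primrec iter :: "(nat \<Rightarrow> 's \<Rightarrow> 's) \<Rightarrow> nat \<Rightarrow> 's \<Rightarrow> 's" where
  "iter f 0 s = s"
| "iter f (Suc n) s = iter f n (f n s)"

text \<open>A state consists of variables and of an array. \<open>Get x e\<close> and \<open>Put e x\<close> access the array cell
  with index \<open>e\<close>; \<open>For x y c\<close> runs \<open>c\<close> with \<open>x = y - 1, \<dots>, 0\<close>.\<close>
primrec run :: "com \<Rightarrow> env \<times> env \<Rightarrow> env \<times> env" where
  "run Skip s = s"
| "run (Asg x e) s = ((fst s)(x := eval e (fst s)), snd s)"
| "run (Get x e) s = ((fst s)(x := snd s (nat (eval e (fst s)))), snd s)"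
| "run (Put e x) s = (fst s, (snd s)(nat (eval e (fst s)) := fst s x))"
| "run (c1 ;; c2) s = run c2 (run c1 s)"
| "run (IfPos e c1 c2) s = (if eval e (fst s) > 0 then run c1 s else run c2 s)"
| "run (IfZero e c1 c2) s = (if eval e (fst s) = 0 then run c1 s else run c2 s)"
| "run (For x y c) s = iter (\<lambda>i s. run c ((fst s)(x := int i), snd s)) (nat (fst s y))
     ((fst s)(x := fst s y), snd s)"

section \<open>Syntactic side conditions and frame properties\<close>

primrec writes :: "com \<Rightarrow> nat set" where
  "writes Skip = {}"
| "writes (Asg x e) = {x}"
| "writes (Get x e) = {x}"
| "writes (Put e x) = {}"
| "writes (c1 ;; c2) = writes c1 \<union> writes c2"
| "writes (IfPos e c1 c2) = writes c1 \<union> writes c2"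
| "writes (IfZero e c1 c2) = writes c1 \<union> writes c2"
| "writes (For x y c) = insert x (writes c)"

primrec puts :: "com \<Rightarrow> bool" where
  "puts Skip = False"
| "puts (Asg x e) = False"
| "puts (Get x e) = False"
| "puts (Put e x) = True"
| "puts (c1 ;; c2) \<longleftrightarrow> puts c1 \<or> puts c2"
| "puts (IfPos e c1 c2) \<longleftrightarrow> puts c1 \<or> puts c2"
| "puts (IfZero e c1 c2) \<longleftrightarrow> puts c1 \<or> puts c2"
| "puts (For x y c) = puts c"

primrec limits :: "com \<Rightarrow> nat set" where
  "limits Skip = {}"
| "limits (Asg x e) = {}"
| "limits (Get x e) = {}"
| "limits (Put e x) = {}"
| "limits (c1 ;; c2) = limits c1 \<union> limits c2"
| "limits (IfPos e c1 c2) = limits c1 \<union> limits c2"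
| "limits (IfZero e c1 c2) = limits c1 \<union> limits c2"
| "limits (For x y c) = insert y (limits c)"

text \<open>The last conjunct ensures that the number of iterations of an inner loop is the same in
  every iteration of the outer one.\<close>
primrec wf_com :: "com \<Rightarrow> bool" where
  "wf_com Skip = True"
| "wf_com (Asg x e) = True"
| "wf_com (Get x e) = True"
| "wf_com (Put e x) = True"
| "wf_com (c1 ;; c2) \<longleftrightarrow> wf_com c1 \<and> wf_com c2"
| "wf_com (IfPos e c1 c2) \<longleftrightarrow> wf_com c1 \<and> wf_com c2"
| "wf_com (IfZero e c1 c2) \<longleftrightarrow> wf_com c1 \<and> wf_com c2"
| "wf_com (For x y c) \<longleftrightarrow> wf_com c \<and> x \<notin> writes c \<and> limits c \<inter> insert x (writes c) = {}"

text \<open>Loops count down, so the index of the invariant is the number of iterations still to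
  come.\<close>

lemma iter_invariant:
  assumes "I n s" "\<And>i s. i < n \<Longrightarrow> I (Suc i) s \<Longrightarrow> I i (f i s)"
  shows "I 0 (iter f n s)"
  using assms by (induction n arbitrary: s) auto

lemma run_frame: "x \<notin> writes c \<Longrightarrow> fst (run c s) x = fst s x"
proof (induction c arbitrary: s)
  case (For y z c)
  show ?case using For.prems
    by (auto simp: For.IH intro!: iter_invariant[where I = "\<lambda>_ s'. fst s' x = fst s x"])
qed auto

lemma run_no_puts: "\<not> puts c \<Longrightarrow> snd (run c s) = snd s"
proof (induction c arbitrary: s)
  case (For y z c)
  show ?case using For.prems
    by (auto simp: For.IH intro!: iter_invariant[where I = "\<lambda>_ s'. snd s' = snd s"])
qed auto

section \<open>Bounds on the numbers of steps and multiplications\<close>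

text \<open>With \<open>fl = True\<close> all steps are counted, with \<open>fl = False\<close> only the multiplications.\<close>
primrec ebnd :: "bool \<Rightarrow> exp \<Rightarrow> nat" where
  "ebnd fl (Atom a) = of_bool fl"
| "ebnd fl (Bin e b a) = ebnd fl e + of_bool (fl \<or> b = Times)"

text \<open>Both branches of a test are charged, and a loop body is charged at the state before the
  loop, which \<open>bnd_cong\<close> justifies. The constants come from the compiled code:
  \<open>Get\<close> and \<open>Put\<close> spend at most 6 steps on the address and 2 on the
  transfer; a loop spends 2 on entry, 3 on exit and 5 per iteration.\<close>

primrec bnd :: "bool \<Rightarrow> com \<Rightarrow> env \<times> env \<Rightarrow> nat" where
  "bnd fl Skip s = 0"
| "bnd fl (Asg x e) s = ebnd fl e + of_bool fl"
| "bnd fl (Get x e) s = ebnd fl e + 8 * of_bool fl"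
| "bnd fl (Put e x) s = ebnd fl e + 8 * of_bool fl"
| "bnd fl (c1 ;; c2) s = bnd fl c1 s + bnd fl c2 (run c1 s)"
| "bnd fl (IfPos e c1 c2) s = ebnd fl e + 2 * of_bool fl + bnd fl c1 s + bnd fl c2 s"
| "bnd fl (IfZero e c1 c2) s = ebnd fl e + 2 * of_bool fl + bnd fl c1 s + bnd fl c2 s"
| "bnd fl (For x y c) s = 5 * of_bool fl + nat (fst s y) * (bnd fl c s + 5 * of_bool fl)"

text \<open>The state enters only through loop limits. These are not written, so by
  \<open>run_frame\<close> agreement on them survives sequential composition.\<close>

lemma bnd_cong:
  assumes "wf_com c" "limits c \<inter> writes c = {}" "\<And>x. x \<in> limits c \<Longrightarrow> fst s x = fst s' x"
  shows "bnd fl c s = bnd fl c s'"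
  using assms
proof (induction c arbitrary: s s')
  case (Seq c1 c2)
  have "bnd fl c1 s = bnd fl c1 s'" by (rule Seq.IH) (use Seq.prems in auto)
  moreover have "bnd fl c2 (run c1 s) = bnd fl c2 (run c1 s')"
  proof (rule Seq.IH)
    fix x assume "x \<in> limits c2"
    then show "fst (run c1 s) x = fst (run c1 s') x"
      using Seq.prems by (subst (1 2) run_frame) auto
  qed (use Seq.prems in auto)
  ultimately show ?case by simp
next
  case (IfPos e c1 c2)
  have "bnd fl c1 s = bnd fl c1 s'" by (rule IfPos.IH) (use IfPos.prems in auto)
  moreover have "bnd fl c2 s = bnd fl c2 s'" by (rule IfPos.IH) (use IfPos.prems in auto)
  ultimately show ?case by simp
next
  case (IfZero e c1 c2)
  have "bnd fl c1 s = bnd fl c1 s'" by (rule IfZero.IH) (use IfZero.prems in auto)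
  moreover have "bnd fl c2 s = bnd fl c2 s'" by (rule IfZero.IH) (use IfZero.prems in auto)
  ultimately show ?case by simp
next
  case (For x y c)
  have "bnd fl c s = bnd fl c s'" by (rule For.IH) (use For.prems in auto)
  then show ?case using For.prems(3) by simp
qed auto

text \<open>A loop multiplies the bound of its body by at most \<open>X\<close>, which raises the
  degree by one. In a sequence the second command still meets the original limits, since the first
  one does not write them.\<close>

lemma bnd_polynomial:
  assumes "wf_com c" "limits c \<inter> writes c = {}"
  shows "\<exists>A e. \<forall>s X. (\<forall>x\<in>limits c. nat (fst s x) \<le> X) \<longrightarrow> bnd fl c s \<le> A * (X + 1) ^ e"
proof -
  have join: "\<exists>A e. \<forall>X::nat. A1 * (X + 1) ^ e1 + A2 * (X + 1) ^ e2 \<le> A * (X + 1) ^ e" for A1 e1 A2 e2 :: nat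
  proof (intro exI allI)
    fix X :: nat
    have "(X + 1) ^ e1 \<le> (X + 1) ^ (e1 + e2)" "(X + 1) ^ e2 \<le> (X + 1) ^ (e1 + e2)"
      by (intro power_increasing; simp)+
    then show "A1 * (X + 1) ^ e1 + A2 * (X + 1) ^ e2 \<le> (A1 + A2) * (X + 1) ^ (e1 + e2)"
      unfolding add_mult_distrib by (intro add_mono mult_left_mono) auto
  qed
  have const: "\<exists>A e. \<forall>s X. P s X \<longrightarrow> (n::nat) \<le> A * (X + 1) ^ e" for P :: "env \<times> env \<Rightarrow> nat \<Rightarrow> bool" and n
    by (rule exI[of _ n], rule exI[of _ 0]) simp
  from assms show ?thesis
  proof (induction c)
    case (Seq c1 c2)
    from Seq.prems have wf: "wf_com c1" "limits c1 \<inter> writes c1 = {}" "wf_com c2" "limits c2 \<inter> writes c2 = {}"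
      by auto
    obtain A1 e1 where 1: "\<And>s X. \<forall>x\<in>limits c1. nat (fst s x) \<le> X \<Longrightarrow> bnd fl c1 s \<le> A1 * (X + 1) ^ e1"
      using Seq.IH(1) wf by blast
    obtain A2 e2 where 2: "\<And>s X. \<forall>x\<in>limits c2. nat (fst s x) \<le> X \<Longrightarrow> bnd fl c2 s \<le> A2 * (X + 1) ^ e2"
      using Seq.IH(2) wf by blast
    obtain A e where A: "\<And>X::nat. A1 * (X + 1) ^ e1 + A2 * (X + 1) ^ e2 \<le> A * (X + 1) ^ e"
      using join by blast
    have "bnd fl (c1 ;; c2) s \<le> A * (X + 1) ^ e" if "\<forall>x\<in>limits (c1 ;; c2). nat (fst s x) \<le> X" for s X
    proof -
      have "bnd fl c1 s \<le> A1 * (X + 1) ^ e1" by (rule 1) (use that in auto)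
      moreover have "bnd fl c2 (run c1 s) \<le> A2 * (X + 1) ^ e2"
      proof (rule 2, rule ballI)
        fix x assume x: "x \<in> limits c2"
        then have "x \<notin> writes c1" using Seq.prems by auto
        with x that show "nat (fst (run c1 s) x) \<le> X" by (simp add: run_frame)
      qed
      ultimately show ?thesis using A[of X] by simp
    qed
    then show ?case by blast
  next
    case (IfPos e c1 c2)
    from IfPos.prems have wf: "wf_com c1" "limits c1 \<inter> writes c1 = {}" "wf_com c2" "limits c2 \<inter> writes c2 = {}"
      by auto
    obtain A1 e1 where 1: "\<And>s X. \<forall>x\<in>limits c1. nat (fst s x) \<le> X \<Longrightarrow> bnd fl c1 s \<le> A1 * (X + 1) ^ e1"
      using IfPos.IH(1) wf by blast
    obtain A2 e2 where 2: "\<And>s X. \<forall>x\<in>limits c2. nat (fst s x) \<le> X \<Longrightarrow> bnd fl c2 s \<le> A2 * (X + 1) ^ e2"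
      using IfPos.IH(2) wf by blast
    obtain A e' where A: "\<And>X::nat. A1 * (X + 1) ^ e1 + A2 * (X + 1) ^ e2 \<le> A * (X + 1) ^ e'"
      using join by blast
    obtain B e'' where B: "\<And>X::nat. A * (X + 1) ^ e' + (ebnd fl e + 2) * (X + 1) ^ 0 \<le> B * (X + 1) ^ e''"
      using join by blast
    have "bnd fl (IfPos e c1 c2) s \<le> B * (X + 1) ^ e''"
      if "\<forall>x\<in>limits (IfPos e c1 c2). nat (fst s x) \<le> X" for s X
    proof -
      have "bnd fl c1 s \<le> A1 * (X + 1) ^ e1" by (rule 1) (use that in auto)
      moreover have "bnd fl c2 s \<le> A2 * (X + 1) ^ e2" by (rule 2) (use that in auto)
      moreover have "(of_bool fl :: nat) \<le> 1" by simp
      ultimately show ?thesis using A[of X] B[of X] by simp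
    qed
    then show ?case by blast
  next
    case (IfZero e c1 c2)
    from IfZero.prems have wf: "wf_com c1" "limits c1 \<inter> writes c1 = {}" "wf_com c2" "limits c2 \<inter> writes c2 = {}"
      by auto
    obtain A1 e1 where 1: "\<And>s X. \<forall>x\<in>limits c1. nat (fst s x) \<le> X \<Longrightarrow> bnd fl c1 s \<le> A1 * (X + 1) ^ e1"
      using IfZero.IH(1) wf by blast
    obtain A2 e2 where 2: "\<And>s X. \<forall>x\<in>limits c2. nat (fst s x) \<le> X \<Longrightarrow> bnd fl c2 s \<le> A2 * (X + 1) ^ e2"
      using IfZero.IH(2) wf by blast
    obtain A e' where A: "\<And>X::nat. A1 * (X + 1) ^ e1 + A2 * (X + 1) ^ e2 \<le> A * (X + 1) ^ e'"
      using join by blast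
    obtain B e'' where B: "\<And>X::nat. A * (X + 1) ^ e' + (ebnd fl e + 2) * (X + 1) ^ 0 \<le> B * (X + 1) ^ e''"
      using join by blast
    have "bnd fl (IfZero e c1 c2) s \<le> B * (X + 1) ^ e''"
      if "\<forall>x\<in>limits (IfZero e c1 c2). nat (fst s x) \<le> X" for s X
    proof -
      have "bnd fl c1 s \<le> A1 * (X + 1) ^ e1" by (rule 1) (use that in auto)
      moreover have "bnd fl c2 s \<le> A2 * (X + 1) ^ e2" by (rule 2) (use that in auto)
      moreover have "(of_bool fl :: nat) \<le> 1" by simp
      ultimately show ?thesis using A[of X] B[of X] by simp
    qed
    then show ?case by blast
  next
    case (For x y c)
    from For.prems have wf: "wf_com c" "limits c \<inter> writes c = {}" by auto
    obtain A1 e1 where 1: "\<And>s X. \<forall>x\<in>limits c. nat (fst s x) \<le> X \<Longrightarrow> bnd fl c s \<le> A1 * (X + 1) ^ e1"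
      using For.IH wf by blast
    obtain A e where A: "\<And>X::nat. A1 * (X + 1) ^ e1 + 10 * (X + 1) ^ 0 \<le> A * (X + 1) ^ e"
      using join by blast
    have "bnd fl (For x y c) s \<le> A * (X + 1) ^ Suc e"
      if "\<forall>z\<in>limits (For x y c). nat (fst s z) \<le> X" for s X
    proof -
      have "bnd fl c s \<le> A1 * (X + 1) ^ e1" by (rule 1) (use that in auto)
      then have b: "bnd fl c s + 5 \<le> A * (X + 1) ^ e" "5 \<le> A * (X + 1) ^ e" using A[of X] by simp_all
      have "bnd fl (For x y c) s \<le> 5 + nat (fst s y) * (bnd fl c s + 5)"
        by (cases fl) (simp_all add: add_mult_distrib2)
      also have "\<dots> \<le> A * (X + 1) ^ e + X * (A * (X + 1) ^ e)"
        by (intro add_mono mult_mono b) (use that in auto)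
      finally show ?thesis by (simp add: algebra_simps)
    qed
    then show ?case by blast
  next
    case Skip
    show ?case unfolding bnd.simps by (rule const)
  next
    case (Asg x e)
    show ?case unfolding bnd.simps by (rule const)
  next
    case (Get x e)
    show ?case unfolding bnd.simps by (rule const)
  next
    case (Put e x)
    show ?case unfolding bnd.simps by (rule const)
  qed
qed

text \<open>Register \<open>0\<close> is the accumulator and register \<open>1\<close> holds computed addresses.\<close>
definition reg :: "nat \<Rightarrow> nat" where
  "reg x = 2 * x + 3"

text \<open>Array cells occupy the even registers from 2 on and variables the odd ones from 3 on, so
  the array is unbounded without a collision.\<close>

definition cell :: "nat \<Rightarrow> nat" where
  "cell j = 2 * j + 2"

primrec catom :: "atom \<Rightarrow> operand" where
  "catom (C z) = Imm z"
| "catom (V x) = At (Dir (reg x))"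

primrec cbop :: "bop \<Rightarrow> operand \<Rightarrow> instr" where
  "cbop Plus = Add"
| "cbop Minus = Sub"
| "cbop Times = Mult"
| "cbop Divide = Div"

primrec cexp :: "exp \<Rightarrow> instr list" where
  "cexp (Atom a) = [Load (catom a)]"
| "cexp (Bin e b a) = cexp e @ [cbop b (catom a)]"

text \<open>A nonpositive index is replaced by 0, which realizes \<open>nat\<close> and avoids
  illegal addresses. The index is doubled by an addition, so that array accesses cost no
  multiplication; the parser relies on this.\<close>

definition caddr :: "nat \<Rightarrow> exp \<Rightarrow> instr list" where
  "caddr n e = cexp e @ [JumpGtz (n + length (cexp e) + 2), Load (Imm 0), Store (Dir 1),
     Add (At (Dir 1)), Add (Imm 2), Store (Dir 1)]"

primrec csize :: "com \<Rightarrow> nat" where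
  "csize Skip = 0"
| "csize (Asg x e) = length (cexp e) + 1"
| "csize (Get x e) = length (cexp e) + 8"
| "csize (Put e x) = length (cexp e) + 8"
| "csize (c1 ;; c2) = csize c1 + csize c2"
| "csize (IfPos e c1 c2) = length (cexp e) + 2 + csize c1 + csize c2"
| "csize (IfZero e c1 c2) = length (cexp e) + 2 + csize c1 + csize c2"
| "csize (For x y c) = csize c + 8"

text \<open>Jump targets are absolute, hence the argument \<open>n\<close>, the address of the first
  instruction. In a conditional the second branch is placed first, because the machine falls through
  when the test fails.\<close>

primrec comp :: "nat \<Rightarrow> com \<Rightarrow> instr list" where
  "comp n Skip = []"
| "comp n (Asg x e) = cexp e @ [Store (Dir (reg x))]"
| "comp n (Get x e) = caddr n e @ [Load (At (Ind 1)), Store (Dir (reg x))]"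
| "comp n (Put e x) = caddr n e @ [Load (At (Dir (reg x))), Store (Ind 1)]"
| "comp n (c1 ;; c2) = comp n c1 @ comp (n + csize c1) c2"
| "comp n (IfPos e c1 c2) = cexp e @ [JumpGtz (n + length (cexp e) + 2 + csize c2)]
     @ comp (n + length (cexp e) + 1) c2
     @ [Jump (n + csize (IfPos e c1 c2))] @ comp (n + length (cexp e) + 2 + csize c2) c1"
| "comp n (IfZero e c1 c2) = cexp e @ [JumpZero (n + length (cexp e) + 2 + csize c2)]
     @ comp (n + length (cexp e) + 1) c2
     @ [Jump (n + csize (IfZero e c1 c2))] @ comp (n + length (cexp e) + 2 + csize c2) c1"
| "comp n (For x y c) = [Load (At (Dir (reg y))), Store (Dir (reg x)), Load (At (Dir (reg x))),
     JumpGtz (n + 5), Jump (n + csize c + 8), Sub (Imm 1), Store (Dir (reg x))]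
     @ comp (n + 7) c @ [Jump (n + 2)]"

lemma length_comp [simp]: "length (comp n c) = csize c"
  by (induction c arbitrary: n) (auto simp: caddr_def)

section \<open>Correctness of the compiler\<close>

primrec code_at :: "program \<Rightarrow> nat \<Rightarrow> instr list \<Rightarrow> bool" where
  "code_at P n [] = True"
| "code_at P n (i # is) \<longleftrightarrow> n < length P \<and> P ! n = i \<and> code_at P (Suc n) is"

lemma code_at_append [simp]: "code_at P n (xs @ ys) \<longleftrightarrow> code_at P n xs \<and> code_at P (n + length xs) ys"
  by (induction xs arbitrary: n) auto

lemma code_at_infix: "P = xs @ ys @ zs \<Longrightarrow> n = length xs \<Longrightarrow> code_at P n ys"
proof (induction ys arbitrary: xs n)
  case (Cons y ys)
  have "code_at P (Suc n) ys" by (rule Cons.IH[of "xs @ [y]"]) (use Cons.prems in auto)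
  then show ?case using Cons.prems by (simp add: nth_append)
qed simp

definition repr :: "env \<times> env \<Rightarrow> registers \<Rightarrow> bool" where
  "repr s r \<longleftrightarrow> (\<forall>x. r (reg x) = fst s x) \<and> (\<forall>j. r (cell j) = snd s j)"

lemma reg_cell_simps [simp]:
  "reg x = reg y \<longleftrightarrow> x = y" "cell i = cell j \<longleftrightarrow> i = j" "reg x \<noteq> cell i" "cell i \<noteq> reg x"
  "reg x \<noteq> 0" "reg x \<noteq> Suc 0" "cell i \<noteq> 0" "cell i \<noteq> Suc 0"
  "0 \<noteq> reg x" "Suc 0 \<noteq> reg x" "0 \<noteq> cell i" "Suc 0 \<noteq> cell i"
  unfolding reg_def cell_def by presburger+

lemma repr_scratch [simp]:
  "repr s (r(0 := z)) = repr s r" "repr s (r(Suc 0 := z)) = repr s r"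
  by (auto simp: repr_def)

lemma repr_reg: "repr s r \<Longrightarrow> repr ((fst s)(x := z), snd s) (r(reg x := z))"
  by (auto simp: repr_def)

lemma repr_cell: "repr s r \<Longrightarrow> repr (fst s, (snd s)(j := z)) (r(cell j := z))"
  by (auto simp: repr_def)

lemma fetch_catom: "repr s r \<Longrightarrow> fetch r (catom a) = Some (aval a (fst s))"
  by (cases a) (auto simp: repr_def)

lemma ram_step_cbop:
  "\<exists>s. ram_step (cbop b a) (pc, r, xs) =
    map_option (\<lambda>v. (s, (Suc pc, r(0 := bval b (r 0) v), xs))) (fetch r a)"
  by (cases b) (auto simp: arith_step_def)

lemma mults_cbop [simp]: "mults (cbop b a) = of_bool (b = Times)"
  by (cases b) auto

lemma reach_cexp:
  assumes "repr s r" "code_at P pc (cexp e)"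
  shows "\<exists>r'. reach P (pc, r, xs) (ebnd True e) (ebnd False e) (pc + length (cexp e), r', xs)
    \<and> repr s r' \<and> r' 0 = eval e (fst s)"
  using assms(2)
proof (induction e)
  case (Atom a)
  let ?r = "r(0 := aval a (fst s))"
  have "reach P (pc, r, xs) 1 (mults (P ! pc)) (Suc pc, ?r, xs)"
    using Atom fetch_catom[OF assms(1)] by (intro reach_one) auto
  then have "reach P (pc, r, xs) (ebnd True (Atom a)) (ebnd False (Atom a)) (pc + length (cexp (Atom a)), ?r, xs)"
    using Atom by simp
  moreover have "repr s ?r" "?r 0 = eval (Atom a) (fst s)" using assms(1) by simp_all
  ultimately show ?case by blast
next
  case (Bin e b a)
  obtain r' where r': "reach P (pc, r, xs) (ebnd True e) (ebnd False e) (pc + length (cexp e), r', xs)"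
    "repr s r'" "r' 0 = eval e (fst s)" using Bin by auto
  let ?r = "r'(0 := eval (Bin e b a) (fst s))"
  have P: "pc + length (cexp e) < length P" "P ! (pc + length (cexp e)) = cbop b (catom a)"
    using Bin.prems by simp_all
  obtain t where "ram_step (cbop b (catom a)) (pc + length (cexp e), r', xs) =
      Some (t, (pc + length (cexp (Bin e b a)), ?r, xs))"
    using ram_step_cbop[of b "catom a" "pc + length (cexp e)" r' xs] r'(3) fetch_catom[OF r'(2)] by auto
  then have "reach P (pc + length (cexp e), r', xs) 1 (mults (P ! (pc + length (cexp e))))
      (pc + length (cexp (Bin e b a)), ?r, xs)"
    using P by (intro reach_one) auto
  from reach_trans[OF r'(1) this]
  have "reach P (pc, r, xs) (ebnd True (Bin e b a)) (ebnd False (Bin e b a)) (pc + length (cexp (Bin e b a)), ?r, xs)"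
    using Bin.prems by simp
  moreover have "repr s ?r" "?r 0 = eval (Bin e b a) (fst s)" using r'(2) by simp_all
  ultimately show ?case by blast
qed

text \<open>Upper bounds instead of exact counts, since different branches take different numbers of
  steps.\<close>

definition rch where
  "rch P c n m c' \<longleftrightarrow> (\<exists>n' m'. n' \<le> n \<and> m' \<le> m \<and> reach P c n' m' c')"

lemma rch_mono: "rch P c n m c' \<Longrightarrow> n \<le> n' \<Longrightarrow> m \<le> m' \<Longrightarrow> rch P c n' m' c'"
  unfolding rch_def using order_trans by blast

lemma rch_trans: "rch P c n m c' \<Longrightarrow> rch P c' n' m' c'' \<Longrightarrow> rch P c (n + n') (m + m') c''"
  unfolding rch_def using reach_trans add_mono by meson

lemma rch_refl: "rch P c 0 0 c"
  unfolding rch_def using reach_refl by blast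

lemma rch_one:
  assumes "pc < length P" "ram_step (P ! pc) (pc, r, xs) = Some (s, c)" "mults (P ! pc) = 0"
  shows "rch P (pc, r, xs) 1 0 c"
  unfolding rch_def using reach_one[OF assms(1,2)] assms(3) by (metis order_refl)

lemma rch_step:
  assumes "pc < length P" "ram_step (P ! pc) (pc, r, xs) = Some (s, c)" "mults (P ! pc) = 0"
    "rch P c n m c'"
  shows "rch P (pc, r, xs) (Suc n) m c'"
  using rch_trans[OF rch_one[OF assms(1-3)] assms(4)] by simp

lemma rch_cexp:
  assumes "repr s r" "code_at P pc (cexp e)"
  obtains r' where "rch P (pc, r, xs) (ebnd True e) (ebnd False e) (pc + length (cexp e), r', xs)"
    "repr s r'" "r' 0 = eval e (fst s)"
  using reach_cexp[OF assms, of xs] unfolding rch_def by blast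

lemma rch_caddr:
  assumes "repr s r" "code_at P pc (caddr pc e)"
  obtains r' where "rch P (pc, r, xs) (ebnd True e + 6) (ebnd False e) (pc + length (cexp e) + 6, r', xs)"
    "repr s r'" "r' 1 = int (cell (nat (eval e (fst s))))"
proof -
  let ?pc = "pc + length (cexp e)"
  let ?z = "eval e (fst s)"
  have "code_at P pc (cexp e)" using assms(2) by (simp add: caddr_def)
  then obtain r' where r': "rch P (pc, r, xs) (ebnd True e) (ebnd False e) (?pc, r', xs)"
    "repr s r'" "r' 0 = ?z"
    by (rule rch_cexp[OF assms(1)])
  let ?r = "r'(0 := int (nat ?z))"
  have "rch P (?pc, r', xs) 2 0 (?pc + 2, ?r, xs)"
  proof (cases "?z > 0")
    case True
    then have "?r = r'" using r'(3) by auto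
    then have "rch P (?pc, r', xs) 1 0 (?pc + 2, ?r, xs)"
      using True r'(3) assms(2) by (intro rch_one) (auto simp: caddr_def)
    then show ?thesis by (rule rch_mono) auto
  next
    case False
    then have "rch P (?pc, r', xs) (Suc (Suc 0)) 0 (?pc + 2, ?r, xs)"
      using r'(3) assms(2) by (auto simp: caddr_def intro!: rch_step rch_refl)
    then show ?thesis by (rule rch_mono) auto
  qed
  moreover
  let ?r' = "?r(1 := int (nat ?z), 0 := 2 * int (nat ?z) + 2, 1 := 2 * int (nat ?z) + 2)"
  have "rch P (?pc + 2, ?r, xs) (Suc (Suc (Suc (Suc 0)))) 0 (?pc + 6, ?r', xs)"
    using assms(2)
    by (auto simp: caddr_def arith_step_def numeral_eq_Suc intro!: rch_step rch_refl)
  ultimately have "rch P (?pc, r', xs) (2 + 4) (0 + 0) (?pc + 6, ?r', xs)"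
    using rch_trans by fastforce
  from rch_trans[OF r'(1) this] have "rch P (pc, r, xs) (ebnd True e + 6) (ebnd False e) (?pc + 6, ?r', xs)"
    by simp
  then show ?thesis by (rule that) (use r'(2) in \<open>auto simp: cell_def\<close>)
qed

text \<open>Compiled code never touches the tape, so it may be embedded in a program that still has
  the rest \<open>xs\<close> to read.\<close>

lemma rch_comp:
  assumes "wf_com c" "repr s r" "code_at P pc (comp pc c)"
  shows "\<exists>r'. rch P (pc, r, xs) (bnd True c s) (bnd False c s) (pc + csize c, r', xs) \<and> repr (run c s) r'"
  using assms
proof (induction c arbitrary: s r pc)
  case Skip
  then show ?case using rch_refl by (intro exI[of _ r]) simp
next
  case (Asg x e)
  then have c: "code_at P pc (cexp e)" by simp
  obtain r' where r': "rch P (pc, r, xs) (ebnd True e) (ebnd False e) (pc + length (cexp e), r', xs)"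
    "repr s r'" "r' 0 = eval e (fst s)" by (rule rch_cexp[OF Asg.prems(2) c])
  let ?r = "r'(reg x := eval e (fst s))"
  have "rch P (pc + length (cexp e), r', xs) 1 0 (pc + csize (Asg x e), ?r, xs)"
    using Asg.prems r'(3) by (intro rch_one) auto
  from rch_trans[OF r'(1) this]
  have "rch P (pc, r, xs) (bnd True (Asg x e) s) (bnd False (Asg x e) s) (pc + csize (Asg x e), ?r, xs)" by simp
  moreover have "repr (run (Asg x e) s) ?r" using repr_reg[OF r'(2)] by simp
  ultimately show ?case by blast
next
  case (Get x e)
  then have c: "code_at P pc (caddr pc e)" by simp
  let ?j = "nat (eval e (fst s))"
  obtain r' where r': "rch P (pc, r, xs) (ebnd True e + 6) (ebnd False e) (pc + length (cexp e) + 6, r', xs)"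
    "repr s r'" "r' 1 = int (cell ?j)" by (rule rch_caddr[OF Get.prems(2) c])
  let ?r = "r'(0 := snd s ?j, reg x := snd s ?j)"
  have "rch P (pc + length (cexp e) + 6, r', xs) (Suc (Suc 0)) 0 (pc + csize (Get x e), ?r, xs)"
    using Get.prems(3) r'(2,3) by (auto simp: caddr_def numeral_eq_Suc repr_def intro!: rch_step rch_refl)
  from rch_trans[OF r'(1) this] have "rch P (pc, r, xs) (bnd True (Get x e) s) (bnd False (Get x e) s) (pc + csize (Get x e), ?r, xs)"
    by (auto elim: rch_mono)
  moreover have "repr (run (Get x e) s) ?r" using repr_reg[of s "r'(0 := snd s ?j)"] r'(2) by simp
  ultimately show ?case by blast
next
  case (Put e x)
  then have c: "code_at P pc (caddr pc e)" by simp
  let ?j = "nat (eval e (fst s))"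
  obtain r' where r': "rch P (pc, r, xs) (ebnd True e + 6) (ebnd False e) (pc + length (cexp e) + 6, r', xs)"
    "repr s r'" "r' 1 = int (cell ?j)" by (rule rch_caddr[OF Put.prems(2) c])
  let ?r = "r'(0 := fst s x, cell ?j := fst s x)"
  have "rch P (pc + length (cexp e) + 6, r', xs) (Suc (Suc 0)) 0 (pc + csize (Put e x), ?r, xs)"
    using Put.prems(3) r'(2,3) by (auto simp: caddr_def numeral_eq_Suc repr_def intro!: rch_step rch_refl)
  from rch_trans[OF r'(1) this] have "rch P (pc, r, xs) (bnd True (Put e x) s) (bnd False (Put e x) s) (pc + csize (Put e x), ?r, xs)"
    by (auto elim: rch_mono)
  moreover have "repr (run (Put e x) s) ?r" using repr_cell[of s "r'(0 := fst s x)"] r'(2) by simp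
  ultimately show ?case by blast
next
  case (Seq c1 c2)
  obtain r1 where r1: "rch P (pc, r, xs) (bnd True c1 s) (bnd False c1 s) (pc + csize c1, r1, xs)"
    "repr (run c1 s) r1" using Seq.IH(1)[of s r pc] Seq.prems by auto
  obtain r2 where "rch P (pc + csize c1, r1, xs) (bnd True c2 (run c1 s)) (bnd False c2 (run c1 s))
      (pc + csize c1 + csize c2, r2, xs)" "repr (run c2 (run c1 s)) r2"
    using Seq.IH(2)[OF _ r1(2), of "pc + csize c1"] Seq.prems by auto
  with rch_trans[OF r1(1) this(1)] show ?case by (auto simp: add.assoc)
next
  case (IfPos e c1 c2)
  let ?pc = "pc + length (cexp e)"
  have c: "code_at P pc (cexp e)" using IfPos.prems by simp
  obtain r' where r': "rch P (pc, r, xs) (ebnd True e) (ebnd False e) (?pc, r', xs)"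
    "repr s r'" "r' 0 = eval e (fst s)" by (rule rch_cexp[OF IfPos.prems(2) c])
  show ?case
  proof (cases "eval e (fst s) > 0")
    case True
    obtain r1 where r1: "rch P (?pc + 2 + csize c2, r', xs) (bnd True c1 s) (bnd False c1 s)
        (?pc + 2 + csize c2 + csize c1, r1, xs)" "repr (run c1 s) r1"
      using IfPos.IH(1)[OF _ r'(2), of "?pc + 2 + csize c2"] IfPos.prems by auto
    have "rch P (?pc, r', xs) (Suc (bnd True c1 s)) (bnd False c1 s) (?pc + 2 + csize c2 + csize c1, r1, xs)"
      using r1(1) IfPos.prems(3) r'(3) True by (intro rch_step) auto
    from rch_trans[OF r'(1) this] show ?thesis using r1(2) True
      by (intro exI[of _ r1] conjI) (auto elim!: rch_mono simp: ac_simps)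
  next
    case False
    obtain r1 where r1: "rch P (?pc + 1, r', xs) (bnd True c2 s) (bnd False c2 s)
        (?pc + 1 + csize c2, r1, xs)" "repr (run c2 s) r1"
      using IfPos.IH(2)[OF _ r'(2), of "?pc + 1"] IfPos.prems by auto
    have "rch P (?pc + 1 + csize c2, r1, xs) 1 0 (pc + csize (IfPos e c1 c2), r1, xs)"
      using IfPos.prems(3) by (intro rch_one) auto
    from rch_trans[OF r1(1) this]
    have "rch P (?pc, r', xs) (Suc (bnd True c2 s + 1)) (bnd False c2 s + 0) (pc + csize (IfPos e c1 c2), r1, xs)"
      using IfPos.prems(3) r'(3) False by (intro rch_step) auto
    from rch_trans[OF r'(1) this] show ?thesis using r1(2) False
      by (intro exI[of _ r1] conjI) (auto elim!: rch_mono)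
  qed
next
  case (IfZero e c1 c2)
  let ?pc = "pc + length (cexp e)"
  have c: "code_at P pc (cexp e)" using IfZero.prems by simp
  obtain r' where r': "rch P (pc, r, xs) (ebnd True e) (ebnd False e) (?pc, r', xs)"
    "repr s r'" "r' 0 = eval e (fst s)" by (rule rch_cexp[OF IfZero.prems(2) c])
  show ?case
  proof (cases "eval e (fst s) = 0")
    case True
    obtain r1 where r1: "rch P (?pc + 2 + csize c2, r', xs) (bnd True c1 s) (bnd False c1 s)
        (?pc + 2 + csize c2 + csize c1, r1, xs)" "repr (run c1 s) r1"
      using IfZero.IH(1)[OF _ r'(2), of "?pc + 2 + csize c2"] IfZero.prems by auto
    have "rch P (?pc, r', xs) (Suc (bnd True c1 s)) (bnd False c1 s) (?pc + 2 + csize c2 + csize c1, r1, xs)"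
      using r1(1) IfZero.prems(3) r'(3) True by (intro rch_step) auto
    from rch_trans[OF r'(1) this] show ?thesis using r1(2) True
      by (intro exI[of _ r1] conjI) (auto elim!: rch_mono simp: ac_simps)
  next
    case False
    obtain r1 where r1: "rch P (?pc + 1, r', xs) (bnd True c2 s) (bnd False c2 s)
        (?pc + 1 + csize c2, r1, xs)" "repr (run c2 s) r1"
      using IfZero.IH(2)[OF _ r'(2), of "?pc + 1"] IfZero.prems by auto
    have "rch P (?pc + 1 + csize c2, r1, xs) 1 0 (pc + csize (IfZero e c1 c2), r1, xs)"
      using IfZero.prems(3) by (intro rch_one) auto
    from rch_trans[OF r1(1) this]
    have "rch P (?pc, r', xs) (Suc (bnd True c2 s + 1)) (bnd False c2 s + 0) (pc + csize (IfZero e c1 c2), r1, xs)"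
      using IfZero.prems(3) r'(3) False by (intro rch_step) auto
    from rch_trans[OF r'(1) this] show ?thesis using r1(2) False
      by (intro exI[of _ r1] conjI) (auto elim!: rch_mono)
  qed
next
  case (For x y c)
  let ?f = "\<lambda>i s. run c ((fst s)(x := int i), snd s)"
  have code: "code_at P (pc + 7) (comp (pc + 7) c)" "pc + 7 + csize c < length P"
    "P ! (pc + 7 + csize c) = Jump (pc + 2)"
    using For.prems(3) by (simp_all add: numeral_eq_Suc)
  \<comment> \<open>The bounds refer to a fixed state \<open>s0\<close> that agrees with every
    intermediate state on the limits of the body, so all iterations cost the same. The case
    \<open>n = 0\<close> with a nonpositive value covers negative limits.\<close>
  have loop: "\<exists>r'. rch P (pc + 2, r, xs) (n * (bnd True c s0 + 5) + 3) (n * bnd False c s0)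
      (pc + csize (For x y c), r', xs) \<and> repr (iter ?f n s) r'"
    if "repr s r" "fst s x = int n \<or> n = 0 \<and> fst s x \<le> 0" "\<And>z. z \<in> limits c \<Longrightarrow> fst s z = fst s0 z"
    for n s r s0
    using that
  proof (induction n arbitrary: s r)
    case 0
    have "r (reg x) \<le> 0" using 0 by (auto simp: repr_def)
    then have "rch P (pc + 2, r, xs) (Suc (Suc (Suc 0))) 0 (pc + csize (For x y c), r(0 := r (reg x)), xs)"
      using For.prems(3) by (auto simp: numeral_eq_Suc intro!: rch_step rch_refl)
    then have "rch P (pc + 2, r, xs) (0 * (bnd True c s0 + 5) + 3) (0 * bnd False c s0)
        (pc + csize (For x y c), r(0 := r (reg x)), xs)" by (simp add: numeral_eq_Suc)
    moreover have "repr (iter ?f 0 s) (r(0 := r (reg x)))" using 0(1) by simp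
    ultimately show ?case by blast
  next
    case (Suc n)
    let ?s = "((fst s)(x := int n), snd s)"
    let ?r = "r(0 := int n, reg x := int n)"
    have x: "r (reg x) = int n + 1" using Suc.prems by (auto simp: repr_def)
    have "rch P (pc + 2, r, xs) (Suc (Suc (Suc (Suc 0)))) 0 (pc + 7, r(0 := int n + 1, 0 := int n, reg x := int n), xs)"
      using For.prems(3) x by (auto simp: numeral_eq_Suc arith_step_def intro!: rch_step rch_refl)
    then have 1: "rch P (pc + 2, r, xs) 4 0 (pc + 7, ?r, xs)" by (simp add: numeral_eq_Suc)
    have rs: "repr ?s ?r" using repr_reg[of s "r(0 := int n)"] Suc.prems(1) by simp
    obtain r1 where r1: "rch P (pc + 7, ?r, xs) (bnd True c ?s) (bnd False c ?s) (pc + 7 + csize c, r1, xs)"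
      "repr (run c ?s) r1"
      using For.IH[OF _ rs code(1)] For.prems(1) by (metis wf_com.simps(8))
    have "rch P (pc + 7 + csize c, r1, xs) 1 0 (pc + 2, r1, xs)"
      using code by (intro rch_one) auto
    note 2 = rch_trans[OF rch_trans[OF 1 r1(1)] this]
    have b: "bnd fl c ?s = bnd fl c s0" for fl
      using For.prems(1) Suc.prems(3) by (intro bnd_cong) auto
    have "\<exists>r'. rch P (pc + 2, r1, xs) (n * (bnd True c s0 + 5) + 3) (n * bnd False c s0)
      (pc + csize (For x y c), r', xs) \<and> repr (iter ?f n (run c ?s)) r'"
    proof (rule Suc.IH[OF r1(2)])
      show "fst (run c ?s) x = int n \<or> n = 0 \<and> fst (run c ?s) x \<le> 0"
        using For.prems(1) by (subst (1 2) run_frame) auto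
      show "fst (run c ?s) z = fst s0 z" if "z \<in> limits c" for z
        using For.prems(1) Suc.prems(3)[OF that] that by (subst run_frame) auto
    qed
    then obtain r2 where r2: "rch P (pc + 2, r1, xs) (n * (bnd True c s0 + 5) + 3) (n * bnd False c s0)
      (pc + csize (For x y c), r2, xs)" "repr (iter ?f n (run c ?s)) r2" by blast
    from rch_trans[OF 2 r2(1)] have "rch P (pc + 2, r, xs) (Suc n * (bnd True c s0 + 5) + 3)
        (Suc n * bnd False c s0) (pc + csize (For x y c), r2, xs)"
      by (rule rch_mono) (auto simp: b)
    moreover have "repr (iter ?f (Suc n) s) r2" using r2(2) unfolding iter.simps .
    ultimately show ?case by blast
  qed
  let ?r = "r(0 := fst s y, reg x := fst s y)"
  have 1: "rch P (pc, r, xs) (Suc (Suc 0)) 0 (pc + 2, ?r, xs)"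
    using For.prems(2,3) by (auto simp: numeral_eq_Suc repr_def intro!: rch_step rch_refl)
  have rs: "repr ((fst s)(x := fst s y), snd s) ?r"
    using repr_reg[of s "r(0 := fst s y)"] For.prems(2) by simp
  have "x \<notin> limits c" using For.prems(1) by auto
  then have "\<exists>r'. rch P (pc + 2, ?r, xs) (nat (fst s y) * (bnd True c s + 5) + 3) (nat (fst s y) * bnd False c s)
      (pc + csize (For x y c), r', xs) \<and> repr (iter ?f (nat (fst s y)) ((fst s)(x := fst s y), snd s)) r'"
    by (intro loop[OF rs]) auto
  then obtain r2 where r2: "rch P (pc + 2, ?r, xs) (nat (fst s y) * (bnd True c s + 5) + 3) (nat (fst s y) * bnd False c s)
      (pc + csize (For x y c), r2, xs)" "repr (run (For x y c) s) r2"
    unfolding run.simps by blast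
  from rch_trans[OF 1 r2(1)] have "rch P (pc, r, xs) (bnd True (For x y c) s) (bnd False (For x y c) s)
      (pc + csize (For x y c), r2, xs)" by (rule rch_mono) auto
  with r2(2) show ?case by blast
qed

section \<open>Programs that read their input letter by letter\<close>

text \<open>Variable \<open>0\<close> receives the first square of the tape, variable \<open>1\<close> the letters one after the
  other, and variable \<open>2\<close> the result.\<close>
definition prog :: "com \<Rightarrow> com \<Rightarrow> program" where
  "prog body post = [Read (Dir (reg 0)), Read (Dir (reg 1)), Load (At (Dir (reg 1))),
     JumpZero (5 + csize body)] @ comp 4 body @ [Jump 1] @ comp (5 + csize body) post
     @ [Load (At (Dir (reg 2))), Halt]"

text \<open>The endmarker is read into variable 1 as well, hence the assignment for the empty
  list.\<close>

primrec consume :: "com \<Rightarrow> int list \<Rightarrow> env \<times> env \<Rightarrow> env \<times> env" where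
  "consume c [] s = ((fst s)(1 := 0), snd s)"
| "consume c (z # zs) s = consume c zs (run c ((fst s)(1 := z), snd s))"

definition after_input :: "com \<Rightarrow> int \<Rightarrow> int list \<Rightarrow> env \<times> env" where
  "after_input body k ls = consume body ls ((\<lambda>_. 0)(0 := k), \<lambda>_. 0)"

text \<open>A letter costs 3 steps for reading and testing it, the body, and 1 step for jumping
  back; the endmarker costs 3. A letter 0 would be mistaken for the endmarker.\<close>

lemma rch_consume:
  assumes "P = prog body post" "wf_com body" "\<And>s. bnd True body s \<le> B" "\<And>s. bnd False body s = 0"
    "repr s r" "0 \<notin> set ls"
  shows "\<exists>r'. rch P (1, r, ls) (length ls * (B + 4) + 3) 0 (5 + csize body, r', [])
    \<and> repr (consume body ls s) r'"
  using assms(5,6)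
proof (induction ls arbitrary: s r)
  case Nil
  let ?r = "r(reg 1 := 0, 0 := 0)"
  have "rch P (1, r, []) (Suc (Suc (Suc 0))) 0 (5 + csize body, ?r, [])"
    by (auto simp: assms(1) prog_def numeral_eq_Suc intro!: rch_step rch_refl)
  then have "rch P (1, r, []) (length [] * (B + 4) + 3) 0 (5 + csize body, ?r, [])"
    by (simp add: numeral_eq_Suc)
  moreover have "repr (consume body [] s) ?r" using repr_reg[OF Nil(1)] by simp
  ultimately show ?case by blast
next
  case (Cons z ls)
  let ?r = "r(reg 1 := z, 0 := z)"
  let ?s = "((fst s)(1 := z), snd s)"
  have "rch P (1, r, z # ls) (Suc (Suc (Suc 0))) 0 (4, ?r, ls)"
    using Cons.prems(2) by (auto simp: assms(1) prog_def numeral_eq_Suc intro!: rch_step rch_refl)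
  then have 1: "rch P (1, r, z # ls) 3 0 (4, ?r, ls)" by (simp add: numeral_eq_Suc)
  have rs: "repr ?s ?r" using repr_reg[OF Cons.prems(1)] by simp
  have "code_at P 4 (comp 4 body)"
    by (rule code_at_infix[of _ "take 4 P"]) (simp_all add: assms(1) prog_def)
  from rch_comp[OF assms(2) rs this, of ls] obtain r1 where
    r1: "rch P (4, ?r, ls) (bnd True body ?s) (bnd False body ?s) (4 + csize body, r1, ls)"
    and rs1: "repr (run body ?s) r1" by blast
  from r1 have 2: "rch P (4, ?r, ls) B 0 (4 + csize body, r1, ls)"
    by (rule rch_mono) (simp_all add: assms(3,4) del: fun_upd_apply)
  have 3: "rch P (4 + csize body, r1, ls) 1 0 (1, r1, ls)"
    by (intro rch_one) (auto simp: assms(1) prog_def nth_append)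
  obtain r2 where 4: "rch P (1, r1, ls) (length ls * (B + 4) + 3) 0 (5 + csize body, r2, [])"
    and rs2: "repr (consume body ls (run body ?s)) r2"
    using Cons.IH[OF rs1] Cons.prems(2) by auto
  from rch_trans[OF rch_trans[OF rch_trans[OF 1 2] 3] 4]
  have "rch P (1, r, z # ls) (length (z # ls) * (B + 4) + 3) 0 (5 + csize body, r2, [])"
    by (rule rch_mono) auto
  moreover have "repr (consume body (z # ls) s) r2" using rs2 unfolding consume.simps .
  ultimately show ?case by blast
qed

lemma ram_run_prog:
  assumes "wf_com body" "wf_com post" "\<And>s. bnd True body s \<le> B" "\<And>s. bnd False body s = 0"
  shows "\<exists>L0. \<forall>k ls. set ls \<subseteq> {1, 2} \<longrightarrow>
    (let s = after_input body k ls; N = length ls * (B + 4) + 5 + bnd True post s; M = bnd False post s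
     in \<exists>t \<le> N * (4 * ((len k + L0 + N) * 2 ^ M)) + 1. ram_run (prog body post) (k # ls) t (fst (run post s) 2))"
proof -
  define P where "P = prog body post"
  \<comment> \<open>The 2 covers the letters and the empty registers, the sum every constant in the
    program text.\<close>
  define L0 where "L0 = 2 + (\<Sum>i\<leftarrow>P. instr_const i)"
  have "\<exists>t \<le> N * (4 * ((len k + L0 + N) * 2 ^ M)) + 1. ram_run P (k # ls) t (fst (run post s) 2)"
    if ls: "set ls \<subseteq> {1, 2}" and s: "s = after_input body k ls"
      and N: "N = length ls * (B + 4) + 5 + bnd True post s" and M: "M = bnd False post s" for k ls s N M
  proof -
    let ?r = "(\<lambda>_. 0)(reg 0 := k)"
    let ?s = "((\<lambda>_. 0)(0 := k), \<lambda>_. 0)"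
    let ?pc = "5 + csize body"
    have 1: "rch P (0, \<lambda>_. 0, k # ls) 1 0 (1, ?r, ls)"
      by (intro rch_one) (auto simp: P_def prog_def)
    have "repr ?s ?r" by (auto simp: repr_def)
    from rch_consume[OF P_def assms(1,3,4) this] ls obtain r1 where
      2: "rch P (1, ?r, ls) (length ls * (B + 4) + 3) 0 (?pc, r1, [])" and rs1: "repr s r1"
      unfolding s after_input_def by fastforce
    have "code_at P ?pc (comp ?pc post)"
      by (rule code_at_infix[of _ "[Read (Dir (reg 0)), Read (Dir (reg 1)), Load (At (Dir (reg 1))),
       JumpZero (5 + csize body)] @ comp 4 body @ [Jump 1]"]) (simp_all add: P_def prog_def)
    from rch_comp[OF assms(2) rs1 this, of "[]"] obtain r2 where
      3: "rch P (?pc, r1, []) (bnd True post s) M (?pc + csize post, r2, [])" and rs2: "repr (run post s) r2"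
      unfolding M by blast
    let ?v = "fst (run post s) 2"
    have 4: "rch P (?pc + csize post, r2, []) 1 0 (?pc + csize post + 1, r2(0 := ?v), [])"
      using rs2 by (intro rch_one) (auto simp: P_def prog_def nth_append repr_def)
    from rch_trans[OF rch_trans[OF rch_trans[OF 1 2] 3] 4]
    have "rch P (0, \<lambda>_. 0, k # ls) N M (?pc + csize post + 1, r2(0 := ?v), [])"
      by (rule rch_mono) (auto simp: N)
    then obtain n m where nm: "n \<le> N" "m \<le> M"
      and r: "reach P (0, \<lambda>_. 0, k # ls) n m (?pc + csize post + 1, r2(0 := ?v), [])"
      unfolding rch_def by blast
    let ?L = "len k + L0"
    have "len 0 = 1" "len 1 \<le> 2" "len 2 \<le> 2" by (simp_all add: len_def floorlog_def)
    then have "bounded ?L (0, \<lambda>_. 0, k # ls)"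
      using ls by (auto simp: bounded_def L0_def)
    moreover have "instr_const i \<le> ?L" if "i \<in> set P" for i
      using member_le_sum_list[of "instr_const i" "map instr_const P"] that by (auto simp: L0_def)
    ultimately obtain t where t: "t \<le> n * (4 * ((?L + n) * 2 ^ m))"
      "\<And>t' v. halts_with P (?pc + csize post + 1, r2(0 := ?v), []) t' v \<Longrightarrow> halts_with P (0, \<lambda>_. 0, k # ls) (t + t') v"
      using reach_cost[OF r] by blast
    have "halts_with P (?pc + csize post + 1, r2(0 := ?v), []) 1 ((r2(0 := ?v)) 0)"
      by (rule halt) (auto simp: P_def prog_def nth_append)
    from t(2)[OF this] have "ram_run P (k # ls) (t + 1) ?v" unfolding ram_run_def by simp
    moreover have "t \<le> N * (4 * ((?L + N) * 2 ^ M))"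
      by (rule order_trans[OF t(1)]) (use nm in \<open>intro mult_mono add_mono power_increasing; simp\<close>)
    ultimately show ?thesis by (intro exI[of _ "t + 1"]) simp
  qed
  then show ?thesis unfolding P_def Let_def by blast
qed

section \<open>A criterion for membership in FPT\<close>

lemma len_int_le: "len (int k) \<le> k + 1"
proof -
  have "k < 2 ^ (k + 1)" by (rule less_trans[OF less_exp]) simp
  then have "int k < 2 ^ (k + 1)" by (metis of_nat_less_iff of_nat_numeral of_nat_power)
  then show ?thesis by (simp add: len_le_iff)
qed

text \<open>This is \<open>8 * (2 ^ Z) ^ 3\<close> for the \<open>Z\<close> of
  \<open>FPT_criterion\<close>: one factor \<open>2 ^ Z\<close> each for the number of steps, the
  length before multiplications and their effect.\<close>

definition growth :: "nat \<Rightarrow> nat \<Rightarrow> nat \<Rightarrow> nat \<Rightarrow> nat" where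
  "growth A e D k = 2 ^ (3 * (k + D + A * 2 ^ (e * k)) + 3)"

text \<open>Powers arise by repeated multiplication and doubling. The limit of the second loop is
  computed by the program itself; this is harmless, as \<open>computable_fun\<close> asks for no
  time bound.\<close>

definition growth_prog :: "nat \<Rightarrow> nat \<Rightarrow> nat \<Rightarrow> com" where
  "growth_prog A e D = Asg 3 (Atom (C (int A))) ;; For 4 0 (Asg 3 (Bin (Atom (V 3)) Times (C (2 ^ e)))) ;;
     Asg 3 (Bin (Bin (Bin (Bin (Atom (V 3)) Plus (V 0)) Plus (C (int D))) Times (C 3)) Plus (C 3)) ;;
     Asg 2 (Atom (C 1)) ;; For 4 3 (Asg 2 (Bin (Atom (V 2)) Plus (V 2)))"

lemma computable_growth: "computable_fun (growth A e D)"
proof -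
  have iter_run: "I 0 (run (For x y c) s)"
    if "I (nat (fst s y)) ((fst s)(x := fst s y), snd s)"
      "\<And>i s. I (Suc i) s \<Longrightarrow> I i (run c ((fst s)(x := int i), snd s))" for I x y c s
    unfolding run.simps using that by (rule iter_invariant)
  have correct: "fst (run (growth_prog A e D) (after_input Skip (int n) [])) 2 = int (growth A e D n)" for n
  proof -
    let ?s1 = "run (Asg 3 (Atom (C (int A)))) (after_input Skip (int n) [])"
    define s2 where "s2 = run (For 4 0 (Asg 3 (Bin (Atom (V 3)) Times (C (2 ^ e))))) ?s1"
    \<comment> \<open>The invariant for both loops: the value so far times the factors still to come
      is the final value.\<close>
    have "fst s2 0 = int n \<and> fst s2 3 * 2 ^ (e * 0) = int A * 2 ^ (e * n)"
      unfolding s2_def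
      by (rule iter_run[where I = "\<lambda>i s. fst s 0 = int n \<and> fst s 3 * 2 ^ (e * i) = int A * 2 ^ (e * n)"])
        (auto simp: after_input_def power_add algebra_simps)
    then have s2: "fst s2 0 = int n" "fst s2 3 = int A * 2 ^ (e * n)" by auto
    define E where "E = 3 * (n + D + A * 2 ^ (e * n)) + 3"
    let ?s3 = "run (Asg 3 (Bin (Bin (Bin (Bin (Atom (V 3)) Plus (V 0)) Plus (C (int D))) Times (C 3)) Plus (C 3))) s2"
    let ?s4 = "run (Asg 2 (Atom (C 1))) ?s3"
    have s4: "fst ?s4 3 = int E" "fst ?s4 2 = 1" using s2 by (auto simp: E_def)
    have "fst (run (For 4 3 (Asg 2 (Bin (Atom (V 2)) Plus (V 2)))) ?s4) 2 * 2 ^ 0 = 2 ^ E"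
      by (rule iter_run[where I = "\<lambda>i s. fst s 2 * 2 ^ i = 2 ^ E"]) (use s4 in \<open>auto simp: algebra_simps\<close>)
    then show ?thesis unfolding growth_prog_def growth_def
      by (simp add: s2_def E_def del: run.simps(8))
  qed
  have wf: "wf_com (growth_prog A e D)" by (simp add: growth_prog_def)
  show ?thesis unfolding computable_fun_def
  proof (rule exI, rule allI)
    fix n
    from ram_run_prog[of Skip "growth_prog A e D" 0] wf
    obtain t where "ram_run (prog Skip (growth_prog A e D)) [int n] t
        (fst (run (growth_prog A e D) (after_input Skip (int n) [])) 2)"
      unfolding Let_def by (fastforce dest: spec[of _ "[]"])
    then show "\<exists>t. ram_run (prog Skip (growth_prog A e D)) [int n] t (int (growth A e D n))"
      unfolding correct by blast
  qed
qed

definition letters :: "bool list \<Rightarrow> int list" where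
  "letters w = map (\<lambda>b. if b then 2 else 1) w"

text \<open>The body performs no multiplications, so reading leaves lengths linear in the length of
  the word. The multiplications of \<open>post\<close> enlarge them by a factor that depends on
  \<open>k\<close> only.\<close>

lemma FPT_criterion:
  assumes "wf_com body" "wf_com post" "\<And>s. bnd True body s \<le> B" "\<And>s. bnd False body s = 0"
    and post: "\<And>fl k w. bnd fl post (after_input body (int k) (letters w)) \<le> A * 2 ^ (e * k)"
    and correct: "\<And>w k. fst (run post (after_input body (int k) (letters w))) 2 = (if (w, k) \<in> L then 1 else 0)"
  shows "L \<in> FPT"
proof -
  obtain L0 where L0: "\<And>k ls s N M. set ls \<subseteq> {1, 2} \<Longrightarrow> s = after_input body k ls \<Longrightarrow>
      N = length ls * (B + 4) + 5 + bnd True post s \<Longrightarrow> M = bnd False post s \<Longrightarrow>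
      \<exists>t \<le> N * (4 * ((len k + L0 + N) * 2 ^ M)) + 1. ram_run (prog body post) (k # ls) t (fst (run post s) 2)"
    using ram_run_prog[OF assms(1-4)] unfolding Let_def by metis
  \<comment> \<open>The sum of \<open>1 + L0\<close> from the initial lengths and
    \<open>B + 9\<close> from the number of steps.\<close>
  define D where "D = L0 + B + 10"
  have "\<exists>t. ram_run (prog body post) (input_tape w k) t (if (w, k) \<in> L then 1 else 0)
        \<and> t \<le> growth A e D k * (length w + 1) ^ 2" for w k
  proof -
    define Q where "Q = A * 2 ^ (e * k)"
    let ?s = "after_input body (int k) (letters w)"
    define N where "N = length (letters w) * (B + 4) + 5 + bnd True post ?s"
    define M where "M = bnd False post ?s"
    have "set (letters w) \<subseteq> {1, 2}" by (auto simp: letters_def)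
    from L0[OF this refl N_def M_def] obtain t where
      t: "t \<le> N * (4 * ((len (int k) + L0 + N) * 2 ^ M)) + 1"
      "ram_run (prog body post) (int k # letters w) t (fst (run post ?s) 2)" by blast
    define n where "n = length w + 1"
    define Z where "Z = k + D + Q"
    have n: "n \<ge> 1" by (simp add: n_def)
    have post': "bnd fl post ?s \<le> Q" for fl using post unfolding Q_def .
    have "N \<le> length w * (B + 4) + 5 + Q" using post'[of True] by (simp add: N_def letters_def)
    also have "\<dots> \<le> n * (B + 9 + Q)" by (simp add: n_def algebra_simps)
    finally have N: "N \<le> n * (B + 9 + Q)" .
    also have "\<dots> \<le> n * Z" by (intro mult_mono) (auto simp: Z_def D_def)
    finally have N1: "N \<le> n * Z" .
    have "len (int k) + L0 + N \<le> n * (k + 1 + L0) + n * (B + 9 + Q)"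
    proof (rule add_mono[OF _ N])
      have "len (int k) + L0 \<le> 1 * (k + 1 + L0)" using len_int_le[of k] by simp
      also have "\<dots> \<le> n * (k + 1 + L0)" by (intro mult_mono n) auto
      finally show "len (int k) + L0 \<le> n * (k + 1 + L0)" .
    qed
    also have "\<dots> = n * Z" by (simp add: Z_def D_def algebra_simps)
    finally have N2: "len (int k) + L0 + N \<le> n * Z" .
    have "(2::nat) ^ M \<le> 2 ^ Z" using post'[of False] by (intro power_increasing) (auto simp: Z_def M_def)
    with N1 N2 have "N * (4 * ((len (int k) + L0 + N) * 2 ^ M)) \<le> n * Z * (4 * (n * Z * 2 ^ Z))"
      by (intro mult_mono) auto
    also have "\<dots> \<le> n * 2 ^ Z * (4 * (n * 2 ^ Z * 2 ^ Z))"
      using less_exp[of Z] by (intro mult_mono) auto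
    finally have "t \<le> n * 2 ^ Z * (4 * (n * 2 ^ Z * 2 ^ Z)) + 1" using t(1) by linarith
    also have "n * 2 ^ Z * (4 * (n * 2 ^ Z * 2 ^ Z)) = 4 * 2 ^ (3 * Z) * n ^ 2"
    proof -
      have "(2::nat) ^ (3 * Z) = 2 ^ Z * 2 ^ Z * 2 ^ Z" by (simp add: power_add[symmetric])
      then show ?thesis by (simp add: power2_eq_square)
    qed
    \<comment> \<open>The cost of \<open>Halt\<close> is absorbed by a further factor 2; with the
      factor 4 this is the \<open>+ 3\<close> in the exponent of \<open>growth\<close>.\<close>
    also have "(1::nat) \<le> 4 * 2 ^ (3 * Z) * n ^ 2" using n by (simp add: Suc_le_eq)
    also have "4 * 2 ^ (3 * Z) * n ^ 2 + 4 * 2 ^ (3 * Z) * n ^ 2 = growth A e D k * n ^ 2"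
      by (simp add: growth_def Z_def Q_def power_add)
    finally have "t \<le> growth A e D k * n ^ 2" by simp
    moreover have "int k # letters w = input_tape w k" by (simp add: input_tape_def letters_def)
    ultimately show ?thesis using t(2) unfolding correct n_def by metis
  qed
  then show ?thesis unfolding FPT_def using computable_growth[of A e D] by blast
qed

section \<open>Norm maximization at vertices\<close>

text \<open>Multiplying the induction hypothesis by the convex combination leaves the error
  \<open>u * (1 - u) * ((y ^ p - z ^ p) * (y - z))\<close>, which is nonnegative because both
  differences have the same sign.\<close>

lemma convex_power:
  fixes y z u :: real
  assumes "y \<ge> 0" "z \<ge> 0" "0 \<le> u" "u \<le> 1"
  shows "((1 - u) * y + u * z) ^ p \<le> (1 - u) * y ^ p + u * z ^ p"
proof (induction p)
  case (Suc p)
  have "(y ^ p - z ^ p) * (y - z) \<ge> 0"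
  proof (cases "y \<ge> z")
    case True
    then show ?thesis using assms by (simp add: power_mono)
  next
    case False
    then show ?thesis using assms by (intro mult_nonpos_nonpos) (simp_all add: power_mono)
  qed
  then have nonneg: "u * (1 - u) * ((y ^ p - z ^ p) * (y - z)) \<ge> 0" using assms by simp
  have "((1 - u) * y + u * z) ^ Suc p \<le> ((1 - u) * y + u * z) * ((1 - u) * y ^ p + u * z ^ p)"
    using assms Suc by (simp add: mult_left_mono)
  also have "\<dots> = (1 - u) * y ^ Suc p + u * z ^ Suc p - u * (1 - u) * ((y ^ p - z ^ p) * (y - z))"
    by (simp add: algebra_simps)
  also have "\<dots> \<le> (1 - u) * y ^ Suc p + u * z ^ Suc p" using nonneg by linarith
  finally show ?case .
qed simp

text \<open>The p-th power of the norm as a function of the coefficients, so that maximization takes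
  place over a cube instead of a Minkowski sum.\<close>

definition power_sum :: "nat \<Rightarrow> nat \<Rightarrow> nat \<Rightarrow> (nat \<Rightarrow> nat \<Rightarrow> real) \<Rightarrow> (nat \<Rightarrow> real) \<Rightarrow> real" where
  "power_sum p n d v l = (\<Sum>j<d. \<bar>\<Sum>i<n. l i * v i j\<bar> ^ p)"

lemma power_sum_cong: "(\<And>i. i < n \<Longrightarrow> l i = l' i) \<Longrightarrow> power_sum p n d v l = power_sum p n d v l'"
  by (simp add: power_sum_def)

lemma power_sum_convex:
  assumes "0 \<le> u" "u \<le> 1" "\<And>i. l i = (1 - u) * l1 i + u * l2 i"
  shows "power_sum p n d v l \<le> (1 - u) * power_sum p n d v l1 + u * power_sum p n d v l2"
proof -
  let ?s = "\<lambda>l j. \<Sum>i<n. l i * v i j"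
  have "\<bar>?s l j\<bar> ^ p \<le> (1 - u) * \<bar>?s l1 j\<bar> ^ p + u * \<bar>?s l2 j\<bar> ^ p" for j
  proof -
    have "?s l j = (1 - u) * ?s l1 j + u * ?s l2 j"
      by (simp add: assms(3) sum_distrib_left sum.distrib[symmetric] algebra_simps del: sum.distrib)
    then have "\<bar>?s l j\<bar> \<le> \<bar>(1 - u) * ?s l1 j\<bar> + \<bar>u * ?s l2 j\<bar>" by linarith
    then have "\<bar>?s l j\<bar> \<le> (1 - u) * \<bar>?s l1 j\<bar> + u * \<bar>?s l2 j\<bar>" using assms by (simp add: abs_mult)
    then have "\<bar>?s l j\<bar> ^ p \<le> ((1 - u) * \<bar>?s l1 j\<bar> + u * \<bar>?s l2 j\<bar>) ^ p" by (intro power_mono) auto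
    also have "\<dots> \<le> (1 - u) * \<bar>?s l1 j\<bar> ^ p + u * \<bar>?s l2 j\<bar> ^ p" using assms by (intro convex_power) auto
    finally show ?thesis .
  qed
  then have "power_sum p n d v l \<le> (\<Sum>j<d. (1 - u) * \<bar>?s l1 j\<bar> ^ p + u * \<bar>?s l2 j\<bar> ^ p)"
    unfolding power_sum_def by (intro sum_mono) auto
  then show ?thesis by (simp add: power_sum_def sum_distrib_left sum.distrib)
qed

text \<open>The coefficients are moved to an endpoint one after the other. By convexity in a single
  coefficient, one of the two endpoints does not decrease the value.\<close>

lemma power_sum_le_vertex:
  assumes "a < b" "\<And>i. i < n \<Longrightarrow> a \<le> l i \<and> l i \<le> b"
  shows "\<exists>S\<subseteq>{..<n}. power_sum p n d v l \<le> power_sum p n d v (\<lambda>i. if i \<in> S then b else a)"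
proof -
  have "\<exists>l'. (\<forall>i<k. l' i \<in> {a, b}) \<and> (\<forall>i<n. a \<le> l' i \<and> l' i \<le> b) \<and> power_sum p n d v l \<le> power_sum p n d v l'"
    if "k \<le> n" for k
    using that
  proof (induction k)
    case 0
    then show ?case using assms(2) by (intro exI[of _ l]) simp
  next
    case (Suc k)
    then obtain l' where l': "\<forall>i<k. l' i \<in> {a, b}" "\<forall>i<n. a \<le> l' i \<and> l' i \<le> b"
      "power_sum p n d v l \<le> power_sum p n d v l'" by auto
    define u where "u = (l' k - a) / (b - a)"
    have lk: "a \<le> l' k" "l' k \<le> b" using l'(2) Suc.prems by auto
    have u: "0 \<le> u" "u \<le> 1" using lk assms(1) by (auto simp: u_def field_simps)
    have "u * (b - a) = l' k - a" using assms(1) by (simp add: u_def)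
    then have comb: "l' i = (1 - u) * (l'(k := a)) i + u * (l'(k := b)) i" for i
      by (auto simp: algebra_simps)
    let ?A = "power_sum p n d v (l'(k := a))" and ?B = "power_sum p n d v (l'(k := b))"
    have "power_sum p n d v l' \<le> (1 - u) * ?A + u * ?B"
      by (rule power_sum_convex[OF u comb])
    also have "\<dots> \<le> (1 - u) * max ?A ?B + u * max ?A ?B" using u by (intro add_mono mult_left_mono) auto
    finally have "power_sum p n d v l' \<le> max ?A ?B" by (simp add: algebra_simps)
    then have "power_sum p n d v l \<le> ?A \<or> power_sum p n d v l \<le> ?B"
      using l'(3) by linarith
    then obtain c where c: "c \<in> {a, b}" "power_sum p n d v l \<le> power_sum p n d v (l'(k := c))"
      by blast
    have "\<forall>i<Suc k. (l'(k := c)) i \<in> {a, b}" using l'(1) c(1) by (auto simp: less_Suc_eq)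
    moreover have "\<forall>i<n. a \<le> (l'(k := c)) i \<and> (l'(k := c)) i \<le> b"
      using l'(2) c(1) assms(1) by auto
    ultimately show ?case using c(2) by blast
  qed
  from this[of n] obtain l' where l': "\<forall>i<n. l' i \<in> {a, b}" "power_sum p n d v l \<le> power_sum p n d v l'" by auto
  let ?S = "{i. i < n \<and> l' i = b}"
  have "power_sum p n d v l' = power_sum p n d v (\<lambda>i. if i \<in> ?S then b else a)"
    by (rule power_sum_cong) (use l'(1) in auto)
  moreover have "?S \<subseteq> {..<n}" by auto
  ultimately show ?thesis using l'(2) by metis
qed

lemma segment_sum_iff:
  assumes "set vs \<subseteq> carrier_vec d"
  shows "x \<in> segment_sum d a b vs \<longleftrightarrow> x \<in> carrier_vec d \<and>
    (\<exists>l. (\<forall>i<length vs. a \<le> l i \<and> l i \<le> b) \<and> (\<forall>j<d. x $ j = (\<Sum>i<length vs. l i * vs ! i $ j)))"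
  using assms
proof (induction vs arbitrary: x)
  case Nil
  show ?case by (auto simp: segment_sum_def)
next
  case (Cons v vs)
  have v: "v \<in> carrier_vec d" using Cons.prems by simp
  have IH: "y \<in> segment_sum d a b vs \<longleftrightarrow> y \<in> carrier_vec d \<and>
    (\<exists>l. (\<forall>i<length vs. a \<le> l i \<and> l i \<le> b) \<and> (\<forall>j<d. y $ j = (\<Sum>i<length vs. l i * vs ! i $ j)))" for y
    using Cons by auto
  have "segment_sum d a b (v # vs) = segment a b v + segment_sum d a b vs"
    by (simp add: segment_sum_def)
  then have "x \<in> segment_sum d a b (v # vs) \<longleftrightarrow>
    (\<exists>c y. a \<le> c \<and> c \<le> b \<and> y \<in> segment_sum d a b vs \<and> x = c \<cdot>\<^sub>v v + y)"
    by (auto simp: set_plus_def segment_def)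
  also have "\<dots> \<longleftrightarrow> x \<in> carrier_vec d \<and> (\<exists>l. (\<forall>i<length (v # vs). a \<le> l i \<and> l i \<le> b) \<and>
      (\<forall>j<d. x $ j = (\<Sum>i<length (v # vs). l i * (v # vs) ! i $ j)))" (is "?L \<longleftrightarrow> ?R")
  proof
    assume ?L
    then obtain c y l where c: "a \<le> c" "c \<le> b" and y: "y \<in> carrier_vec d" "x = c \<cdot>\<^sub>v v + y"
      and l: "\<forall>i<length vs. a \<le> l i \<and> l i \<le> b" "\<forall>j<d. y $ j = (\<Sum>i<length vs. l i * vs ! i $ j)"
      unfolding IH by auto
    define l' where "l' = (\<lambda>i. case i of 0 \<Rightarrow> c | Suc i \<Rightarrow> l i)"
    have "\<forall>j<d. x $ j = (\<Sum>i<length (v # vs). l' i * (v # vs) ! i $ j)"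
      using v y l(2) by (simp add: l'_def sum.lessThan_Suc_shift del: sum.lessThan_Suc)
    moreover have "\<forall>i<length (v # vs). a \<le> l' i \<and> l' i \<le> b"
      using c l(1) by (auto simp: l'_def split: nat.split)
    moreover have "x \<in> carrier_vec d" using v y by simp
    ultimately show ?R by blast
  next
    assume ?R
    then obtain l where x: "x \<in> carrier_vec d" and l: "\<forall>i<length (v # vs). a \<le> l i \<and> l i \<le> b"
      "\<forall>j<d. x $ j = (\<Sum>i<length (v # vs). l i * (v # vs) ! i $ j)" by blast
    define y where "y = vec d (\<lambda>j. \<Sum>i<length vs. l (Suc i) * vs ! i $ j)"
    have "y \<in> segment_sum d a b vs" unfolding IH
      using l(1) by (auto simp: y_def intro!: exI[of _ "\<lambda>i. l (Suc i)"])
    moreover have "x = l 0 \<cdot>\<^sub>v v + y"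
      using x v l(2) by (intro eq_vecI) (auto simp: y_def sum.lessThan_Suc_shift simp del: sum.lessThan_Suc)
    moreover have "a \<le> l 0" "l 0 \<le> b" using l(1) by auto
    ultimately show ?L by blast
  qed
  finally show ?case .
qed

text \<open>The maximum over the finitely many vertices is attained in the set and bounds it, so
  \<open>GREATEST\<close> is identified without a compactness argument. The assumption on
  \<open>p\<close> lets the root and the power cancel.\<close>

lemma max_norm_segment_sum:
  assumes "a < b" "p \<ge> 1" "set vs \<subseteq> carrier_vec d"
  shows "(GREATEST m. m \<in> (\<lambda>x. p_norm p x ^ p) ` segment_sum d a b vs) \<ge> \<gamma> \<longleftrightarrow>
    (\<exists>S\<subseteq>{..<length vs}. power_sum p (length vs) d (\<lambda>i j. vs ! i $ j) (\<lambda>i. if i \<in> S then b else a) \<ge> \<gamma>)"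
proof -
  let ?n = "length vs"
  let ?\<phi> = "power_sum p ?n d (\<lambda>i j. vs ! i $ j)"
  let ?\<psi> = "\<lambda>S. ?\<phi> (\<lambda>i. if i \<in> S then b else a)"
  have norm: "p_norm p x ^ p = ?\<phi> l"
    if "x \<in> carrier_vec d" "\<forall>j<d. x $ j = (\<Sum>i<?n. l i * vs ! i $ j)" for x l
  proof -
    have "p_norm p x ^ p = (\<Sum>j<dim_vec x. \<bar>x $ j\<bar> ^ p)"
      unfolding p_norm_def using assms(2) by (intro real_root_pow_pos2) (auto intro: sum_nonneg)
    also have "\<dots> = ?\<phi> l" using that by (auto simp: power_sum_def intro!: sum.cong)
    finally show ?thesis .
  qed
  have img: "(\<lambda>x. p_norm p x ^ p) ` segment_sum d a b vs = ?\<phi> ` {l. \<forall>i<?n. a \<le> l i \<and> l i \<le> b}" (is "?I = ?J")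
  proof
    show "?I \<subseteq> ?J"
    proof
      fix m assume "m \<in> ?I"
      then obtain x l where "m = p_norm p x ^ p" "x \<in> carrier_vec d" "\<forall>i<?n. a \<le> l i \<and> l i \<le> b"
        "\<forall>j<d. x $ j = (\<Sum>i<?n. l i * vs ! i $ j)"
        by (auto simp: segment_sum_iff[OF assms(3)])
      then show "m \<in> ?J" using norm[of x l] by blast
    qed
    show "?J \<subseteq> ?I"
    proof
      fix m assume "m \<in> ?J"
      then obtain l where l: "m = ?\<phi> l" "\<forall>i<?n. a \<le> l i \<and> l i \<le> b" by auto
      let ?x = "vec d (\<lambda>j. \<Sum>i<?n. l i * vs ! i $ j)"
      have "?x \<in> segment_sum d a b vs" using l(2) by (auto simp: segment_sum_iff[OF assms(3)])
      moreover have "m = p_norm p ?x ^ p" unfolding l(1) by (rule norm[symmetric]) auto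
      ultimately show "m \<in> ?I" by blast
    qed
  qed
  define M where "M = Max (?\<psi> ` Pow {..<?n})"
  have fin: "finite (?\<psi> ` Pow {..<?n})" "?\<psi> ` Pow {..<?n} \<noteq> {}" by auto
  have "M \<in> ?\<psi> ` Pow {..<?n}" unfolding M_def by (rule Max_in[OF fin])
  then have "M \<in> ?J" using assms(1) by auto
  moreover have "m \<le> M" if m: "m \<in> ?J" for m
  proof -
    obtain l where l: "m = ?\<phi> l" "\<forall>i<?n. a \<le> l i \<and> l i \<le> b" using m by auto
    then obtain S where "S \<subseteq> {..<?n}" "m \<le> ?\<psi> S"
      using power_sum_le_vertex[OF assms(1), of ?n l p d "\<lambda>i j. vs ! i $ j"] by auto
    moreover from this(1) have "?\<psi> S \<le> M" unfolding M_def by (intro Max_ge[OF fin(1)]) auto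
    ultimately show ?thesis by simp
  qed
  ultimately have "(GREATEST m. m \<in> ?I) = M" unfolding img by (intro Greatest_equality) auto
  then show ?thesis unfolding M_def using fin by (auto simp: Max_ge_iff)
qed

section \<open>Linear independence by elimination\<close>

text \<open>Independence of the family of the first \<open>n\<close> rows. Coefficients belong to
  positions, so repeated rows are dependent, and distinctness need not be checked
  separately.\<close>

definition indep :: "nat \<Rightarrow> nat \<Rightarrow> (nat \<Rightarrow> nat \<Rightarrow> 'a::field) \<Rightarrow> bool" where
  "indep n d A \<longleftrightarrow> (\<forall>c. (\<forall>j<d. (\<Sum>i<n. c i * A i j) = 0) \<longrightarrow> (\<forall>i<n. c i = 0))"

lemma indep_cong:
  assumes "\<And>i j. i < n \<Longrightarrow> j < d \<Longrightarrow> A i j = B i j"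
  shows "indep n d A = indep n d B"
proof -
  have "(\<Sum>i<n. c i * A i j) = (\<Sum>i<n. c i * B i j)" if "j < d" for c j
    using assms that by (intro sum.cong) auto
  then show ?thesis unfolding indep_def by auto
qed

lemma indep_scale:
  assumes "s \<noteq> 0"
  shows "indep n d (\<lambda>i j. s * A i j) = indep n d A"
proof -
  have "(\<Sum>i<n. c i * (s * A i j)) = s * (\<Sum>i<n. c i * A i j)" for c j
    by (simp add: sum_distrib_left algebra_simps)
  then show ?thesis using assms by (simp add: indep_def)
qed

lemma indep_0: "indep 0 d A"
  by (simp add: indep_def)

lemma not_indep_zero_row:
  fixes A :: "nat \<Rightarrow> nat \<Rightarrow> 'a::field"
  assumes "\<And>j. j < d \<Longrightarrow> A n j = 0"
  shows "\<not> indep (Suc n) d A"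
proof -
  have *: "\<forall>j<d. (\<Sum>i<Suc n. of_bool (i = n) * A i j) = 0"
    using assms by simp
  show ?thesis
  proof
    assume "indep (Suc n) d A"
    from this[unfolded indep_def, THEN spec, THEN mp, OF *] show False by auto
  qed
qed

text \<open>Subtracting a multiple of the pivot row clears column \<open>q\<close>; multiplying by
  the pivot first avoids divisions.\<close>

lemma indep_eliminate:
  assumes "A n q \<noteq> 0" "q < d"
  shows "indep (Suc n) d A \<longleftrightarrow> indep n d (\<lambda>i j. A i j * A n q - A n j * A i q)"
proof
  assume L: "indep (Suc n) d A"
  show "indep n d (\<lambda>i j. A i j * A n q - A n j * A i q)"
    unfolding indep_def
  proof (rule allI, rule impI)
    fix c assume c: "\<forall>j<d. (\<Sum>i<n. c i * (A i j * A n q - A n j * A i q)) = 0"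
    \<comment> \<open>The coefficient of row \<open>n\<close> collects the multiples of that row
      that were subtracted from the others.\<close>
    define c' where "c' = (\<lambda>i. if i = n then - (\<Sum>i<n. c i * A i q) else c i * A n q)"
    have "(\<Sum>i<Suc n. c' i * A i j) = 0" if "j < d" for j
    proof -
      have "(\<Sum>i<Suc n. c' i * A i j) = (\<Sum>i<n. c i * A n q * A i j) - (\<Sum>i<n. c i * A i q) * A n j"
        by (simp add: c'_def)
      also have "\<dots> = (\<Sum>i<n. c i * (A i j * A n q - A n j * A i q))"
        unfolding sum_distrib_right sum_subtractf[symmetric] by (intro sum.cong) (simp_all add: algebra_simps)
      finally show ?thesis using c that by simp
    qed
    then have "\<forall>i<Suc n. c' i = 0" using L unfolding indep_def by blast
    show "\<forall>i<n. c i = 0"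
    proof (intro allI impI)
      fix i assume "i < n"
      then have "c' i = 0" using \<open>\<forall>i<Suc n. c' i = 0\<close> by simp
      moreover have "c' i = c i * A n q" using \<open>i < n\<close> by (simp add: c'_def)
      ultimately show "c i = 0" using assms(1) by simp
    qed
  qed
next
  assume R: "indep n d (\<lambda>i j. A i j * A n q - A n j * A i q)"
  show "indep (Suc n) d A"
    unfolding indep_def
  proof (rule allI, rule impI)
    fix c assume c: "\<forall>j<d. (\<Sum>i<Suc n. c i * A i j) = 0"
    then have cj: "(\<Sum>i<n. c i * A i j) = - (c n * A n j)" if "j < d" for j
      using that by (simp add: eq_neg_iff_add_eq_0)
    have "(\<Sum>i<n. c i * (A i j * A n q - A n j * A i q)) = 0" if "j < d" for j
    proof -
      have "(\<Sum>i<n. c i * (A i j * A n q - A n j * A i q)) =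
          (\<Sum>i<n. c i * A i j) * A n q - (\<Sum>i<n. c i * A i q) * A n j"
        unfolding sum_distrib_right sum_subtractf[symmetric] by (intro sum.cong) (simp_all add: algebra_simps)
      then show ?thesis by (simp add: cj[OF that] cj[OF assms(2)])
    qed
    then have 0: "\<forall>i<n. c i = 0" using R unfolding indep_def by blast
    then have "c n * A n q = 0" using cj[OF assms(2)] by simp
    with 0 assms(1) show "\<forall>i<Suc n. c i = 0" by (auto simp: less_Suc_eq)
  qed
qed

lemma lin_indep_family_iff:
  assumes "set vs \<subseteq> carrier_vec d"
  shows "lin_indep_family d vs \<longleftrightarrow> indep (length vs) d (\<lambda>i j. vs ! i $ j)"
proof -
  interpret vec_space "TYPE(rat)" d .
  let ?n = "length vs"
  have idx: "lincomb a (set vs) = 0\<^sub>v d \<longleftrightarrow> (\<forall>j<d. (\<Sum>x\<in>set vs. a x * x $ j) = 0)" for a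
  proof -
    have "dim_vec (lincomb a (set vs)) = d" by (rule lincomb_dim) (use assms in auto)
    then show ?thesis by (auto simp: vec_eq_iff lincomb_index[OF _ assms])
  qed
  have reindex: "(\<Sum>x\<in>set vs. a x * x $ j) = (\<Sum>i<?n. a (vs ! i) * vs ! i $ j)" if "distinct vs" for a j
    using that by (simp add: sum.distinct_set_conv_list sum_list_sum_nth atLeast0LessThan)
  show ?thesis
  proof
    assume L: "lin_indep_family d vs"
    then have dist: "distinct vs" and li: "lin_indpt (set vs)"
      by (auto simp: lin_indep_family_def)
    show "indep ?n d (\<lambda>i j. vs ! i $ j)"
      unfolding indep_def
    proof (rule allI, rule impI, rule ccontr)
      fix c assume c: "\<forall>j<d. (\<Sum>i<?n. c i * vs ! i $ j) = 0" "\<not> (\<forall>i<?n. c i = 0)"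
      then obtain k where k: "k < ?n" "c k \<noteq> 0" by auto
      \<comment> \<open>Coefficients on positions become coefficients on vectors; distinctness makes
        the position unique.\<close>
      let ?a = "\<lambda>x. c (the_inv_into {..<?n} ((!) vs) x)"
      have inj: "inj_on ((!) vs) {..<?n}" using dist by (auto simp: inj_on_def nth_eq_iff_index_eq)
      have a: "?a (vs ! i) = c i" if "i < ?n" for i using the_inv_into_f_f[OF inj] that by simp
      have "(\<Sum>x\<in>set vs. ?a x * x $ j) = (\<Sum>i<?n. c i * vs ! i $ j)" for j
        unfolding reindex[OF dist] using a by (intro sum.cong) auto
      then have "lincomb ?a (set vs) = 0\<^sub>v d" using c(1) unfolding idx by simp
      then have "lin_dep (set vs)"
        using k a by (intro lin_dep_crit[where A = "set vs" and a = ?a and v = "vs ! k"]) auto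
      with li show False by simp
    qed
  next
    assume R: "indep ?n d (\<lambda>i j. vs ! i $ j)"
    have dist: "distinct vs"
      unfolding distinct_conv_nth
    proof (intro allI impI notI)
      fix i k assume ik: "i < ?n" "k < ?n" "i \<noteq> k" "vs ! i = vs ! k"
      \<comment> \<open>Equal vectors in two positions are related with the coefficients 1 and
        -1.\<close>
      let ?c = "\<lambda>m. of_bool (m = i) - of_bool (m = k) :: rat"
      have *: "\<forall>j<d. (\<Sum>m<?n. ?c m * vs ! m $ j) = 0"
      proof (intro allI impI)
        fix j
        have "(\<Sum>m<?n. ?c m * vs ! m $ j) = vs ! i $ j - vs ! k $ j"
          using ik by (simp add: left_diff_distrib sum_subtractf)
        then show "(\<Sum>m<?n. ?c m * vs ! m $ j) = 0" using ik by simp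
      qed
      from R[unfolded indep_def, THEN spec, THEN mp, OF *] have "\<forall>m<?n. ?c m = 0" .
      then have "?c i = 0" using ik(1) by blast
      then show False using ik(3) by simp
    qed
    have "lin_indpt (set vs)"
    proof
      assume "lin_dep (set vs)"
      from finite_lin_dep[OF _ this] obtain a v where a: "lincomb a (set vs) = 0\<^sub>v d" "v \<in> set vs" "a v \<noteq> 0"
        using assms by auto
      from a(1) have "\<forall>j<d. (\<Sum>i<?n. a (vs ! i) * vs ! i $ j) = 0"
        unfolding idx reindex[OF dist] .
      from R[unfolded indep_def, THEN spec, THEN mp, OF this] have "\<forall>i<?n. a (vs ! i) = 0" .
      then show False using a(2,3) by (auto simp: in_set_conv_nth)
    qed
    with dist assms show "lin_indep_family d vs" by (simp add: lin_indep_family_def)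
  qed
qed

section \<open>Instances as lists of integers\<close>

definition encode_list :: "int list \<Rightarrow> bool list" where
  "encode_list zs = concat (map encode_int zs)"

text \<open>In a list of integers, place 0 holds the dimension, followed by pairs of numerator and
  denominator: pair 0 is the threshold and pair \<open>1 + (i * d + j)\<close> is coordinate
  \<open>j\<close> of vector \<open>i\<close>.\<close>

definition numer :: "int list \<Rightarrow> nat \<Rightarrow> int" where
  "numer zs q = zs ! (1 + 2 * q)"

definition denom :: "int list \<Rightarrow> nat \<Rightarrow> int" where
  "denom zs q = zs ! (2 + 2 * q)"

text \<open>The product instead of the least common multiple: it needs no gcd, and the number of
  multiplications depends on \<open>d\<close> only.\<close>

definition common_denom :: "nat \<Rightarrow> int list \<Rightarrow> int" where
  "common_denom d zs = (\<Prod>i<d. \<Prod>j<d. denom zs (1 + (i * d + j)))"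

definition scaled :: "nat \<Rightarrow> int list \<Rightarrow> nat \<Rightarrow> nat \<Rightarrow> int" where
  "scaled d zs i j = numer zs (1 + (i * d + j)) * (common_denom d zs div denom zs (1 + (i * d + j)))"

lemma concat_uniform:
  assumes "\<And>xs. xs \<in> set xss \<Longrightarrow> length xs = d"
  shows "length (concat xss) = length xss * d"
    "i < length xss \<Longrightarrow> j < d \<Longrightarrow> concat xss ! (i * d + j) = xss ! i ! j"
proof -
  show "length (concat xss) = length xss * d" using assms by (induction xss) auto
  show "i < length xss \<Longrightarrow> j < d \<Longrightarrow> concat xss ! (i * d + j) = xss ! i ! j"
    using assms
  proof (induction xss arbitrary: i)
    case (Cons xs xss)
    then show ?case by (cases i) (auto simp: nth_append)
  qed simp
qed

text \<open>Division with remainder by \<open>d\<close> recovers row and column from a positive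
  position.\<close>

lemma all_square_iff:
  fixes d :: nat
  shows "(\<forall>q<1 + d * d. Q q) \<longleftrightarrow> Q 0 \<and> (\<forall>i<d. \<forall>j<d. Q (1 + (i * d + j)))"
proof (intro iffI conjI allI impI)
  fix i j assume Q: "\<forall>q<1 + d * d. Q q" and ij: "i < d" "j < d"
  have "i * d + j < (i + 1) * d" using ij by simp
  also have "\<dots> \<le> d * d" using ij by (intro mult_right_mono) auto
  finally show "Q (1 + (i * d + j))" using Q by simp
next
  fix q assume Q: "Q 0 \<and> (\<forall>i<d. \<forall>j<d. Q (1 + (i * d + j)))" and q: "q < 1 + d * d"
  show "Q q"
  proof (cases q)
    case (Suc t)
    then have t: "t < d * d" using q by simp
    then have "0 < d" by (cases d) auto
    with t have "t div d < d" "t mod d < d" by (simp_all add: less_mult_imp_div_less)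
    then have "Q (1 + (t div d * d + t mod d))" using Q by blast
    then show ?thesis using Suc by simp
  qed (use Q in simp)
qed auto

lemma encode_list_pairs:
  "encode_list (concat (map (\<lambda>q. [a q, b q]) qs)) = concat (map (\<lambda>q. encode_int (a q) @ encode_int (b q)) qs)"
  by (induction qs) (auto simp: encode_list_def)

text \<open>Since any fraction with positive denominator may represent an entry, encodings
  correspond to integer lists of the right shape, and no normal form of fractions is
  involved.\<close>

lemma encodes_input_iff:
  assumes "length vs = d" "set vs \<subseteq> carrier_vec d"
  shows "encodes_input d \<gamma> vs w \<longleftrightarrow> (\<exists>zs. w = encode_list zs \<and> length zs = 3 + 2 * (d * d) \<and> zs ! 0 = int d
    \<and> (\<forall>q<1 + d * d. denom zs q > 0) \<and> \<gamma> = Rat.Fract (numer zs 0) (denom zs 0)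
    \<and> (\<forall>i<d. \<forall>j<d. vs ! i $ j = Rat.Fract (numer zs (1 + (i * d + j))) (denom zs (1 + (i * d + j)))))"
    (is "_ \<longleftrightarrow> ?R")
proof -
  define qs where "qs = \<gamma> # concat (map list_of_vec vs)"
  define N where "N = 1 + d * d"
  have u: "length (list_of_vec x) = d" if "x \<in> set vs" for x using that assms(2) by auto
  have "length (concat (map list_of_vec vs)) = length (map list_of_vec vs) * d"
    by (rule concat_uniform(1)) (use u in auto)
  then have len_qs: "length qs = N" using assms(1) by (simp add: qs_def N_def)
  have qs_nth: "qs ! (1 + (i * d + j)) = vs ! i $ j" if "i < d" "j < d" for i j
  proof -
    have "qs ! (1 + (i * d + j)) = map list_of_vec vs ! i ! j"
      using concat_uniform(2)[of "map list_of_vec vs" d i j] u that assms(1) by (force simp: qs_def)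
    moreover have "dim_vec (vs ! i) = d" using assms that by (metis carrier_vecD nth_mem subsetD)
    ultimately show ?thesis using that assms(1) by (simp add: list_of_vec_index)
  qed
  have qs_all: "(\<forall>q<N. qs ! q = F q) \<longleftrightarrow> \<gamma> = F 0 \<and> (\<forall>i<d. \<forall>j<d. vs ! i $ j = F (1 + (i * d + j)))" for F
    unfolding N_def all_square_iff[of d "\<lambda>q. qs ! q = F q"] using qs_nth by (simp add: qs_def)
  show ?thesis
  proof
    assume "encodes_input d \<gamma> vs w"
    then obtain ws where ws: "list_all2 encodes_rat qs ws" "w = encode_int (int d) @ concat ws"
      by (auto simp: encodes_input_def qs_def)
    then have "length ws = N" "\<forall>q<N. encodes_rat (qs ! q) (ws ! q)"
      using len_qs by (auto simp: list_all2_conv_all_nth)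
    then have "\<forall>q. \<exists>a b. q < N \<longrightarrow> b > 0 \<and> qs ! q = Rat.Fract a b \<and> ws ! q = encode_int a @ encode_int b"
      unfolding encodes_rat_def by blast
    then obtain a b where ab: "\<And>q. q < N \<Longrightarrow> b q > 0 \<and> qs ! q = Rat.Fract (a q) (b q) \<and> ws ! q = encode_int (a q) @ encode_int (b q)"
      by metis
    let ?ps = "map (\<lambda>q. [a q, b q]) [0..<N]"
    define zs where "zs = int d # concat ?ps"
    have "ws = map (\<lambda>q. encode_int (a q) @ encode_int (b q)) [0..<N]"
      using ab \<open>length ws = N\<close> by (intro nth_equalityI) auto
    then have w: "w = encode_list zs"
      using ws(2) encode_list_pairs[of a b "[0..<N]"] by (simp add: zs_def encode_list_def)
    have 2: "\<And>xs. xs \<in> set ?ps \<Longrightarrow> length xs = 2" by auto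
    have len: "length zs = 3 + 2 * (d * d)"
      by (simp only: zs_def length_Cons concat_uniform(1)[OF 2] length_map length_upt) (simp add: N_def)
    have nd: "numer zs q = a q" "denom zs q = b q" if "q < N" for q
      using concat_uniform(2)[of ?ps 2 q 0, OF 2] concat_uniform(2)[of ?ps 2 q 1, OF 2] that
      by (simp_all add: zs_def numer_def denom_def mult.commute)
    have "\<forall>q<N. qs ! q = Rat.Fract (numer zs q) (denom zs q)" using ab nd by simp
    then have "\<gamma> = Rat.Fract (numer zs 0) (denom zs 0)
      \<and> (\<forall>i<d. \<forall>j<d. vs ! i $ j = Rat.Fract (numer zs (1 + (i * d + j))) (denom zs (1 + (i * d + j))))"
      by (rule qs_all[THEN iffD1])
    moreover have "\<forall>q<1 + d * d. denom zs q > 0" using ab nd unfolding N_def by simp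
    moreover have "zs ! 0 = int d" by (simp add: zs_def)
    ultimately show ?R using w len by blast
  next
    assume ?R
    then obtain zs where w: "w = encode_list zs" and len: "length zs = 3 + 2 * (d * d)" and z0: "zs ! 0 = int d"
      and pos: "\<forall>q<N. denom zs q > 0" and "\<gamma> = Rat.Fract (numer zs 0) (denom zs 0)
      \<and> (\<forall>i<d. \<forall>j<d. vs ! i $ j = Rat.Fract (numer zs (1 + (i * d + j))) (denom zs (1 + (i * d + j))))"
      unfolding N_def by blast
    from this(5) have qs: "\<forall>q<N. qs ! q = Rat.Fract (numer zs q) (denom zs q)"
      by (rule qs_all[THEN iffD2])
    let ?ps = "map (\<lambda>q. [numer zs q, denom zs q]) [0..<N]"
    define ws where "ws = map (\<lambda>q. encode_int (numer zs q) @ encode_int (denom zs q)) [0..<N]"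
    have 2: "\<And>xs. xs \<in> set ?ps \<Longrightarrow> length xs = 2" by auto
    have "zs = int d # concat ?ps"
    proof (rule nth_equalityI)
      show "length zs = length (int d # concat ?ps)" 
        by (simp only: len length_Cons concat_uniform(1)[OF 2] length_map length_upt) (simp add: N_def)
      fix k assume k: "k < length zs"
      show "zs ! k = (int d # concat ?ps) ! k"
      proof (cases k)
        case (Suc t)
        then have t: "t div 2 < N" using k len by (auto simp: N_def)
        have "concat ?ps ! (t div 2 * 2 + t mod 2) = ?ps ! (t div 2) ! (t mod 2)"
          using t by (intro concat_uniform(2)[OF 2]) auto
        also have "\<dots> = zs ! Suc (t div 2 * 2 + t mod 2)"
          using t by (cases "t mod 2 = 0") (auto simp: numer_def denom_def mod2_eq_if mult.commute)
        finally show ?thesis using Suc by simp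
      qed (use z0 in simp)
    qed
    then have "encode_list zs = encode_list (int d # concat ?ps)" by (rule arg_cong)
    then have "w = encode_int (int d) @ concat ws"
      using w encode_list_pairs[of "numer zs" "denom zs" "[0..<N]"] by (simp add: ws_def encode_list_def)
    moreover have "list_all2 encodes_rat qs ws"
      unfolding list_all2_conv_all_nth using len_qs qs pos by (auto simp: ws_def encodes_rat_def)
    ultimately show "encodes_input d \<gamma> vs w" unfolding encodes_input_def qs_def by blast
  qed
qed

lemma common_denom_dvd:
  assumes "i < d" "j < d"
  shows "denom zs (1 + (i * d + j)) dvd common_denom d zs"
proof -
  have "denom zs (1 + (i * d + j)) dvd (\<Prod>j<d. denom zs (1 + (i * d + j)))"
    using assms by (intro dvd_prodI) auto
  also have "\<dots> dvd common_denom d zs"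
    unfolding common_denom_def using assms by (intro dvd_prodI[of _ i "\<lambda>i. \<Prod>j<d. denom zs (1 + (i * d + j))"]) auto
  finally show ?thesis .
qed

text \<open>Multiplication of all vectors by the common denominator preserves independence and
  multiplies the p-th powers of the norms by its p-th power. Clearing the denominator of the
  threshold too leaves a comparison of integers.\<close>

lemma Parmax_iff:
  assumes "p \<ge> 1" "lo < 1"
  shows "(w, d) \<in> Parmax (of_int lo) 1 p \<longleftrightarrow> (\<exists>zs. w = encode_list zs \<and> d \<ge> 1 \<and> length zs = 3 + 2 * (d * d)
    \<and> zs ! 0 = int d \<and> (\<forall>q<1 + d * d. denom zs q > 0)
    \<and> indep d d (\<lambda>i j. of_int (scaled d zs i j) :: rat)
    \<and> (\<exists>S\<subseteq>{..<d}. denom zs 0 * (\<Sum>j<d. \<bar>\<Sum>i<d. (if i \<in> S then 1 else lo) * scaled d zs i j\<bar> ^ p)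
        \<ge> numer zs 0 * common_denom d zs ^ p))"
proof -
  define F where "F = (\<lambda>zs q. Rat.Fract (numer zs q) (denom zs q))"
  have step: "lin_indep_family d vs \<and> (GREATEST m. m \<in> (\<lambda>x. p_norm p x ^ p) `
        segment_sum d (of_int lo) 1 (map (map_vec of_rat) vs)) \<ge> of_rat (F zs 0) \<longleftrightarrow>
      indep d d (\<lambda>i j. of_int (scaled d zs i j) :: rat)
      \<and> (\<exists>S\<subseteq>{..<d}. denom zs 0 * (\<Sum>j<d. \<bar>\<Sum>i<d. (if i \<in> S then 1 else lo) * scaled d zs i j\<bar> ^ p)
        \<ge> numer zs 0 * common_denom d zs ^ p)"
    if vs: "length vs = d" "set vs \<subseteq> carrier_vec d" and pos: "\<forall>q<1 + d * d. denom zs q > 0"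
      and F: "\<forall>i<d. \<forall>j<d. vs ! i $ j = F zs (1 + (i * d + j))" for vs zs
  proof -
    let ?D = "common_denom d zs"
    have pos': "denom zs 0 > 0" "\<And>i j. i < d \<Longrightarrow> j < d \<Longrightarrow> denom zs (1 + (i * d + j)) > 0"
      using pos[unfolded all_square_iff] by auto
    then have D: "?D > 0" unfolding common_denom_def by (intro prod_pos ballI) auto
    have frac: "Rat.Fract a b = of_int a / of_int b" for a b by (simp add: Fract_of_int_quotient)
    have sc: "of_int (scaled d zs i j) = of_int ?D * vs ! i $ j" if ij: "i < d" "j < d" for i j
    proof -
      obtain k where k: "?D = denom zs (1 + (i * d + j)) * k" using common_denom_dvd[OF ij] by blast
      then show ?thesis using F ij pos'(2)[OF ij] by (simp add: F_def frac scaled_def)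
    qed
    have "lin_indep_family d vs \<longleftrightarrow> indep d d (\<lambda>i j. vs ! i $ j)"
      using lin_indep_family_iff[OF vs(2)] vs(1) by simp
    also have "\<dots> \<longleftrightarrow> indep d d (\<lambda>i j. of_int ?D * vs ! i $ j)" using D by (subst indep_scale) auto
    also have "\<dots> \<longleftrightarrow> indep d d (\<lambda>i j. of_int (scaled d zs i j) :: rat)"
      by (rule indep_cong) (simp add: sc)
    finally have li: "lin_indep_family d vs \<longleftrightarrow> indep d d (\<lambda>i j. of_int (scaled d zs i j) :: rat)" .
    let ?us = "map (map_vec real_of_rat) vs"
    let ?c = "\<lambda>S i. if i \<in> S then 1 else lo"
    have us: "set ?us \<subseteq> carrier_vec d" "length ?us = d" using vs by auto
    have us_nth: "?us ! i $ j = of_int (scaled d zs i j) / of_int ?D" if "i < d" "j < d" for i j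
    proof -
      have "dim_vec (vs ! i) = d" using vs that by (metis carrier_vecD nth_mem subsetD)
      then have "?us ! i $ j = of_rat (vs ! i $ j)" using that vs(1) by simp
      also have "vs ! i $ j = of_int (scaled d zs i j) / of_int ?D" using sc[OF that] D by simp
      finally show ?thesis by (simp add: of_rat_divide)
    qed
    have ps: "power_sum p d d (\<lambda>i j. ?us ! i $ j) (\<lambda>i. if i \<in> S then 1 else of_int lo) =
        of_int (\<Sum>j<d. \<bar>\<Sum>i<d. ?c S i * scaled d zs i j\<bar> ^ p) / of_int ?D ^ p" for S
    proof -
      have pow: "\<bar>of_int X / of_int ?D\<bar> ^ p = (of_int (\<bar>X\<bar> ^ p) / of_int ?D ^ p :: real)" for X
        using D by (simp add: power_divide)
      have "(\<Sum>i<d. (if i \<in> S then 1 else of_int lo) * ?us ! i $ j) =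
          of_int (\<Sum>i<d. ?c S i * scaled d zs i j) / of_int ?D" if "j < d" for j
        unfolding of_int_sum sum_divide_distrib by (intro sum.cong) (use that us_nth in auto)
      then have "power_sum p d d (\<lambda>i j. ?us ! i $ j) (\<lambda>i. if i \<in> S then 1 else of_int lo) =
          (\<Sum>j<d. \<bar>of_int (\<Sum>i<d. ?c S i * scaled d zs i j) / of_int ?D\<bar> ^ p)"
        unfolding power_sum_def by (intro sum.cong) auto
      also have "\<dots> = (\<Sum>j<d. of_int (\<bar>\<Sum>i<d. ?c S i * scaled d zs i j\<bar> ^ p) / of_int ?D ^ p)"
        by (intro sum.cong refl pow)
      finally show ?thesis by (simp only: sum_divide_distrib of_int_sum)
    qed
    have ge: "power_sum p d d (\<lambda>i j. ?us ! i $ j) (\<lambda>i. if i \<in> S then 1 else of_int lo) \<ge> of_rat (F zs 0) \<longleftrightarrow>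
        denom zs 0 * (\<Sum>j<d. \<bar>\<Sum>i<d. ?c S i * scaled d zs i j\<bar> ^ p) \<ge> numer zs 0 * ?D ^ p" for S
    proof -
      define X where "X = (\<Sum>j<d. \<bar>\<Sum>i<d. ?c S i * scaled d zs i j\<bar> ^ p)"
      have "real_of_rat (F zs 0) = of_int (numer zs 0) / of_int (denom zs 0)"
        by (simp add: F_def frac of_rat_divide)
      moreover have "of_int (numer zs 0) / of_int (denom zs 0) \<le> (of_int X / of_int ?D ^ p :: real) \<longleftrightarrow>
          real_of_int (numer zs 0 * ?D ^ p) \<le> of_int (denom zs 0 * X)"
        using pos'(1) D by (simp add: field_simps)
      ultimately show ?thesis unfolding ps X_def[symmetric] by (simp only: of_int_le_iff)
    qed
    have "(GREATEST m. m \<in> (\<lambda>x. p_norm p x ^ p) ` segment_sum d (of_int lo) 1 ?us) \<ge> of_rat (F zs 0) \<longleftrightarrow>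
        (\<exists>S\<subseteq>{..<d}. power_sum p d d (\<lambda>i j. ?us ! i $ j) (\<lambda>i. if i \<in> S then 1 else of_int lo) \<ge> of_rat (F zs 0))"
      using max_norm_segment_sum[OF _ assms(1) us(1), of "of_int lo" 1] assms(2) us(2) by simp
    then show ?thesis unfolding ge li by blast
  qed
  show ?thesis
  proof
    assume "(w, d) \<in> Parmax (of_int lo) 1 p"
    then obtain \<gamma> vs where vs: "d \<ge> 1" "length vs = d" "lin_indep_family d vs" "encodes_input d \<gamma> vs w"
      "(GREATEST m. m \<in> (\<lambda>x. p_norm p x ^ p) ` segment_sum d (of_int lo) 1 (map (map_vec of_rat) vs)) \<ge> of_rat \<gamma>"
      unfolding Parmax_def by blast
    have C: "set vs \<subseteq> carrier_vec d" using vs(3) by (simp add: lin_indep_family_def)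
    from vs(4)[unfolded encodes_input_iff[OF vs(2) C]] obtain zs where zs: "w = encode_list zs"
      "length zs = 3 + 2 * (d * d)" "zs ! 0 = int d" "\<forall>q<1 + d * d. denom zs q > 0" "\<gamma> = F zs 0"
      "\<forall>i<d. \<forall>j<d. vs ! i $ j = F zs (1 + (i * d + j))" unfolding F_def by blast
    from step[OF vs(2) C zs(4,6)] vs(3,5) zs vs(1) show "\<exists>zs. w = encode_list zs \<and> d \<ge> 1 \<and> length zs = 3 + 2 * (d * d)
    \<and> zs ! 0 = int d \<and> (\<forall>q<1 + d * d. denom zs q > 0)
    \<and> indep d d (\<lambda>i j. of_int (scaled d zs i j) :: rat)
    \<and> (\<exists>S\<subseteq>{..<d}. denom zs 0 * (\<Sum>j<d. \<bar>\<Sum>i<d. (if i \<in> S then 1 else lo) * scaled d zs i j\<bar> ^ p)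
        \<ge> numer zs 0 * common_denom d zs ^ p)" by blast
  next
    assume "\<exists>zs. w = encode_list zs \<and> d \<ge> 1 \<and> length zs = 3 + 2 * (d * d)
    \<and> zs ! 0 = int d \<and> (\<forall>q<1 + d * d. denom zs q > 0)
    \<and> indep d d (\<lambda>i j. of_int (scaled d zs i j) :: rat)
    \<and> (\<exists>S\<subseteq>{..<d}. denom zs 0 * (\<Sum>j<d. \<bar>\<Sum>i<d. (if i \<in> S then 1 else lo) * scaled d zs i j\<bar> ^ p)
        \<ge> numer zs 0 * common_denom d zs ^ p)"
    then obtain zs where zs: "w = encode_list zs" "d \<ge> 1" "length zs = 3 + 2 * (d * d)" "zs ! 0 = int d"
      "\<forall>q<1 + d * d. denom zs q > 0" and R: "indep d d (\<lambda>i j. of_int (scaled d zs i j) :: rat)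
    \<and> (\<exists>S\<subseteq>{..<d}. denom zs 0 * (\<Sum>j<d. \<bar>\<Sum>i<d. (if i \<in> S then 1 else lo) * scaled d zs i j\<bar> ^ p)
        \<ge> numer zs 0 * common_denom d zs ^ p)" by blast
    define vs where "vs = map (\<lambda>i. vec d (\<lambda>j. F zs (1 + (i * d + j)))) [0..<d]"
    have vs: "length vs = d" "set vs \<subseteq> carrier_vec d" "\<forall>i<d. \<forall>j<d. vs ! i $ j = F zs (1 + (i * d + j))"
      by (auto simp: vs_def)
    have "encodes_input d (F zs 0) vs w"
      unfolding encodes_input_iff[OF vs(1,2)] using zs vs(3) unfolding F_def by blast
    moreover from R have "lin_indep_family d vs \<and> (GREATEST m. m \<in> (\<lambda>x. p_norm p x ^ p) `
        segment_sum d (of_int lo) 1 (map (map_vec of_rat) vs)) \<ge> of_rat (F zs 0)"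
      by (rule step[OF vs(1,2) zs(5) vs(3), THEN iffD2])
    ultimately show "(w, d) \<in> Parmax (of_int lo) 1 p" unfolding Parmax_def using zs(2) vs(1) by blast
  qed
qed

section \<open>Parsing\<close>

text \<open>Variables: \<open>3\<close> error flag, \<open>4\<close> phase (\<open>0\<close>: a sign comes next, \<open>1\<close>: a continuation bit,
  \<open>2\<close>: a digit), \<open>5\<close> sign, \<open>6\<close> value so far, \<open>7\<close> weight of the next digit, \<open>8\<close> whether the number
  may end here, \<open>9\<close> how many numbers have been stored.\<close>
definition fail :: com where
  "fail = Asg 3 (Atom (C 1))"

text \<open>Letters are 1 and 2, so subtracting 1 yields the bit. The weight is doubled by an
  addition, which keeps the parser free of multiplications. Variable 8 starts at 1 because 0 has no
  digits, and afterwards it remembers the last digit.\<close>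

definition parser :: com where
  "parser =
    IfZero (Atom (V 4))
      (Asg 5 (Bin (Atom (V 1)) Minus (C 1)) ;; Asg 6 (Atom (C 0)) ;; Asg 7 (Atom (C 1)) ;;
       Asg 8 (Atom (C 1)) ;; Asg 4 (Atom (C 1)))
      (IfZero (Bin (Atom (V 4)) Minus (C 1))
        (IfPos (Bin (Atom (V 1)) Minus (C 1))
          (Asg 4 (Atom (C 2)))
          (IfZero (Atom (V 8)) fail Skip ;;
           IfPos (Atom (V 5)) (IfZero (Atom (V 6)) fail Skip ;; Asg 6 (Bin (Atom (C 0)) Minus (V 6))) Skip ;;
           Put (Atom (V 9)) 6 ;; Asg 9 (Bin (Atom (V 9)) Plus (C 1)) ;; Asg 4 (Atom (C 0))))
        (Asg 8 (Bin (Atom (V 1)) Minus (C 1)) ;; IfPos (Atom (V 8)) (Asg 6 (Bin (Atom (V 6)) Plus (V 7))) Skip ;;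
         Asg 7 (Bin (Atom (V 7)) Plus (V 7)) ;; Asg 4 (Atom (C 1))))"

section \<open>Soundness and completeness of the parser\<close>

primrec digits_value :: "bool list \<Rightarrow> nat" where
  "digits_value [] = 0"
| "digits_value (b # bs) = of_bool b + 2 * digits_value bs"

lemma digits_value_snoc: "digits_value (bs @ [b]) = digits_value bs + of_bool b * 2 ^ length bs"
  by (induction bs) auto

lemma digits_value_binary: "digits_value (binary n) = n"
  by (induction n rule: binary.induct) (subst binary.simps, auto simp: odd_iff_mod_2_eq_one)

lemma last_binary: "binary n \<noteq> [] \<Longrightarrow> last (binary n)"
proof (induction n rule: binary.induct)
  case (1 n)
  from 1(2) have n: "n \<noteq> 0" by (subst (asm) binary.simps) (auto split: if_splits)
  show ?case
  proof (cases "n div 2 = 0")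
    case True
    then have "n = 1" using n by auto
    then show ?thesis by (simp add: binary.simps)
  next
    case False
    then have ne: "binary (n div 2) \<noteq> []" by (subst binary.simps) simp
    then have "last (binary (n div 2))" by (rule 1(1)[OF n])
    moreover have "binary n = odd n # binary (n div 2)" using n by (subst binary.simps) simp
    ultimately show ?thesis using ne by simp
  qed
qed

text \<open>The assumption excludes leading zeros; the last digit is the most significant
  one.\<close>

lemma binary_digits_value: "ds = [] \<or> last ds \<Longrightarrow> binary (digits_value ds) = ds"
proof (induction ds)
  case Nil
  show ?case by (simp add: binary.simps)
next
  case (Cons b ds)
  then have IH: "binary (digits_value ds) = ds" by (auto split: if_splits)
  have "digits_value (b # ds) \<noteq> 0"
  proof (cases "ds = []")
    case False
    then have "digits_value ds \<noteq> 0" using IH by (metis binary.simps)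
    then show ?thesis by simp
  qed (use Cons.prems in simp)
  moreover have "digits_value (b # ds) div 2 = digits_value ds" "odd (digits_value (b # ds)) = b" by auto
  ultimately show ?case using IH by (subst binary.simps) simp
qed

definition marked :: "bool list \<Rightarrow> bool list" where
  "marked ds = concat (map (\<lambda>b. [True, b]) ds)"

lemma encode_int_marked: "encode_int z = (z < 0) # marked (binary (nat \<bar>z\<bar>)) @ [False]"
  by (simp add: encode_int_def marked_def)

definition stored :: "int list \<Rightarrow> env \<times> env \<Rightarrow> bool" where
  "stored zs s \<longleftrightarrow> fst s 9 = int (length zs) \<and> (\<forall>i<length zs. snd s i = zs ! i)"

definition at_sign :: "int list \<Rightarrow> env \<times> env \<Rightarrow> bool" where
  "at_sign zs s \<longleftrightarrow> stored zs s \<and> fst s 3 = 0 \<and> fst s 4 = 0"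

definition in_number :: "int \<Rightarrow> int list \<Rightarrow> bool \<Rightarrow> bool list \<Rightarrow> env \<times> env \<Rightarrow> bool" where
  "in_number ph zs b ds s \<longleftrightarrow> stored zs s \<and> fst s 3 = 0 \<and> fst s 4 = ph \<and> fst s 5 = of_bool b \<and>
    fst s 6 = int (digits_value ds) \<and> fst s 7 = 2 ^ length ds \<and> fst s 8 = of_bool (ds = [] \<or> last ds)"

definition feed :: "bool \<Rightarrow> env \<times> env \<Rightarrow> env \<times> env" where
  "feed b s = run parser ((fst s)(1 := if b then 2 else 1), snd s)"

lemma feed_sign: "at_sign zs s \<Longrightarrow> in_number 1 zs b [] (feed b s)"
  by (auto simp: at_sign_def in_number_def feed_def parser_def stored_def)

lemma feed_continue: "in_number 1 zs b ds s \<Longrightarrow> in_number 2 zs b ds (feed True s)"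
  by (auto simp: in_number_def feed_def parser_def stored_def)

lemma feed_digit: "in_number 2 zs b ds s \<Longrightarrow> in_number 1 zs b (ds @ [c]) (feed c s)"
  by (auto simp: in_number_def feed_def parser_def stored_def digits_value_snoc)

text \<open>A most significant digit 0 and a negative zero must be rejected, as they encode no
  integer. The first part serves soundness, the second completeness.\<close>

lemma feed_end:
  assumes "in_number 1 zs b ds s"
  shows "fst (feed False s) 3 \<noteq> 0 \<or> (\<exists>z. at_sign (zs @ [z]) (feed False s) \<and> encode_int z = b # marked ds @ [False])"
    "encode_int z = b # marked ds @ [False] \<Longrightarrow> ds = binary (nat \<bar>z\<bar>) \<Longrightarrow> at_sign (zs @ [z]) (feed False s)"
proof -
  let ?v = "int (digits_value ds)"
  have s: "stored zs s" "fst s 3 = 0" "fst s 4 = 1" "fst s 5 = of_bool b" "fst s 6 = ?v"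
    "fst s 8 = of_bool (ds = [] \<or> last ds)" using assms by (auto simp: in_number_def)
  have st: "at_sign (zs @ [if b then - ?v else ?v]) (feed False s)" if "ds = [] \<or> last ds" "b \<longrightarrow> ?v \<noteq> 0"
    using s that by (auto simp: feed_def parser_def stored_def at_sign_def nth_append fail_def)
  have bad: "fst (feed False s) 3 \<noteq> 0" if "\<not> ((ds = [] \<or> last ds) \<and> (b \<longrightarrow> ?v \<noteq> 0))"
    using s that by (auto simp: feed_def parser_def fail_def)
  show "fst (feed False s) 3 \<noteq> 0 \<or> (\<exists>z. at_sign (zs @ [z]) (feed False s) \<and> encode_int z = b # marked ds @ [False])"
  proof (cases "(ds = [] \<or> last ds) \<and> (b \<longrightarrow> ?v \<noteq> 0)")
    case True
    then have "encode_int (if b then - ?v else ?v) = b # marked ds @ [False]"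
      using binary_digits_value[of ds] by (auto simp: encode_int_marked)
    then show ?thesis using st True by blast
  qed (use bad in blast)
  show "at_sign (zs @ [z]) (feed False s)" if z: "encode_int z = b # marked ds @ [False]" "ds = binary (nat \<bar>z\<bar>)"
  proof -
    have b: "b \<longleftrightarrow> z < 0" using z(1) by (simp add: encode_int_marked)
    have v: "?v = \<bar>z\<bar>" unfolding z(2) digits_value_binary by simp
    have "ds = [] \<or> last ds" using last_binary z(2) by blast
    moreover have "b \<longrightarrow> ?v \<noteq> 0" using b v by simp
    moreover have "(if b then - ?v else ?v) = z" using b v by auto
    ultimately show ?thesis using st by metis
  qed
qed

lemma feed_fail: "fst s 3 \<noteq> 0 \<Longrightarrow> fst (feed b s) 3 \<noteq> 0"
  by (auto simp: feed_def parser_def fail_def)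

lemma fold_feed_number:
  assumes "at_sign zs s"
  shows "at_sign (zs @ [z]) (fold feed (encode_int z) s)"
proof -
  have "in_number 1 zs b ds (fold feed (marked ds) (feed b s))" for b ds
  proof (induction ds rule: rev_induct)
    case Nil
    show ?case using feed_sign[OF assms] by (simp add: marked_def)
  next
    case (snoc c ds)
    then show ?case using feed_digit[OF feed_continue] by (simp add: marked_def)
  qed
  from feed_end(2)[OF this] show ?thesis by (simp add: encode_int_marked)
qed

lemma fold_feed_list: "at_sign zs s \<Longrightarrow> at_sign (zs @ zs') (fold feed (encode_list zs') s)"
proof (induction zs' arbitrary: zs s)
  case (Cons z zs')
  from Cons.IH[OF fold_feed_number[OF Cons.prems]] show ?case by (simp add: encode_list_def)
qed (simp add: encode_list_def)

text \<open>The alternatives are the states of the parser: failed, or in phase 0, 1 or 2. Hence a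
  word that ends in phase 0 without an error is a complete list.\<close>

lemma fold_feed_sound:
  assumes "at_sign [] s"
  shows "let s' = fold feed w s in fst s' 3 \<noteq> 0 \<or> (\<exists>zs. w = encode_list zs \<and> at_sign zs s') \<or>
    (\<exists>zs b ds. w = encode_list zs @ b # marked ds \<and> in_number 1 zs b ds s') \<or>
    (\<exists>zs b ds. w = encode_list zs @ b # marked ds @ [True] \<and> in_number 2 zs b ds s')"
proof (induction w rule: rev_induct)
  case Nil
  then show ?case using assms by (auto simp: encode_list_def intro!: exI[of _ "[]"])
next
  case (snoc c w)
  let ?s = "fold feed w s"
  have f: "fold feed (w @ [c]) s = feed c ?s" by simp
  from snoc consider "fst ?s 3 \<noteq> 0" | zs where "w = encode_list zs" "at_sign zs ?s"
    | zs b ds where "w = encode_list zs @ b # marked ds" "in_number 1 zs b ds ?s"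
    | zs b ds where "w = encode_list zs @ b # marked ds @ [True]" "in_number 2 zs b ds ?s"
    unfolding Let_def by blast
  then show ?case
  proof cases
    case 1
    then show ?thesis unfolding f Let_def using feed_fail by blast
  next
    case (2 zs)
    then have "w @ [c] = encode_list zs @ c # marked []" by (simp add: marked_def)
    then show ?thesis unfolding f Let_def using feed_sign[OF 2(2)] by blast
  next
    case (3 zs b ds)
    show ?thesis
    proof (cases c)
      case True
      then have "w @ [c] = encode_list zs @ b # marked ds @ [True]" using 3 by simp
      then show ?thesis unfolding f Let_def using feed_continue[OF 3(2)] True by auto
    next
      case False
      have "w @ [c] = encode_list (zs @ [z])" if "encode_int z = b # marked ds @ [False]" for z
        using 3(1) False that by (simp add: encode_list_def)
      then show ?thesis unfolding f Let_def using feed_end(1)[OF 3(2)] False by auto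
    qed
  next
    case (4 zs b ds)
    then have "w @ [c] = encode_list zs @ b # marked (ds @ [c])" by (simp add: marked_def)
    then show ?thesis unfolding f Let_def using feed_digit[OF 4(2)] by blast
  qed
qed

lemma after_input_parser:
  "after_input parser k (letters w) = (let s = fold feed w ((\<lambda>_. 0)(0 := k), \<lambda>_. 0) in ((fst s)(1 := 0), snd s))"
proof -
  have "consume parser (letters w) s = (let s = fold feed w s in ((fst s)(1 := 0), snd s))" for s
    by (induction w arbitrary: s) (auto simp: letters_def feed_def)
  then show ?thesis by (simp add: after_input_def)
qed

lemma parser_correct:
  fixes k :: int and w :: "bool list"
  defines "s \<equiv> after_input parser k (letters w)"
  shows "w = encode_list zs \<Longrightarrow> at_sign zs s"
    "fst s 3 = 0 \<Longrightarrow> fst s 4 = 0 \<Longrightarrow> \<exists>zs. w = encode_list zs"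
    "fst s 0 = k"
proof -
  let ?init = "((\<lambda>_. 0)(0 := k), \<lambda>_. 0) :: env \<times> env"
  let ?s = "fold feed w ?init"
  have s1: "fst s x = fst ?s x" if "x \<noteq> 1" for x
    using that by (auto simp: s_def after_input_parser Let_def)
  have s2: "snd s = snd ?s" by (simp add: s_def after_input_parser Let_def)
  note s = s1 s2
  have s0: "at_sign [] ?init" by (simp add: at_sign_def stored_def)
  show "at_sign zs s" if "w = encode_list zs"
  proof -
    have "at_sign zs ?s" using fold_feed_list[OF s0, of zs] unfolding that by simp
    then show ?thesis using s unfolding at_sign_def stored_def by simp
  qed
  show "\<exists>zs. w = encode_list zs" if "fst s 3 = 0" "fst s 4 = 0"
    using fold_feed_sound[OF s0, of w] that s by (auto simp: Let_def in_number_def)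
  have "fst (fold feed w s1) 0 = fst s1 0" for s1
  proof (induction w arbitrary: s1)
    case (Cons b w)
    have "0 \<notin> writes parser" by (simp add: parser_def fail_def)
    then have "fst (feed b s1) 0 = fst s1 0" by (simp add: feed_def run_frame)
    then show ?case using Cons by simp
  qed simp
  then show "fst s 0 = k" using s1[of 0] by simp
qed

section \<open>The decision procedure\<close>

text \<open>\<open>J i\<close> describes the state when \<open>i\<close> iterations are still to
  come, and it must not depend on the loop variable. The step may use that unwritten variables, and
  the array if there is no \<open>Put\<close>, are as before the loop.\<close>

lemma For_rule:
  assumes "\<And>i s v. J i s \<Longrightarrow> J i ((fst s)(x := v), snd s)" "J (nat (fst s y)) s"
    and step: "\<And>i s'. i < nat (fst s y) \<Longrightarrow> fst s' x = int i \<Longrightarrow> J (Suc i) s' \<Longrightarrow>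
      (\<And>z. z \<notin> insert x (writes c) \<Longrightarrow> fst s' z = fst s z) \<Longrightarrow> (\<not> puts c \<Longrightarrow> snd s' = snd s) \<Longrightarrow> J i (run c s')"
  shows "J 0 (run (For x y c) s)"
proof -
  let ?I = "\<lambda>i s'. J i s' \<and> (\<forall>z. z \<notin> insert x (writes c) \<longrightarrow> fst s' z = fst s z) \<and> (\<not> puts c \<longrightarrow> snd s' = snd s)"
  have "?I 0 (run (For x y c) s)"
    unfolding run.simps
  proof (rule iter_invariant[where I = ?I])
    show "?I (nat (fst s y)) ((fst s)(x := fst s y), snd s)" using assms(1,2) by simp
    fix i s' assume i: "i < nat (fst s y)" "?I (Suc i) s'"
    let ?s = "((fst s')(x := int i), snd s')"
    have "J i (run c ?s)" by (rule step) (use i assms(1) in auto)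
    moreover have "fst (run c ?s) z = fst s z" if "z \<notin> insert x (writes c)" for z
      using i that by (simp add: run_frame)
    moreover have "snd (run c ?s) = snd s" if "\<not> puts c" using i that by (simp add: run_no_puts)
    ultimately show "?I i (run c ?s)" by blast
  qed
  then show ?thesis by blast
qed

text \<open>Later stages run even after an error, so they must not clear variable 3.\<close>

primrec keeps_fail :: "com \<Rightarrow> bool" where
  "keeps_fail Skip = True"
| "keeps_fail (Asg x e) \<longleftrightarrow> x = 3 \<longrightarrow> e = Atom (C 1)"
| "keeps_fail (Get x e) \<longleftrightarrow> x \<noteq> 3"
| "keeps_fail (Put e x) = True"
| "keeps_fail (c1 ;; c2) \<longleftrightarrow> keeps_fail c1 \<and> keeps_fail c2"
| "keeps_fail (IfPos e c1 c2) \<longleftrightarrow> keeps_fail c1 \<and> keeps_fail c2"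
| "keeps_fail (IfZero e c1 c2) \<longleftrightarrow> keeps_fail c1 \<and> keeps_fail c2"
| "keeps_fail (For x y c) \<longleftrightarrow> x \<noteq> 3 \<and> keeps_fail c"

lemma run_keeps_fail: "keeps_fail c \<Longrightarrow> fst s 3 \<noteq> 0 \<Longrightarrow> fst (run c s) 3 \<noteq> 0"
proof (induction c arbitrary: s)
  case (For x y c)
  show ?case unfolding run.simps
    by (rule iter_invariant[where I = "\<lambda>_ s'. fst s' 3 \<noteq> 0"]) (use For.prems in \<open>auto simp: For.IH\<close>)
qed auto

definition idx :: "nat \<Rightarrow> nat \<Rightarrow> nat \<Rightarrow> exp" where
  "idx r c k = Bin (Bin (Bin (Bin (Atom (V r)) Times (V 0)) Plus (V c)) Times (C 2)) Plus (C (int k))"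

text \<open>The numerator of entry \<open>(i, j)\<close> is stored at \<open>loc d 3 i j\<close>, its denominator at \<open>loc d 4 i j\<close>.\<close>
definition loc :: "nat \<Rightarrow> nat \<Rightarrow> nat \<Rightarrow> nat \<Rightarrow> nat" where
  "loc d k i j = k + 2 * (i * d + j)"

lemma eval_idx:
  assumes "v 0 = int d" "v r = int i" "v c = int j"
  shows "nat (eval (idx r c k) v) = loc d k i j"
proof -
  have "eval (idx r c k) v = int (loc d k i j)" using assms by (simp add: idx_def loc_def algebra_simps)
  then show ?thesis by simp
qed

lemma loc_eq_iff:
  assumes "j < d" "j' < d"
  shows "loc d k i j = loc d k i' j' \<longleftrightarrow> i = i' \<and> j = j'"
proof
  assume "loc d k i j = loc d k i' j'"
  then have e: "i * d + j = i' * d + j'" by (simp add: loc_def)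
  then have "(i * d + j) div d = (i' * d + j') div d" "(i * d + j) mod d = (i' * d + j') mod d" by simp_all
  then show "i = i' \<and> j = j'" using assms by simp
qed simp

lemma loc_parity: "loc d 3 i j \<noteq> loc d 4 i' j'" "loc d 4 i j \<noteq> loc d 3 i' j'"
  unfolding loc_def by presburger+

lemma loc_zs: "zs ! loc d 3 i j = numer zs (1 + (i * d + j))" "zs ! loc d 4 i j = denom zs (1 + (i * d + j))"
proof -
  have "loc d 3 i j = 1 + 2 * (1 + (i * d + j))" "loc d 4 i j = 2 + 2 * (1 + (i * d + j))"
    by (simp_all add: loc_def)
  then show "zs ! loc d 3 i j = numer zs (1 + (i * d + j))" "zs ! loc d 4 i j = denom zs (1 + (i * d + j))"
    by (simp_all only: numer_def denom_def)
qed

lemma loc_less: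
  assumes "i < d" "j < d" "k \<le> 4"
  shows "loc d k i j < 3 + 2 * (d * d)"
proof -
  have "i * d + j < (i + 1) * d" using assms by simp
  also have "\<dots> \<le> d * d" using assms by (intro mult_right_mono) auto
  finally show ?thesis using assms(3) by (simp add: loc_def)
qed

subsection \<open>Enumerating sign patterns\<close>

definition two_power :: com where
  "two_power = Asg 15 (Atom (C 1)) ;; For 12 0 (Asg 15 (Bin (Atom (V 15)) Plus (V 15)))"

lemma run_two_power:
  assumes "fst s 0 = int d"
  shows "fst (run two_power s) 15 = 2 ^ d"
proof -
  let ?s = "run (Asg 15 (Atom (C 1))) s"
  have "fst (run (For 12 0 (Asg 15 (Bin (Atom (V 15)) Plus (V 15)))) ?s) 15 * 2 ^ 0 = 2 ^ d"
    by (rule For_rule[where J = "\<lambda>i s. fst s 15 * 2 ^ i = 2 ^ d"]) (use assms in auto)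
  then show ?thesis by (simp add: two_power_def del: run.simps(8))
qed

subsection \<open>Well-formedness\<close>

text \<open>Variables \<open>20\<close> and \<open>21\<close> receive the numerator and the denominator of the threshold, and variable
  \<open>14\<close> will hold the common denominator of the entries of the vectors.\<close>
definition checks :: com where
  "checks =
    IfZero (Atom (V 4)) Skip fail ;;
    IfZero (Bin (Bin (Bin (Bin (Atom (V 0)) Times (V 0)) Times (C 2)) Plus (C 3)) Minus (V 9)) Skip fail ;;
    Get 10 (Atom (C 0)) ;; IfZero (Bin (Atom (V 10)) Minus (V 0)) Skip fail ;;
    IfPos (Atom (V 0)) Skip fail ;;
    Get 20 (Atom (C 1)) ;; Get 21 (Atom (C 2)) ;; IfPos (Atom (V 21)) Skip fail"

lemma run_checks:
  "fst (run checks s) 3 = 0 \<longleftrightarrow> fst s 3 = 0 \<and> fst s 4 = 0 \<and> fst s 0 * fst s 0 * 2 + 3 = fst s 9 \<and>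
     snd s 0 = fst s 0 \<and> fst s 0 > 0 \<and> snd s 2 > 0"
  "fst (run checks s) 20 = snd s 1" "fst (run checks s) 21 = snd s 2" "snd (run checks s) = snd s"
  by (auto simp: checks_def fail_def)

definition denoms_row :: com where
  "denoms_row = For 13 0 (Get 10 (idx 12 13 4) ;; IfPos (Atom (V 10)) Skip fail ;;
     Asg 14 (Bin (Atom (V 14)) Times (V 10)))"

lemma run_denoms_row:
  assumes "fst s 0 = int d" "fst s 12 = int i"
  shows "fst (run denoms_row s) 14 = fst s 14 * (\<Prod>j<d. snd s (loc d 4 i j)) \<and>
    (fst (run denoms_row s) 3 = 0 \<longleftrightarrow> fst s 3 = 0 \<and> (\<forall>j<d. snd s (loc d 4 i j) > 0))"
proof -
  let ?b = "\<lambda>j. snd s (loc d 4 i j)"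
  \<comment> \<open>As the loop counts down, the indices already treated are those from
    \<open>n\<close> on; the later invariants have the same form.\<close>
  let ?J = "\<lambda>n s'. fst s' 14 = fst s 14 * (\<Prod>j=n..<d. ?b j) \<and>
    (fst s' 3 = 0 \<longleftrightarrow> fst s 3 = 0 \<and> (\<forall>j\<in>{n..<d}. ?b j > 0))"
  have "?J 0 (run denoms_row s)"
    unfolding denoms_row_def
  proof (rule For_rule[where J = ?J])
    fix j s' assume j: "j < nat (fst s 0)" "fst s' 13 = int j" and J: "?J (Suc j) s'"
      and fr: "\<And>z. z \<notin> insert 13 (writes (Get 10 (idx 12 13 4) ;; IfPos (Atom (V 10)) Skip fail ;;
        Asg 14 (Bin (Atom (V 14)) Times (V 10)))) \<Longrightarrow> fst s' z = fst s z"
      and m: "\<not> puts (Get 10 (idx 12 13 4) ;; IfPos (Atom (V 10)) Skip fail ;;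
        Asg 14 (Bin (Atom (V 14)) Times (V 10))) \<Longrightarrow> snd s' = snd s"
    have f: "fst s' 0 = int d" "fst s' 12 = int i" using fr[of 0] fr[of 12] assms by (simp_all add: fail_def)
    have mem: "snd s' = snd s" using m by (simp add: fail_def)
    have I: "{j..<d} = insert j {Suc j..<d}" using j(1) assms(1) by auto
    show "?J j (run (Get 10 (idx 12 13 4) ;; IfPos (Atom (V 10)) Skip fail ;;
        Asg 14 (Bin (Atom (V 14)) Times (V 10))) s')"
      unfolding I using f j(2) mem J by (auto simp: eval_idx[of _ d _ i _ j] fail_def)
  qed (use assms in auto)
  then show ?thesis by (auto simp: atLeast0LessThan)
qed

definition denoms :: com where
  "denoms = Asg 14 (Atom (C 1)) ;; For 12 0 denoms_row"

lemma writes_denoms_row: "writes denoms_row = {13, 10, 3, 14}" "\<not> puts denoms_row"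
  by (auto simp: denoms_row_def fail_def)

lemma run_denoms:
  assumes "fst s 0 = int d"
  shows "fst (run denoms s) 14 = (\<Prod>i<d. \<Prod>j<d. snd s (loc d 4 i j)) \<and>
    (fst (run denoms s) 3 = 0 \<longleftrightarrow> fst s 3 = 0 \<and> (\<forall>i<d. \<forall>j<d. snd s (loc d 4 i j) > 0))"
proof -
  let ?J = "\<lambda>n s'. fst s' 14 = (\<Prod>i=n..<d. \<Prod>j<d. snd s (loc d 4 i j)) \<and>
    (fst s' 3 = 0 \<longleftrightarrow> fst s 3 = 0 \<and> (\<forall>i\<in>{n..<d}. \<forall>j<d. snd s (loc d 4 i j) > 0))"
  let ?s = "run (Asg 14 (Atom (C 1))) s"
  have "?J 0 (run (For 12 0 denoms_row) ?s)"
  proof (rule For_rule[where J = ?J])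
    fix i s' assume i: "i < nat (fst ?s 0)" "fst s' 12 = int i" and J: "?J (Suc i) s'"
      and fr: "\<And>z. z \<notin> insert 12 (writes denoms_row) \<Longrightarrow> fst s' z = fst ?s z"
      and m: "\<not> puts denoms_row \<Longrightarrow> snd s' = snd ?s"
    have f: "fst s' 0 = int d" using fr[of 0] assms by (simp add: writes_denoms_row)
    have mem: "snd s' = snd s" using m by (simp add: writes_denoms_row)
    have I: "{i..<d} = insert i {Suc i..<d}" using i(1) assms by auto
    show "?J i (run denoms_row s')"
      unfolding I using run_denoms_row[OF f i(2)] J by (auto simp: mem)
  qed (use assms in auto)
  then show ?thesis by (auto simp: denoms_def atLeast0LessThan simp del: run.simps(8))
qed

subsection \<open>Common denominator\<close>

text \<open>The division is unguarded: where a denominator is not positive, \<open>denoms\<close>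
  has already set the flag, and division by 0 does not stop the machine.\<close>

definition scale_entry :: com where
  "scale_entry = Get 10 (idx 12 13 4) ;; Get 11 (idx 12 13 3) ;; Asg 22 (Bin (Atom (V 14)) Divide (V 10)) ;;
     Asg 11 (Bin (Atom (V 11)) Times (V 22)) ;; Put (idx 12 13 3) 11"

definition scale_row :: com where
  "scale_row = For 13 0 scale_entry"

definition scale :: com where
  "scale = For 12 0 scale_row"

lemma run_scale_entry:
  assumes "fst s 0 = int d" "fst s 12 = int i" "fst s 13 = int j"
  shows "snd (run scale_entry s) = (snd s)(loc d 3 i j := snd s (loc d 3 i j) * (fst s 14 div snd s (loc d 4 i j)))"
  using assms by (simp add: scale_entry_def eval_idx[of _ d _ i _ j])

lemma run_scale_row:
  assumes "fst s 0 = int d" "fst s 12 = int i"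
  defines "s' \<equiv> run scale_row s"
  shows "snd s' (loc d 4 a b) = snd s (loc d 4 a b)"
    "b < d \<Longrightarrow> snd s' (loc d 3 a b) =
      (if a = i then snd s (loc d 3 a b) * (fst s 14 div snd s (loc d 4 a b)) else snd s (loc d 3 a b))"
proof -
  let ?J = "\<lambda>n s'. (\<forall>a b. snd s' (loc d 4 a b) = snd s (loc d 4 a b)) \<and> (\<forall>a b. b < d \<longrightarrow> snd s' (loc d 3 a b) =
      (if a = i \<and> n \<le> b then snd s (loc d 3 a b) * (fst s 14 div snd s (loc d 4 a b)) else snd s (loc d 3 a b)))"
  have "?J 0 s'"
    unfolding s'_def scale_row_def
  proof (rule For_rule[where J = ?J])
    fix j s' assume j: "j < nat (fst s 0)" "fst s' 13 = int j" and J: "?J (Suc j) s'"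
      and fr: "\<And>z. z \<notin> insert 13 (writes scale_entry) \<Longrightarrow> fst s' z = fst s z"
    have f: "fst s' 0 = int d" "fst s' 12 = int i" "fst s' 14 = fst s 14"
      using fr[of 0] fr[of 12] fr[of 14] assms by (simp_all add: scale_entry_def)
    have jd: "j < d" using j(1) assms(1) by simp
    show "?J j (run scale_entry s')"
      using J jd by (auto simp: run_scale_entry[OF f(1,2) j(2)] f(3) loc_parity loc_eq_iff)
  qed (use assms in auto)
  then show "snd s' (loc d 4 a b) = snd s (loc d 4 a b)"
    "b < d \<Longrightarrow> snd s' (loc d 3 a b) =
      (if a = i then snd s (loc d 3 a b) * (fst s 14 div snd s (loc d 4 a b)) else snd s (loc d 3 a b))"
    by auto
qed

lemma run_scale:
  assumes "fst s 0 = int d" "a < d" "b < d"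
  shows "snd (run scale s) (loc d 3 a b) = snd s (loc d 3 a b) * (fst s 14 div snd s (loc d 4 a b))"
proof -
  let ?J = "\<lambda>n s'. (\<forall>a b. snd s' (loc d 4 a b) = snd s (loc d 4 a b)) \<and> (\<forall>a<d. \<forall>b<d. snd s' (loc d 3 a b) =
      (if n \<le> a then snd s (loc d 3 a b) * (fst s 14 div snd s (loc d 4 a b)) else snd s (loc d 3 a b)))"
  have "?J 0 (run scale s)"
    unfolding scale_def
  proof (rule For_rule[where J = ?J])
    fix i s' assume i: "i < nat (fst s 0)" "fst s' 12 = int i" and J: "?J (Suc i) s'"
      and fr: "\<And>z. z \<notin> insert 12 (writes scale_row) \<Longrightarrow> fst s' z = fst s z"
    have f: "fst s' 0 = int d" "fst s' 14 = fst s 14"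
      using fr[of 0] fr[of 14] assms by (simp_all add: scale_row_def scale_entry_def)
    show "?J i (run scale_row s')"
      using J by (auto simp: run_scale_row[OF f(1) i(2)] f(2))
  qed (use assms in auto)
  then show ?thesis using assms by auto
qed

subsection \<open>Vertices\<close>

text \<open>The exponent is a constant of the problem, so the power is unrolled and requires no loop
  limit.\<close>

primrec mul_times :: "nat \<Rightarrow> nat \<Rightarrow> nat \<Rightarrow> com" where
  "mul_times x y 0 = Skip"
| "mul_times x y (Suc n) = Asg x (Bin (Atom (V x)) Times (V y)) ;; mul_times x y n"

lemma run_mul_times: "x \<noteq> y \<Longrightarrow> run (mul_times x y n) s = ((fst s)(x := fst s x * fst s y ^ n), snd s)"
  by (induction n arbitrary: s) auto

lemma mul_times_syntax:
  "writes (mul_times x y n) \<subseteq> {x}" "\<not> puts (mul_times x y n)" "limits (mul_times x y n) = {}"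
  "wf_com (mul_times x y n)" "x \<noteq> 3 \<Longrightarrow> keeps_fail (mul_times x y n)"
  by (induction n) auto

text \<open>Variable \<open>16\<close> numbers the vertices: its binary digits, taken off one by one in variable \<open>24\<close>,
  tell whether the coefficient of a vector is \<open>1\<close> or \<open>lo\<close>.\<close>
definition add_vector :: "int \<Rightarrow> com" where
  "add_vector lo = Get 11 (idx 12 13 3) ;; Asg 10 (Bin (Atom (V 24)) Divide (C 2)) ;;
     Asg 25 (Bin (Bin (Atom (V 24)) Minus (V 10)) Minus (V 10)) ;; Asg 24 (Atom (V 10)) ;;
     IfZero (Atom (V 25)) (Asg 11 (Bin (Atom (V 11)) Times (C lo))) Skip ;;
     Asg 18 (Bin (Atom (V 18)) Plus (V 11))"

definition coordinate :: "int \<Rightarrow> com" where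
  "coordinate lo = Asg 24 (Atom (V 16)) ;; Asg 18 (Atom (C 0)) ;; For 12 0 (add_vector lo)"

text \<open>The loop starts with vector \<open>d - 1\<close> and takes off the lowest digit first,
  so vector \<open>i\<close> belongs to digit \<open>d - Suc i\<close>.\<close>

definition coeff :: "int \<Rightarrow> nat \<Rightarrow> nat \<Rightarrow> nat \<Rightarrow> int" where
  "coeff lo d e i = (if odd (e div 2 ^ (d - Suc i)) then 1 else lo)"

lemma run_coordinate:
  assumes "fst s 0 = int d" "fst s 13 = int j" "fst s 16 = int e"
  shows "fst (run (coordinate lo) s) 18 = (\<Sum>i<d. coeff lo d e i * snd s (loc d 3 i j))"
proof -
  let ?s = "run (Asg 18 (Atom (C 0))) (run (Asg 24 (Atom (V 16))) s)"
  let ?J = "\<lambda>n s'. fst s' 24 = int (e div 2 ^ (d - n)) \<and> fst s' 18 = (\<Sum>i=n..<d. coeff lo d e i * snd s (loc d 3 i j))"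
  have "?J 0 (run (For 12 0 (add_vector lo)) ?s)"
  proof (rule For_rule[where J = ?J])
    fix i s' assume i: "i < nat (fst ?s 0)" "fst s' 12 = int i" and J: "?J (Suc i) s'"
      and fr: "\<And>z. z \<notin> insert 12 (writes (add_vector lo)) \<Longrightarrow> fst s' z = fst ?s z"
      and m: "\<not> puts (add_vector lo) \<Longrightarrow> snd s' = snd ?s"
    have f: "fst s' 0 = int d" "fst s' 13 = int j" using fr[of 0] fr[of 13] assms by (simp_all add: add_vector_def)
    have mem: "snd s' = snd s" using m by (simp add: add_vector_def)
    have I: "{i..<d} = insert i {Suc i..<d}" and id: "i < d" using i(1) assms by auto
    let ?q = "e div 2 ^ (d - Suc i)"
    have "d - i = Suc (d - Suc i)" using id by simp
    then have half: "e div 2 ^ (d - i) = ?q div 2" by (simp only: power_Suc2 div_mult2_eq)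
    \<comment> \<open>There is no remainder operation; the lowest digit is obtained by subtracting
      the half twice.\<close>
    have rest: "int ?q - int ?q div 2 - int ?q div 2 = of_bool (odd ?q)"
      by (cases "odd ?q") (auto elim!: oddE evenE)
    have q: "fst s' 24 = int ?q" using J by simp
    show "?J i (run (add_vector lo) s')"
      unfolding I half using f i(2) mem J rest
      by (auto simp: add_vector_def eval_idx[of _ d _ i _ j] q coeff_def zdiv_int simp del: of_nat_div)
  qed (use assms in auto)
  then show ?thesis by (simp add: coordinate_def atLeast0LessThan del: run.simps(8))
qed

definition add_coordinate :: "int \<Rightarrow> nat \<Rightarrow> com" where
  "add_coordinate lo p = coordinate lo ;; IfPos (Atom (V 18)) Skip (Asg 18 (Bin (Atom (C 0)) Minus (V 18))) ;;
     Asg 26 (Atom (C 1)) ;; mul_times 26 18 p ;; Asg 19 (Bin (Atom (V 19)) Plus (V 26))"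

lemma add_coordinate_syntax:
  "writes (add_coordinate lo p) \<subseteq> {10, 11, 12, 18, 19, 24, 25, 26}" "\<not> puts (add_coordinate lo p)"
  "limits (add_coordinate lo p) = {0}" "wf_com (add_coordinate lo p)" "keeps_fail (add_coordinate lo p)"
  using mul_times_syntax[of 26 18 p]
  by (auto simp: add_coordinate_def coordinate_def add_vector_def)

lemma run_add_coordinate:
  assumes "fst s 0 = int d" "fst s 13 = int j" "fst s 16 = int e"
  shows "fst (run (add_coordinate lo p) s) 19 = fst s 19 + \<bar>\<Sum>i<d. coeff lo d e i * snd s (loc d 3 i j)\<bar> ^ p"
proof -
  have "19 \<notin> writes (coordinate lo)" by (simp add: coordinate_def add_vector_def)
  then have "fst (run (coordinate lo) s) 19 = fst s 19" by (rule run_frame)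
  then show ?thesis using run_coordinate[OF assms, of lo]
    by (auto simp: add_coordinate_def run_mul_times)
qed

definition vertex_sum :: "int \<Rightarrow> nat \<Rightarrow> com" where
  "vertex_sum lo p = Asg 19 (Atom (C 0)) ;; For 13 0 (add_coordinate lo p)"

lemma run_vertex_sum:
  assumes "fst s 0 = int d" "fst s 16 = int e"
  shows "fst (run (vertex_sum lo p) s) 19 = (\<Sum>j<d. \<bar>\<Sum>i<d. coeff lo d e i * snd s (loc d 3 i j)\<bar> ^ p)"
proof -
  let ?f = "\<lambda>j. \<bar>\<Sum>i<d. coeff lo d e i * snd s (loc d 3 i j)\<bar> ^ p"
  let ?s = "run (Asg 19 (Atom (C 0))) s"
  let ?J = "\<lambda>n s'. fst s' 19 = (\<Sum>j=n..<d. ?f j)"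
  have "?J 0 (run (For 13 0 (add_coordinate lo p)) ?s)"
  proof (rule For_rule[where J = ?J])
    fix j s' assume j: "j < nat (fst ?s 0)" "fst s' 13 = int j" and J: "?J (Suc j) s'"
      and fr: "\<And>z. z \<notin> insert 13 (writes (add_coordinate lo p)) \<Longrightarrow> fst s' z = fst ?s z"
      and m: "\<not> puts (add_coordinate lo p) \<Longrightarrow> snd s' = snd ?s"
    have "fst s' 0 = fst ?s 0" "fst s' 16 = fst ?s 16"
      by (rule fr; use add_coordinate_syntax(1)[of lo p] in auto)+
    then have f: "fst s' 0 = int d" "fst s' 16 = int e" using assms by simp_all
    have mem: "snd s' = snd s" using m add_coordinate_syntax(2) by simp
    have I: "{j..<d} = insert j {Suc j..<d}" using j(1) assms by auto
    show "?J j (run (add_coordinate lo p) s')"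
      unfolding I using run_add_coordinate[OF f(1) j(2) f(2), of lo p] J by (simp add: mem)
  qed (use assms in auto)
  then show ?thesis by (simp add: vertex_sum_def atLeast0LessThan del: run.simps(8))
qed

lemma vertex_sum_syntax:
  "writes (vertex_sum lo p) \<subseteq> {10, 11, 12, 13, 18, 19, 24, 25, 26}" "\<not> puts (vertex_sum lo p)"
  "limits (vertex_sum lo p) = {0}" "wf_com (vertex_sum lo p)" "keeps_fail (vertex_sum lo p)"
  using add_coordinate_syntax[of lo p] by (auto simp: vertex_sum_def)

text \<open>The only order test is strict; adding 1 makes equality of integers count as
  success.\<close>

definition try_vertex :: "int \<Rightarrow> nat \<Rightarrow> com" where
  "try_vertex lo p = vertex_sum lo p ;; Asg 19 (Bin (Atom (V 19)) Times (V 21)) ;;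
     Asg 27 (Bin (Atom (V 20)) Times (V 23)) ;;
     IfPos (Bin (Bin (Atom (V 19)) Minus (V 27)) Plus (C 1)) (Asg 17 (Atom (C 1))) Skip"

definition vertices :: "int \<Rightarrow> nat \<Rightarrow> com" where
  "vertices lo p = Asg 17 (Atom (C 0)) ;; Asg 23 (Atom (C 1)) ;; mul_times 23 14 p ;;
     For 16 15 (try_vertex lo p) ;; IfPos (Atom (V 17)) Skip fail"

lemma try_vertex_syntax:
  "writes (try_vertex lo p) \<subseteq> {10, 11, 12, 13, 17, 18, 19, 24, 25, 26, 27}" "\<not> puts (try_vertex lo p)"
  "limits (try_vertex lo p) = {0}" "wf_com (try_vertex lo p)" "keeps_fail (try_vertex lo p)"
  using vertex_sum_syntax[of lo p] by (auto simp: try_vertex_def)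

lemma run_vertices:
  assumes "fst s 0 = int d" "fst s 15 = 2 ^ d"
  shows "snd (run (vertices lo p) s) = snd s"
    "fst (run (vertices lo p) s) 3 = 0 \<longleftrightarrow> fst s 3 = 0 \<and> (\<exists>e<2 ^ d. fst s 20 * fst s 14 ^ p \<le>
      fst s 21 * (\<Sum>j<d. \<bar>\<Sum>i<d. coeff lo d e i * snd s (loc d 3 i j)\<bar> ^ p))"
proof -
  show "snd (run (vertices lo p) s) = snd s"
    by (rule run_no_puts) (use try_vertex_syntax mul_times_syntax in \<open>simp add: vertices_def fail_def\<close>)
  let ?P = "\<lambda>e. fst s 20 * fst s 14 ^ p \<le> fst s 21 * (\<Sum>j<d. \<bar>\<Sum>i<d. coeff lo d e i * snd s (loc d 3 i j)\<bar> ^ p)"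
  let ?s = "run (mul_times 23 14 p) (run (Asg 23 (Atom (C 1))) (run (Asg 17 (Atom (C 0))) s))"
  let ?J = "\<lambda>n s'. fst s' 17 = of_bool (\<exists>e\<in>{n..<2 ^ d}. ?P e)"
  let ?s' = "run (For 16 15 (try_vertex lo p)) ?s"
  have N: "nat (2 ^ d) = 2 ^ d" by (metis nat_int of_nat_numeral of_nat_power)
  have J0: "?J 0 ?s'"
  proof (rule For_rule[where J = ?J])
    show "?J (nat (fst ?s 15)) ?s" using assms N by (simp add: run_mul_times)
    fix e s' assume e: "e < nat (fst ?s 15)" "fst s' 16 = int e" and J: "?J (Suc e) s'"
      and fr: "\<And>z. z \<notin> insert 16 (writes (try_vertex lo p)) \<Longrightarrow> fst s' z = fst ?s z"
      and m: "\<not> puts (try_vertex lo p) \<Longrightarrow> snd s' = snd ?s"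
    have "fst s' 0 = fst ?s 0" "fst s' 20 = fst ?s 20" "fst s' 21 = fst ?s 21" "fst s' 23 = fst ?s 23"
      by (rule fr; use try_vertex_syntax(1)[of lo p] in auto)+
    then have f: "fst s' 0 = int d" "fst s' 20 = fst s 20" "fst s' 21 = fst s 21" "fst s' 23 = fst s 14 ^ p"
      using assms by (simp_all add: run_mul_times)
    have mem: "snd s' = snd s" using m try_vertex_syntax(2) by (simp add: run_mul_times)
    let ?s1 = "run (vertex_sum lo p) s'"
    have "fst ?s1 z = fst s' z" if "z \<in> {17, 20, 21, 23}" for z
      by (rule run_frame) (use that vertex_sum_syntax(1)[of lo p] in auto)
    then have g: "fst ?s1 17 = fst s' 17" "fst ?s1 20 = fst s 20" "fst ?s1 21 = fst s 21" "fst ?s1 23 = fst s 14 ^ p"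
      using f by simp_all
    have ed: "e < 2 ^ d" using e(1) assms(2) N by (simp add: run_mul_times)
    then have I: "{e..<2 ^ d} = insert e {Suc e..<2 ^ d}" by auto
    let ?x = "\<Sum>j<d. \<bar>\<Sum>i<d. coeff lo d e i * snd s (loc d 3 i j)\<bar> ^ p"
    have x: "fst ?s1 19 = ?x" using run_vertex_sum[OF f(1) e(2), of lo p] by (simp only: mem)
    have "fst (run (try_vertex lo p) s') 17 = (if ?x * fst s 21 - fst s 20 * fst s 14 ^ p + 1 > 0 then 1 else fst s' 17)"
      by (simp add: try_vertex_def g x)
    also have "\<dots> = (if ?P e then 1 else fst s' 17)" by (intro if_cong) (auto simp: mult.commute)
    also have "\<dots> = of_bool (\<exists>e\<in>insert e {Suc e..<2 ^ d}. ?P e)" unfolding J by auto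
    finally show "?J e (run (try_vertex lo p) s')" unfolding I .
  qed auto
  have "3 \<notin> writes (For 16 15 (try_vertex lo p))" using try_vertex_syntax(1)[of lo p] by auto
  then have "fst ?s' 3 = fst ?s 3" by (rule run_frame)
  then have "fst ?s' 3 = fst s 3" by (simp add: run_mul_times)
  then show "fst (run (vertices lo p) s) 3 = 0 \<longleftrightarrow> fst s 3 = 0 \<and> (\<exists>e<2 ^ d. ?P e)"
    using J0 by (auto simp: vertices_def fail_def simp del: run.simps(8) split: if_splits)
qed

text \<open>Numbers below \<open>2 ^ d\<close> correspond to subsets through their binary digits.
  Outside the range the coefficient is set to \<open>lo\<close>, so that both sides apply
  \<open>Q\<close> to the same functions.\<close>

lemma coeff_subset:
  "(\<exists>e<2 ^ d. Q (\<lambda>i. if i < d then coeff lo d e i else lo)) \<longleftrightarrow> (\<exists>S\<subseteq>{..<d}. Q (\<lambda>i. if i \<in> S then 1 else lo))"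
proof
  assume "\<exists>e<2 ^ d. Q (\<lambda>i. if i < d then coeff lo d e i else lo)"
  then obtain e where e: "Q (\<lambda>i. if i < d then coeff lo d e i else lo)" by blast
  let ?S = "{i. i < d \<and> odd (e div 2 ^ (d - Suc i))}"
  have "(\<lambda>i. if i < d then coeff lo d e i else lo) = (\<lambda>i. if i \<in> ?S then 1 else lo)"
    by (auto simp: coeff_def)
  with e have "Q (\<lambda>i. if i \<in> ?S then 1 else lo)" by (rule back_subst)
  moreover have "?S \<subseteq> {..<d}" by auto
  ultimately show "\<exists>S\<subseteq>{..<d}. Q (\<lambda>i. if i \<in> S then 1 else lo)" by (intro exI[of _ ?S] conjI)
next
  assume "\<exists>S\<subseteq>{..<d}. Q (\<lambda>i. if i \<in> S then 1 else lo)"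
  then obtain S where S: "S \<subseteq> {..<d}" "Q (\<lambda>i. if i \<in> S then 1 else lo)" by blast
  \<comment> \<open>The order is reversed because digit \<open>k\<close> belongs to vector
    \<open>d - Suc k\<close>.\<close>
  let ?bs = "map (\<lambda>k. d - Suc k \<in> S) [0..<d]"
  define e where "e = (horner_sum of_bool 2 ?bs :: nat)"
  have bits: "odd (e div 2 ^ (d - Suc i)) \<longleftrightarrow> i \<in> S" if "i < d" for i
  proof -
    have "odd (e div 2 ^ (d - Suc i)) \<longleftrightarrow> bit e (d - Suc i)" by (simp add: bit_iff_odd)
    also have "\<dots> \<longleftrightarrow> ?bs ! (d - Suc i)" using that by (simp add: e_def bit_horner_sum_bit_iff)
    finally show ?thesis using that by (simp add: Suc_diff_Suc)
  qed
  have "(\<lambda>i. if i \<in> S then 1 else lo) = (\<lambda>i. if i < d then coeff lo d e i else lo)"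
    using S(1) bits by (intro ext) (auto simp: coeff_def)
  with S(2) have "Q (\<lambda>i. if i < d then coeff lo d e i else lo)" by (rule back_subst)
  moreover have "e < 2 ^ length ?bs" unfolding e_def by (rule horner_sum_of_bool_2_less)
  then have "e < 2 ^ d" by simp
  ultimately show "\<exists>e<2 ^ d. Q (\<lambda>i. if i < d then coeff lo d e i else lo)" by (intro exI[of _ e] conjI)
qed

subsection \<open>Elimination\<close>

text \<open>Variable \<open>28\<close> is the row of the pivot, \<open>29\<close> its value (\<open>0\<close> if the row vanishes) and \<open>30\<close> its column.\<close>
definition find_pivot :: com where
  "find_pivot = Asg 29 (Atom (C 0)) ;; Asg 30 (Atom (C 0)) ;;
     For 13 0 (Get 10 (idx 28 13 3) ;; IfZero (Atom (V 10)) Skip (Asg 29 (Atom (V 10)) ;; Asg 30 (Atom (V 13))))"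

lemma run_find_pivot:
  assumes "fst s 0 = int d" "fst s 28 = int r"
  shows "fst (run find_pivot s) 29 = 0 \<Longrightarrow> j < d \<Longrightarrow> snd s (loc d 3 r j) = 0"
    "fst (run find_pivot s) 29 \<noteq> 0 \<Longrightarrow>
      \<exists>q<d. fst (run find_pivot s) 30 = int q \<and> fst (run find_pivot s) 29 = snd s (loc d 3 r q)"
proof -
  let ?c = "Get 10 (idx 28 13 3) ;; IfZero (Atom (V 10)) Skip (Asg 29 (Atom (V 10)) ;; Asg 30 (Atom (V 13)))"
  let ?s = "run (Asg 30 (Atom (C 0))) (run (Asg 29 (Atom (C 0))) s)"
  let ?J = "\<lambda>n s'. if fst s' 29 = 0 then \<forall>j\<in>{n..<d}. snd s (loc d 3 r j) = 0
    else \<exists>q<d. fst s' 30 = int q \<and> fst s' 29 = snd s (loc d 3 r q)"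
  have "?J 0 (run (For 13 0 ?c) ?s)"
  proof (rule For_rule[where J = ?J])
    fix j s' assume j: "j < nat (fst ?s 0)" "fst s' 13 = int j" and J: "?J (Suc j) s'"
      and fr: "\<And>z. z \<notin> insert 13 (writes ?c) \<Longrightarrow> fst s' z = fst ?s z" and m: "\<not> puts ?c \<Longrightarrow> snd s' = snd ?s"
    have f: "fst s' 0 = int d" "fst s' 28 = int r" using fr[of 0] fr[of 28] assms by simp_all
    have mem: "snd s' = snd s" using m by simp
    have I: "{j..<d} = insert j {Suc j..<d}" and jd: "j < d" using j(1) assms by auto
    show "?J j (run ?c s')"
      unfolding I using f j(2) J jd by (auto simp: mem eval_idx[of _ d _ r _ j])
  qed (use assms in auto)
  then have J: "?J 0 (run find_pivot s)" unfolding find_pivot_def run.simps(5) .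
  show "fst (run find_pivot s) 29 = 0 \<Longrightarrow> j < d \<Longrightarrow> snd s (loc d 3 r j) = 0"
    "fst (run find_pivot s) 29 \<noteq> 0 \<Longrightarrow>
      \<exists>q<d. fst (run find_pivot s) 30 = int q \<and> fst (run find_pivot s) 29 = snd s (loc d 3 r q)"
    using J by auto
qed

definition update_entry :: com where
  "update_entry = Get 10 (idx 12 13 3) ;; Get 11 (idx 28 13 3) ;; Asg 10 (Bin (Atom (V 10)) Times (V 29)) ;;
     Asg 11 (Bin (Atom (V 11)) Times (V 31)) ;; Asg 10 (Bin (Atom (V 10)) Minus (V 11)) ;; Put (idx 12 13 3) 10"

text \<open>The entry in the pivot column is saved in variable 31, since the loop overwrites it
  while it is still needed for other columns.\<close>

definition update_row :: com where
  "update_row = Get 31 (idx 12 30 3) ;; For 13 0 update_entry"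

text \<open>A loop up to variable 28 would violate \<open>wf_com\<close>, because that variable runs
  in the enclosing loop. Hence the loop visits all rows and a test selects those above the pivot
  row.\<close>

definition update_rows :: com where
  "update_rows = For 12 0 (IfPos (Bin (Atom (V 28)) Minus (V 12)) update_row Skip)"

text \<open>Rows are treated from the last one upwards, as \<open>indep_eliminate\<close> removes
  the last row. Any column may contain the pivot, so nothing is exchanged.\<close>

definition eliminate :: com where
  "eliminate = For 28 0 (find_pivot ;; IfZero (Atom (V 29)) fail Skip ;; update_rows)"

lemma run_update_entry:
  assumes "fst s 0 = int d" "fst s 12 = int i" "fst s 13 = int j" "fst s 28 = int r"
  shows "snd (run update_entry s) =
    (snd s)(loc d 3 i j := snd s (loc d 3 i j) * fst s 29 - snd s (loc d 3 r j) * fst s 31)"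
  using assms by (simp add: update_entry_def eval_idx[of _ d _ i _ j] eval_idx[of _ d 28 r _ j])

lemma run_update_row:
  assumes "fst s 0 = int d" "fst s 12 = int i" "fst s 28 = int r" "fst s 30 = int q" "i \<noteq> r" "b < d"
  shows "snd (run update_row s) (loc d 3 a b) =
    (if a = i then snd s (loc d 3 i b) * fst s 29 - snd s (loc d 3 r b) * snd s (loc d 3 i q) else snd s (loc d 3 a b))"
proof -
  let ?s = "run (Get 31 (idx 12 30 3)) s"
  have w: "fst ?s 31 = snd s (loc d 3 i q)" using assms by (simp add: eval_idx[of _ d _ i _ q])
  let ?J = "\<lambda>n s'. \<forall>a b. b < d \<longrightarrow> snd s' (loc d 3 a b) =
    (if a = i \<and> n \<le> b then snd s (loc d 3 i b) * fst s 29 - snd s (loc d 3 r b) * snd s (loc d 3 i q) else snd s (loc d 3 a b))"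
  have "?J 0 (run (For 13 0 update_entry) ?s)"
  proof (rule For_rule[where J = ?J])
    fix j s' assume j: "j < nat (fst ?s 0)" "fst s' 13 = int j" and J: "?J (Suc j) s'"
      and fr: "\<And>z. z \<notin> insert 13 (writes update_entry) \<Longrightarrow> fst s' z = fst ?s z"
    have f: "fst s' 0 = int d" "fst s' 12 = int i" "fst s' 28 = int r" "fst s' 29 = fst s 29"
      "fst s' 31 = snd s (loc d 3 i q)"
      using fr[of 0] fr[of 12] fr[of 28] fr[of 29] fr[of 31] assms w by (simp_all add: update_entry_def)
    have jd: "j < d" using j(1) assms by simp
    show "?J j (run update_entry s')"
      unfolding run_update_entry[OF f(1,2) j(2) f(3)] using J jd assms(5) by (auto simp: f loc_eq_iff)
  qed (use assms in auto)
  then show ?thesis using assms(6) by (auto simp: update_row_def simp del: run.simps(8))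
qed

lemma run_update_rows:
  assumes "fst s 0 = int d" "fst s 28 = int r" "fst s 30 = int q" "q < d" "r < d" "a < r" "b < d"
  shows "snd (run update_rows s) (loc d 3 a b) =
    snd s (loc d 3 a b) * fst s 29 - snd s (loc d 3 r b) * snd s (loc d 3 a q)"
proof -
  let ?c = "IfPos (Bin (Atom (V 28)) Minus (V 12)) update_row Skip"
  let ?J = "\<lambda>n s'. \<forall>a b. b < d \<longrightarrow> snd s' (loc d 3 a b) =
    (if n \<le> a \<and> a < r then snd s (loc d 3 a b) * fst s 29 - snd s (loc d 3 r b) * snd s (loc d 3 a q) else snd s (loc d 3 a b))"
  have "?J 0 (run update_rows s)"
    unfolding update_rows_def
  proof (rule For_rule[where J = ?J])
    fix i s' assume i: "i < nat (fst s 0)" "fst s' 12 = int i" and J: "?J (Suc i) s'"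
      and fr: "\<And>z. z \<notin> insert 12 (writes ?c) \<Longrightarrow> fst s' z = fst s z"
    have f: "fst s' 0 = int d" "fst s' 28 = int r" "fst s' 29 = fst s 29" "fst s' 30 = int q"
      using fr[of 0] fr[of 28] fr[of 29] fr[of 30] assms by (simp_all add: update_row_def update_entry_def)
    show "?J i (run ?c s')"
    proof (cases "i < r")
      case True
      then have "run ?c s' = run update_row s'" using f i(2) by simp
      moreover have "i \<noteq> r" using True by simp
      ultimately show ?thesis using J assms(4) True
        by (auto simp: run_update_row[OF f(1) i(2) f(2,4)] f(3))
    next
      case False
      then have "run ?c s' = s'" using f i(2) by simp
      then show ?thesis using J False by auto
    qed
  qed (use assms in auto)
  then show ?thesis using assms by simp
qed

lemma writes_elimination:
  "writes find_pivot = {10, 13, 29, 30}" "\<not> puts find_pivot" "writes update_rows = {10, 11, 12, 13, 31}"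
  by (auto simp: find_pivot_def update_rows_def update_row_def update_entry_def)

lemma run_eliminate:
  assumes "fst s 0 = int d"
  shows "fst (run eliminate s) 3 = 0 \<longleftrightarrow>
    fst s 3 = 0 \<and> indep d d (\<lambda>i j. of_int (snd s (loc d 3 i j)) :: rat)"
proof -
  let ?A = "\<lambda>s i j. of_int (snd s (loc d 3 i j)) :: rat"
  let ?c = "find_pivot ;; IfZero (Atom (V 29)) fail Skip ;; update_rows"
  \<comment> \<open>The original question stays equivalent to the remaining one: the flag is clear
    and the first \<open>n\<close> rows of the current matrix are independent.\<close>
  let ?J = "\<lambda>n s'. fst s 3 = 0 \<and> indep d d (?A s) \<longleftrightarrow> fst s' 3 = 0 \<and> indep n d (?A s')"
  have "?J 0 (run eliminate s)"
    unfolding eliminate_def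
  proof (rule For_rule[where J = ?J])
    fix r s' assume r: "r < nat (fst s 0)" "fst s' 28 = int r" and J: "?J (Suc r) s'"
      and fr: "\<And>z. z \<notin> insert 28 (writes ?c) \<Longrightarrow> fst s' z = fst s z"
    have f: "fst s' 0 = int d" using fr[of 0] assms by (simp add: writes_elimination fail_def)
    have rd: "r < d" using r(1) assms by simp
    let ?s = "run find_pivot s'"
    have g: "fst ?s 0 = int d" "fst ?s 28 = int r" "fst ?s 3 = fst s' 3" "snd ?s = snd s'"
      using f r(2) by (simp_all add: run_frame run_no_puts writes_elimination)
    have flag: "fst (run update_rows t) 3 = fst t 3" for t by (simp add: run_frame writes_elimination)
    show "?J r (run ?c s')"
    proof (cases "fst ?s 29 = 0")
      case True
      then have "snd s' (loc d 3 r j) = 0" if "j < d" for j using run_find_pivot(1)[OF f r(2)] that by blast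
      then have "\<not> indep (Suc r) d (?A s')" by (intro not_indep_zero_row) simp
      moreover have "fst (run ?c s') 3 \<noteq> 0" using True by (simp add: flag fail_def)
      ultimately show ?thesis using J by blast
    next
      case False
      then obtain q where q: "q < d" "fst ?s 30 = int q" "fst ?s 29 = snd s' (loc d 3 r q)"
        using run_find_pivot(2)[OF f r(2)] by blast
      have run: "run ?c s' = run update_rows ?s" using False by simp
      have "indep (Suc r) d (?A s') \<longleftrightarrow> indep r d (\<lambda>i j. ?A s' i j * ?A s' r q - ?A s' r j * ?A s' i q)"
        using False q by (intro indep_eliminate) auto
      also have "\<dots> \<longleftrightarrow> indep r d (?A (run ?c s'))"
        unfolding run by (rule indep_cong) (simp add: run_update_rows[OF g(1,2) q(2,1) rd] q(3) g(4))
      finally have "indep (Suc r) d (?A s') \<longleftrightarrow> indep r d (?A (run ?c s'))" .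
      moreover have "fst (run ?c s') 3 = fst s' 3" unfolding run flag g(3) ..
      ultimately show ?thesis using J by simp
    qed
  qed (use assms in auto)
  then show ?thesis by (simp add: indep_0)
qed

subsection \<open>The complete procedure\<close>

text \<open>The vertices precede the elimination because the latter overwrites the vectors in the
  array.\<close>

definition tests :: "int \<Rightarrow> nat \<Rightarrow> com" where
  "tests lo p = checks ;; denoms ;; scale ;; vertices lo p ;; eliminate ;;
     IfZero (Atom (V 3)) (Asg 2 (Atom (C 1))) (Asg 2 (Atom (C 0)))"

text \<open>\<open>two_power\<close> is split off since it writes variable 15, a loop limit that
  \<open>tests\<close> leaves unchanged. Thus \<open>bnd_polynomial\<close> applies to both
  halves.\<close>

definition decide :: "int \<Rightarrow> nat \<Rightarrow> com" where
  "decide lo p = two_power ;; tests lo p"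

lemmas program_defs = tests_def checks_def denoms_def denoms_row_def scale_def scale_row_def scale_entry_def
  vertices_def eliminate_def find_pivot_def update_rows_def update_row_def update_entry_def fail_def

text \<open>A word that ends inside a number leaves variable 4 nonzero; \<open>checks\<close> turns
  this into an error flag, which all later stages keep.\<close>

lemma decide_fail:
  assumes "fst s 3 \<noteq> 0 \<or> fst s 4 \<noteq> 0"
  shows "fst (run (decide lo p) s) 2 = 0"
proof -
  let ?s = "run checks (run two_power s)"
  have "fst (run two_power s) z = fst s z" if "z \<in> {3, 4}" for z
    by (rule run_frame) (use that in \<open>auto simp: two_power_def\<close>)
  then have 1: "fst ?s 3 \<noteq> 0" using assms by (auto simp: run_checks(1))
  have "keeps_fail (denoms ;; scale ;; vertices lo p ;; eliminate)"
    using mul_times_syntax[of 23 14 p] try_vertex_syntax[of lo p] by (simp add: program_defs)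
  then have "fst (run (denoms ;; scale ;; vertices lo p ;; eliminate) ?s) 3 \<noteq> 0"
    using 1 by (rule run_keeps_fail)
  then show ?thesis by (simp add: decide_def tests_def)
qed

lemma decide_correct:
  assumes "at_sign zs s" "fst s 0 = int d"
  shows "fst (run (decide lo p) s) 2 = (if d \<ge> 1 \<and> length zs = 3 + 2 * (d * d) \<and> zs ! 0 = int d
    \<and> (\<forall>q<1 + d * d. denom zs q > 0) \<and> indep d d (\<lambda>i j. of_int (scaled d zs i j) :: rat)
    \<and> (\<exists>S\<subseteq>{..<d}. denom zs 0 * (\<Sum>j<d. \<bar>\<Sum>i<d. (if i \<in> S then 1 else lo) * scaled d zs i j\<bar> ^ p)
        \<ge> numer zs 0 * common_denom d zs ^ p) then 1 else 0)" (is "_ = (if ?R then 1 else 0)")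
proof -
  define s1 where "s1 = run two_power s"
  define s2 where "s2 = run checks s1"
  define s3 where "s3 = run denoms s2"
  define s4 where "s4 = run scale s3"
  define s5 where "s5 = run (vertices lo p) s4"
  define s6 where "s6 = run eliminate s5"
  have "run (decide lo p) s = run (IfZero (Atom (V 3)) (Asg 2 (Atom (C 1))) (Asg 2 (Atom (C 0)))) s6"
    by (simp only: decide_def tests_def run.simps(5) s1_def s2_def s3_def s4_def s5_def s6_def)
  then have result: "fst (run (decide lo p) s) 2 = (if fst s6 3 = 0 then 1 else 0)" by simp
  have s1: "fst s1 z = fst s z" if "z \<in> {0, 3, 4, 9}" for z
    unfolding s1_def by (rule run_frame) (use that in \<open>auto simp: two_power_def\<close>)
  have s1_mem: "snd s1 = snd s" unfolding s1_def by (rule run_no_puts) (simp add: two_power_def)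
  have s2: "fst s2 z = fst s1 z" if "z \<in> {0, 15}" for z
    unfolding s2_def by (rule run_frame) (use that in \<open>auto simp: checks_def fail_def\<close>)
  have s3: "fst s3 z = fst s2 z" if "z \<in> {0, 15, 20, 21}" for z
    unfolding s3_def by (rule run_frame) (use that in \<open>auto simp: denoms_def denoms_row_def fail_def\<close>)
  have s3_mem: "snd s3 = snd s2" unfolding s3_def
    by (rule run_no_puts) (simp add: denoms_def denoms_row_def fail_def)
  have s4: "fst s4 z = fst s3 z" if "z \<in> {0, 3, 14, 15, 20, 21}" for z
    unfolding s4_def by (rule run_frame) (use that in \<open>auto simp: scale_def scale_row_def scale_entry_def\<close>)
  have "0 \<notin> writes (vertices lo p)"
    using mul_times_syntax(1)[of 23 14 p] try_vertex_syntax(1)[of lo p] by (auto simp: vertices_def fail_def)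
  then have s5: "fst s5 0 = fst s4 0" unfolding s5_def by (rule run_frame)
  have d: "fst s1 0 = int d" "fst s2 0 = int d" "fst s3 0 = int d" "fst s4 0 = int d" "fst s5 0 = int d"
    using assms(2) s1 s2 s3 s4 s5 by simp_all
  have E: "fst s4 15 = 2 ^ d"
    using run_two_power[OF assms(2)] s2 s3 s4 by (simp add: s1_def)
  have s2_vals: "fst s2 20 = snd s 1" "fst s2 21 = snd s 2" "snd s2 = snd s"
    unfolding s2_def by (simp_all add: run_checks s1_mem)
  have mem: "snd s i = zs ! i" if "i < length zs" for i
    using assms(1) that by (simp add: at_sign_def stored_def)
  let ?W = "d \<ge> 1 \<and> length zs = 3 + 2 * (d * d) \<and> zs ! 0 = int d \<and> denom zs 0 > 0"
  have "fst s2 3 = 0 \<longleftrightarrow> int d * int d * 2 + 3 = int (length zs) \<and> snd s 0 = int d \<and> d > 0 \<and> snd s 2 > 0"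
    unfolding s2_def run_checks(1) s1_mem using s1 assms by (auto simp: at_sign_def stored_def)
  also have "int d * int d * 2 + 3 = int (length zs) \<longleftrightarrow> length zs = 3 + 2 * (d * d)"
    by (simp flip: of_nat_mult) linarith
  also have "(length zs = 3 + 2 * (d * d) \<and> snd s 0 = int d \<and> d > 0 \<and> snd s 2 > 0) \<longleftrightarrow> ?W"
  proof -
    have "snd s 0 = zs ! 0 \<and> snd s 2 = zs ! 2" if "length zs = 3 + 2 * (d * d)" using mem that by simp
    then show ?thesis by (auto simp: denom_def)
  qed
  finally have W: "fst s2 3 = 0 \<longleftrightarrow> ?W" .
  have flag3: "fst s3 3 = 0 \<longleftrightarrow> fst s2 3 = 0 \<and> (\<forall>i<d. \<forall>j<d. snd s (loc d 4 i j) > 0)"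
    and D: "fst s3 14 = (\<Prod>i<d. \<Prod>j<d. snd s (loc d 4 i j))"
    using run_denoms[OF d(2)] s2_vals(3) by (simp_all add: s3_def)
  have flag5: "fst s5 3 = 0 \<longleftrightarrow> fst s4 3 = 0 \<and> (\<exists>e<2 ^ d. fst s4 20 * fst s4 14 ^ p \<le>
      fst s4 21 * (\<Sum>j<d. \<bar>\<Sum>i<d. coeff lo d e i * snd s4 (loc d 3 i j)\<bar> ^ p))"
    and s5_mem: "snd s5 = snd s4"
    using run_vertices[OF d(4) E, of lo p] by (simp_all add: s5_def)
  have flag6: "fst s6 3 = 0 \<longleftrightarrow> fst s5 3 = 0 \<and> indep d d (\<lambda>i j. of_int (snd s5 (loc d 3 i j)) :: rat)"
    using run_eliminate[OF d(5)] by (simp add: s6_def)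
  have "fst s6 3 = 0 \<longleftrightarrow> ?R"
  proof (cases ?W)
    \<comment> \<open>Here the array need not hold an instance, so the results of later stages are
      not interpreted; only the persistence of the flag is used.\<close>
    case False
    then have "fst s2 3 \<noteq> 0" unfolding W .
    then have "fst s3 3 \<noteq> 0" using flag3 by blast
    then have "fst s4 3 \<noteq> 0" using s4[of 3] by simp
    then have "fst s6 3 \<noteq> 0" using flag5 flag6 by blast
    moreover have "\<not> ?R" using False by auto
    ultimately show ?thesis by blast
  next
    case True
    have m: "snd s (loc d 3 i j) = numer zs (1 + (i * d + j))" "snd s (loc d 4 i j) = denom zs (1 + (i * d + j))"
      if "i < d" "j < d" for i j
      using that True loc_less[OF that, of 3] loc_less[OF that, of 4] mem by (simp_all add: loc_zs)
    have cd: "fst s3 14 = common_denom d zs" unfolding D common_denom_def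
      by (intro prod.cong refl) (simp add: m)
    have sc: "snd s4 (loc d 3 i j) = scaled d zs i j" if "i < d" "j < d" for i j
      unfolding s4_def run_scale[OF d(3) that] s3_mem s2_vals(3) m[OF that] cd scaled_def ..
    have vals: "fst s4 20 = numer zs 0" "fst s4 21 = denom zs 0" "fst s4 14 = common_denom d zs"
      using s4 s3 s2_vals mem[of 1] mem[of 2] True cd by (simp_all add: numer_def denom_def)
    have 1: "fst s4 3 = 0 \<longleftrightarrow> (\<forall>q<1 + d * d. denom zs q > 0)"
      using s4[of 3] flag3 W True m unfolding all_square_iff[of d "\<lambda>q. denom zs q > 0"] by auto
    have 2: "indep d d (\<lambda>i j. of_int (snd s5 (loc d 3 i j)) :: rat) = indep d d (\<lambda>i j. of_int (scaled d zs i j) :: rat)"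
      by (rule indep_cong) (simp add: s5_mem sc)
    let ?Q = "\<lambda>f. numer zs 0 * common_denom d zs ^ p \<le> denom zs 0 * (\<Sum>j<d. \<bar>\<Sum>i<d. f i * scaled d zs i j\<bar> ^ p)"
    have "(\<Sum>j<d. \<bar>\<Sum>i<d. coeff lo d e i * snd s4 (loc d 3 i j)\<bar> ^ p) =
        (\<Sum>j<d. \<bar>\<Sum>i<d. (if i < d then coeff lo d e i else lo) * scaled d zs i j\<bar> ^ p)" for e
      by (intro sum.cong refl arg_cong[where f = "\<lambda>x. \<bar>x\<bar> ^ p"]) (simp add: sc)
    then have "fst s5 3 = 0 \<longleftrightarrow> fst s4 3 = 0 \<and> (\<exists>e<2 ^ d. ?Q (\<lambda>i. if i < d then coeff lo d e i else lo))"
      unfolding flag5 vals by simp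
    also have "\<dots> \<longleftrightarrow> fst s4 3 = 0 \<and> (\<exists>S\<subseteq>{..<d}. ?Q (\<lambda>i. if i \<in> S then 1 else lo))"
      unfolding coeff_subset[of d ?Q lo] ..
    finally show ?thesis unfolding flag6 2 1 using True by blast
  qed
  then show ?thesis unfolding result by simp
qed

section \<open>Bounds for the complete procedure and conclusion\<close>

lemma stage_syntax:
  "wf_com two_power" "limits two_power = {0}" "writes two_power = {12, 15}"
  "wf_com checks" "limits checks = {}" "0 \<notin> writes checks" "15 \<notin> writes checks"
  "wf_com denoms" "limits denoms = {0}" "0 \<notin> writes denoms" "15 \<notin> writes denoms"
  "wf_com scale" "limits scale = {0}" "0 \<notin> writes scale" "15 \<notin> writes scale"
  "wf_com eliminate" "limits eliminate = {0}" "0 \<notin> writes eliminate" "15 \<notin> writes eliminate"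
  by (simp_all add: program_defs two_power_def insert_commute)

lemma vertices_syntax:
  "wf_com (vertices lo p)" "limits (vertices lo p) = {0, 15}" "0 \<notin> writes (vertices lo p)" "15 \<notin> writes (vertices lo p)"
proof -
  have "0 \<notin> writes (mul_times 23 14 p)" "15 \<notin> writes (mul_times 23 14 p)"
    using mul_times_syntax(1)[of 23 14 p] by auto
  moreover have "0 \<notin> writes (try_vertex lo p)" "15 \<notin> writes (try_vertex lo p)" "16 \<notin> writes (try_vertex lo p)"
    using try_vertex_syntax(1)[of lo p] by auto
  ultimately show "wf_com (vertices lo p)" "limits (vertices lo p) = {0, 15}" "0 \<notin> writes (vertices lo p)" "15 \<notin> writes (vertices lo p)"
    by (simp_all add: vertices_def fail_def mul_times_syntax try_vertex_syntax insert_commute)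
qed

text \<open>The limits are k and \<open>2 ^ k\<close>, and \<open>k + 1 <= 2 ^ k\<close>, so
  polynomials in them take the form that \<open>FPT_criterion\<close> expects.\<close>

lemma decide_bounds:
  "\<exists>A e. \<forall>fl s k. fst s 0 = int k \<longrightarrow> bnd fl (decide lo p) s \<le> A * 2 ^ (e * k)"
proof -
  have w: "wf_com two_power" "limits two_power \<inter> writes two_power = {}" "limits two_power = {0}"
    by (simp_all add: stage_syntax)
  have t: "wf_com (tests lo p)" "limits (tests lo p) \<inter> writes (tests lo p) = {}" "limits (tests lo p) = {0, 15}"
    by (auto simp: tests_def stage_syntax vertices_syntax)
  have "\<exists>A e. \<forall>s k. fst s 0 = int k \<longrightarrow> bnd fl (decide lo p) s \<le> A * 2 ^ (e * k)" for fl
  proof -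
    obtain A1 e1 where 1: "\<And>s X. \<forall>x\<in>limits two_power. nat (fst s x) \<le> X \<Longrightarrow> bnd fl two_power s \<le> A1 * (X + 1) ^ e1"
      using bnd_polynomial[OF w(1,2)] by blast
    obtain A2 e2 where 2: "\<And>s X. \<forall>x\<in>limits (tests lo p). nat (fst s x) \<le> X \<Longrightarrow> bnd fl (tests lo p) s \<le> A2 * (X + 1) ^ e2"
      using bnd_polynomial[OF t(1,2)] by blast
    have "bnd fl (decide lo p) s \<le> (A1 + A2 * 2 ^ e2) * 2 ^ ((e1 + e2) * k)" if s: "fst s 0 = int k" for s k
    proof -
      have k: "k + 1 \<le> 2 ^ k" using less_exp[of k] by (simp only: Suc_eq_plus1[symmetric] Suc_le_eq)
      have "bnd fl two_power s \<le> A1 * (k + 1) ^ e1" by (rule 1) (simp add: w(3) s)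
      also have "\<dots> \<le> A1 * (2 ^ k) ^ e1" by (intro mult_left_mono power_mono k) auto
      also have "\<dots> \<le> A1 * 2 ^ ((e1 + e2) * k)"
        by (simp add: power_mult[symmetric] mult.commute power_increasing)
      finally have b1: "bnd fl two_power s \<le> A1 * 2 ^ ((e1 + e2) * k)" .
      have "nat (2 ^ k) = 2 ^ k" by (metis nat_int of_nat_numeral of_nat_power)
      moreover have "fst (run two_power s) 0 = int k" using s by (simp add: run_frame stage_syntax)
      ultimately have "bnd fl (tests lo p) (run two_power s) \<le> A2 * (2 ^ k + 1) ^ e2"
        using run_two_power[OF s] less_exp[of k] by (intro 2) (auto simp: t(3) intro: less_imp_le)
      also have "\<dots> \<le> A2 * (2 * 2 ^ k) ^ e2" by (intro mult_left_mono power_mono) auto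
      also have "\<dots> = A2 * 2 ^ e2 * 2 ^ (e2 * k)"
        by (simp add: power_mult_distrib power_mult[symmetric] mult.commute)
      also have "\<dots> \<le> A2 * 2 ^ e2 * 2 ^ ((e1 + e2) * k)" by (intro mult_left_mono power_increasing) auto
      finally show ?thesis using b1 by (simp add: decide_def algebra_simps)
    qed
    then show ?thesis by blast
  qed
  then obtain A e where Ae: "\<And>fl s k. fst s 0 = int k \<Longrightarrow> bnd fl (decide lo p) s \<le> A fl * 2 ^ (e fl * k)"
    by metis
  \<comment> \<open>Adding the constants for the two values of \<open>fl\<close> yields one pair for
    both counts.\<close>
  have "bnd fl (decide lo p) s \<le> (A True + A False) * 2 ^ ((e True + e False) * k)" if "fst s 0 = int k" for fl s k
  proof -
    have "A fl \<le> A True + A False" "e fl \<le> e True + e False" by (cases fl; simp)+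
    then have "A fl * 2 ^ (e fl * k) \<le> (A True + A False) * 2 ^ ((e True + e False) * k)"
      by (intro mult_mono power_increasing) auto
    then show ?thesis using Ae[OF that, of fl] by linarith
  qed
  then show ?thesis by blast
qed

lemma Parmax_in_FPT:
  assumes "p \<ge> 1" "lo < 1"
  shows "Parmax (of_int lo) 1 p \<in> FPT"
proof -
  have parser: "wf_com parser" "limits parser \<inter> writes parser = {}" "limits parser = {}"
    by (simp_all add: parser_def fail_def)
  \<comment> \<open>The parser has no loops, so its polynomial bound with a fixed \<open>X\<close>
    is a constant per letter.\<close>
  obtain B where B: "\<And>s. bnd True parser s \<le> B"
    using bnd_polynomial[OF parser(1,2), of True] parser(3) by (metis empty_iff)
  obtain A e where Ae: "\<And>fl s k. fst s 0 = int k \<Longrightarrow> bnd fl (decide lo p) s \<le> A * 2 ^ (e * k)"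
    using decide_bounds by blast
  show ?thesis
  proof (rule FPT_criterion)
    show "wf_com parser" by fact
    show "wf_com (decide lo p)"
      by (simp add: decide_def tests_def stage_syntax vertices_syntax)
    show "bnd True parser s \<le> B" for s by (rule B)
    show "bnd False parser s = 0" for s by (simp add: parser_def fail_def)
    fix k w
    let ?s = "after_input parser (int k) (letters w)"
    have k: "fst ?s 0 = int k" by (rule parser_correct(3))
    then show "bnd fl (decide lo p) ?s \<le> A * 2 ^ (e * k)" for fl by (rule Ae)
    show "fst (run (decide lo p) ?s) 2 = (if (w, k) \<in> Parmax (of_int lo) 1 p then 1 else 0)"
    proof (cases "(w, k) \<in> Parmax (of_int lo) 1 p")
      case True
      then obtain zs where zs: "w = encode_list zs" and R: "k \<ge> 1 \<and> length zs = 3 + 2 * (k * k) \<and> zs ! 0 = int k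
        \<and> (\<forall>q<1 + k * k. denom zs q > 0) \<and> indep k k (\<lambda>i j. of_int (scaled k zs i j) :: rat)
        \<and> (\<exists>S\<subseteq>{..<k}. denom zs 0 * (\<Sum>j<k. \<bar>\<Sum>i<k. (if i \<in> S then 1 else lo) * scaled k zs i j\<bar> ^ p)
          \<ge> numer zs 0 * common_denom k zs ^ p)"
        unfolding Parmax_iff[OF assms] by blast
      show ?thesis unfolding decide_correct[OF parser_correct(1)[OF zs] k] if_P[OF R] if_P[OF True] ..
    next
      case False
      show ?thesis
      proof (cases "fst ?s 3 = 0 \<and> fst ?s 4 = 0")
        case True
        then obtain zs where zs: "w = encode_list zs" using parser_correct(2) by blast
        have "\<not> (k \<ge> 1 \<and> length zs = 3 + 2 * (k * k) \<and> zs ! 0 = int k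
          \<and> (\<forall>q<1 + k * k. denom zs q > 0) \<and> indep k k (\<lambda>i j. of_int (scaled k zs i j) :: rat)
          \<and> (\<exists>S\<subseteq>{..<k}. denom zs 0 * (\<Sum>j<k. \<bar>\<Sum>i<k. (if i \<in> S then 1 else lo) * scaled k zs i j\<bar> ^ p)
            \<ge> numer zs 0 * common_denom k zs ^ p))"
          using False zs unfolding Parmax_iff[OF assms] by blast
        then show ?thesis unfolding decide_correct[OF parser_correct(1)[OF zs] k] using False by (simp only: if_False)
      next
        case fails: False
        then have "fst (run (decide lo p) ?s) 2 = 0" by (intro decide_fail) blast
        then show ?thesis using False by simp
      qed
    qed
  qed
qed

theorem mainTheorem4:
  fixes p :: nat
  assumes "p \<ge> 1"
  shows "Parmax 0 1 p \<in> FPT \<and> Parmax (-1) 1 p \<in> FPT"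
  using Parmax_in_FPT[OF assms, of 0] Parmax_in_FPT[OF assms, of "-1"] by simp

end
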